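(* Let $M$ be an $n|m$-dimensional supermanifold with $n-m\notin\{-1,-3\}$, endowed with a projective class $\Pi^k_{ij}$ and a symmetric tensor field $S^{ij}$ of parity $\tilde S$. (1) The local expression $$S^{ij}\partial_j\partial_i+\left(\frac{2}{n-m+3}\,\partial_jS^{ji}(-1)^{\tilde\jmath(\tilde S+1)}-\frac{n-m+1}{n-m+3}\,S^{jk}\Pi^i_{kj}\right)\partial_i$$ is independent of the choice of local coordinates, i.e. it defines an invariant differential operator on $C^\infty(M)$. (2) The functions $$\gamma^i=\frac{n-m+1}{n-m+3}\left(\partial_jS^{ji}(-1)^{\tilde\jmath(\tilde S+1)}+S^{jk}\Pi^i_{kj}\right)$$ are the coefficients of an upper connection over $S^{ij}$ in the bundle of volume forms on $M$.
   Context: Local coordinates on $M$ are $x^i$, $\tilde\imath\in\{0,1\}$ is the parity of $x^i$, $\partial_i=\partial/\partial x^i$ are left derivatives, and repeated indices are summed. For a coordinate change $x\mapsto x'$ write $J=|\mathrm{Ber}(\partial x'/\partial x)|$. Linear connections on $TM$ have coefficients $\nabla_{\partial_i}\partial_j=\Gamma^k_{ij}\partial_k$ and are symmetric: $\Gamma^k_{ij}=(-1)^{\tilde\imath\tilde\jmath}\Gamma^k_{ji}$. For $n-m\ne -1$ put $$\Pi^k_{ji}=\Gamma^k_{ji}-\frac{1}{n-m+1}\left(\Gamma^s_{js}\delta^k_i(-1)^{\tilde s}+\Gamma^s_{is}\delta^k_j(-1)^{\tilde\imath\tilde\jmath+\tilde s}\right).$$ Two symmetric linear connections define the same projective class if their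 $\Pi^k_{ji}$ coincide in all coordinate systems; the projective class is identified with the $\Pi^k_{ji}$. A symmetric tensor field $S^{ij}$ of parity $\tilde S$ has components of parity $\tilde S+\tilde\imath+\tilde\jmath$ with $S^{ij}=(-1)^{\tilde\imath\tilde\jmath}S^{ji}$, transforming so that $S^{ij}p_jp_i$ is a well-defined fibrewise quadratic function on $T^*M$, where $p_i$ are the momenta conjugate to $x^i$ (so $p_i=\frac{\partial x^{i'}}{\partial x^i}p_{i'}$). Volume forms are sections of the Berezinian bundle, locally $f|Dx|$ with $|Dx|$ the local coordinate Berezin volume element, and $|Dx'|=J\,|Dx|$. An upper connection (contravariant derivative) over $S^{ij}$ in the bundle of volume forms is given locally by operators $\nabla^i(f|Dx|)=(S^{ij}\partial_jf+\gamma^if)|Dx|$, where the coefficients $\gamma^i$ have parity $\tilde S+\tilde\imath$ and, under a change of coordinates, transform as $\gamma^{i'}=(\gamma^i+S^{ij}\partial_j\log J)\,\frac{\partial x^{i'}}{\partial x^i}$. *)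

theory Defs
  imports "HOL-Analysis.Analysis"
begin

section \<open>Grassmann algebra\<close>

text \<open>The Grassmann algebra on generators \<open>\<theta>\<^sub>0, \<theta>\<^sub>1, \<dots>\<close> over the reals (formal infinite sums of
  monomials are allowed). An element is the family of its coefficients at the monomials
  \<open>\<theta>\<^sub>I = \<theta>\<^sub>i \<theta>\<^sub>j \<dots>\<close>, for \<open>I = {i < j < \<dots>}\<close> finite. Functions on an \<open>n|m\<close>-dimensional supermanifold
  only involve \<open>\<theta>\<^sub>k\<close> with \<open>k < m\<close>; the further generators serve as independent odd constants, see
  \<open>symmetric_tensor\<close>.\<close>

typedef grassmann = "{f :: nat set \<Rightarrow> real. \<forall>I. infinite I \<longrightarrow> f I = 0}"
  morphisms gcoeff Abs_grassmann
  by (rule exI[of _ "\<lambda>_. 0"]) simp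

setup_lifting type_definition_grassmann

text \<open>The sign in \<open>\<theta>\<^sub>I \<theta>\<^sub>J = gsign I J \<theta>\<^bsub>I \<union> J\<^esub>\<close> for disjoint \<open>I\<close> and \<open>J\<close>.\<close>

definition gsign :: "nat set \<Rightarrow> nat set \<Rightarrow> real" where
  "gsign I J = (- 1) ^ card {(i, j). i \<in> I \<and> j \<in> J \<and> j < i}"

lemma finite_gsign:
  fixes I J :: "nat set"
  assumes "finite I" "finite J"
  shows "finite {(i, j). i \<in> I \<and> j \<in> J \<and> j < i}"
  by (rule finite_subset[of _ "I \<times> J"]) (use assms in auto)

lemma gsign_empty [simp]: "gsign {} J = 1" "gsign I {} = 1"
  by (simp_all add: gsign_def)

lemma gsign_Un_right:
  assumes "finite I" "finite J" "finite K" "J \<inter> K = {}"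
  shows "gsign I (J \<union> K) = gsign I J * gsign I K"
proof -
  have "{(i, j). i \<in> I \<and> j \<in> J \<union> K \<and> j < i} =
      {(i, j). i \<in> I \<and> j \<in> J \<and> j < i} \<union> {(i, j). i \<in> I \<and> j \<in> K \<and> j < i}" by auto
  moreover have "card (\<dots>) =
      card {(i, j). i \<in> I \<and> j \<in> J \<and> j < i} + card {(i, j). i \<in> I \<and> j \<in> K \<and> j < i}"
    by (rule card_Un_disjoint) (use assms finite_gsign in auto)
  ultimately show ?thesis by (simp add: gsign_def power_add)
qed

lemma gsign_Un_left:
  assumes "finite I" "finite J" "finite K" "I \<inter> J = {}"
  shows "gsign (I \<union> J) K = gsign I K * gsign J K"
proof -
  have "{(i, j). i \<in> I \<union> J \<and> j \<in> K \<and> j < i} =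
      {(i, j). i \<in> I \<and> j \<in> K \<and> j < i} \<union> {(i, j). i \<in> J \<and> j \<in> K \<and> j < i}" by auto
  moreover have "card (\<dots>) =
      card {(i, j). i \<in> I \<and> j \<in> K \<and> j < i} + card {(i, j). i \<in> J \<and> j \<in> K \<and> j < i}"
    by (rule card_Un_disjoint) (use assms finite_gsign in auto)
  ultimately show ?thesis by (simp add: gsign_def power_add)
qed

instantiation grassmann :: real_algebra_1
begin

lift_definition zero_grassmann :: grassmann is "\<lambda>_. 0" by simp
lift_definition one_grassmann :: grassmann is "\<lambda>I. if I = {} then 1 else 0" by auto
lift_definition plus_grassmann :: "grassmann \<Rightarrow> grassmann \<Rightarrow> grassmann" is "\<lambda>a b I. a I + b I" by simp
lift_definition minus_grassmann :: "grassmann \<Rightarrow> grassmann \<Rightarrow> grassmann" is "\<lambda>a b I. a I - b I" by simp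
lift_definition uminus_grassmann :: "grassmann \<Rightarrow> grassmann" is "\<lambda>a I. - a I" by simp
lift_definition scaleR_grassmann :: "real \<Rightarrow> grassmann \<Rightarrow> grassmann" is "\<lambda>r a I. r * a I" by simp
lift_definition times_grassmann :: "grassmann \<Rightarrow> grassmann \<Rightarrow> grassmann" is
  "\<lambda>a b K. \<Sum>I\<in>Pow K. gsign I (K - I) * a I * b (K - I)"
  by simp

instance
proof
  fix a b c :: grassmann and r t :: real
  show "a + b + c = a + (b + c)" by transfer (simp add: add.assoc)
  show "a + b = b + a" by transfer (simp add: add.commute)
  show "0 + a = a" by transfer simp
  show "- a + a = 0" by transfer simp
  show "a - b = a + - b" by transfer simp
  show "r *\<^sub>R (a + b) = r *\<^sub>R a + r *\<^sub>R b" by transfer (simp add: algebra_simps)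
  show "(r + t) *\<^sub>R a = r *\<^sub>R a + t *\<^sub>R a" by transfer (simp add: algebra_simps)
  show "r *\<^sub>R t *\<^sub>R a = (r * t) *\<^sub>R a" by transfer (simp add: algebra_simps)
  show "1 *\<^sub>R a = a" by transfer simp
  show "(0 :: grassmann) \<noteq> 1" by transfer (auto simp: fun_eq_iff)
  show "(a + b) * c = a * c + b * c"
    by transfer (simp add: algebra_simps sum.distrib)
  show "a * (b + c) = a * b + a * c"
    by transfer (simp add: algebra_simps sum.distrib)
  show "r *\<^sub>R a * b = r *\<^sub>R (a * b)"
    by transfer (simp add: sum_distrib_left mult_ac)
  show "a * r *\<^sub>R b = r *\<^sub>R (a * b)"
    by transfer (simp add: sum_distrib_left mult_ac)
  show "1 * a = a"
  proof (transfer, rule ext)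
    fix a :: "nat set \<Rightarrow> real" and K assume a: "\<forall>I. infinite I \<longrightarrow> a I = 0"
    show "(\<Sum>I\<in>Pow K. gsign I (K - I) * (if I = {} then 1 else 0) * a (K - I)) = a K"
    proof (cases "finite K")
      case True
      then have "(\<Sum>I\<in>Pow K. gsign I (K - I) * (if I = {} then 1 else 0) * a (K - I))
          = (\<Sum>I\<in>{{}}. gsign I (K - I) * (if I = {} then 1 else 0) * a (K - I))"
        by (intro sum.mono_neutral_right) auto
      then show ?thesis by simp
    qed (use a in \<open>simp add: finite_Pow_iff\<close>)
  qed
  show "a * 1 = a"
  proof (transfer, rule ext)
    fix a :: "nat set \<Rightarrow> real" and K assume a: "\<forall>I. infinite I \<longrightarrow> a I = 0"
    show "(\<Sum>I\<in>Pow K. gsign I (K - I) * a I * (if K - I = {} then 1 else 0)) = a K"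
    proof (cases "finite K")
      case True
      then have "(\<Sum>I\<in>Pow K. gsign I (K - I) * a I * (if K - I = {} then 1 else 0))
          = (\<Sum>I\<in>{K}. gsign I (K - I) * a I * (if K - I = {} then 1 else 0))"
        by (intro sum.mono_neutral_right) auto
      then show ?thesis by simp
    qed (use a in \<open>simp add: finite_Pow_iff\<close>)
  qed
  show "a * b * c = a * (b * c)"
  proof (transfer, rule ext)
    fix a b c :: "nat set \<Rightarrow> real" and K
    show "(\<Sum>L\<in>Pow K. gsign L (K - L) * (\<Sum>I\<in>Pow L. gsign I (L - I) * a I * b (L - I)) * c (K - L))
        = (\<Sum>I\<in>Pow K. gsign I (K - I) * a I *
            (\<Sum>J\<in>Pow (K - I). gsign J (K - I - J) * b J * c (K - I - J)))" (is "?l = ?r")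
    proof (cases "finite K")
      case True
      have "?l = (\<Sum>(L, I)\<in>Sigma (Pow K) Pow.
          gsign L (K - L) * gsign I (L - I) * a I * b (L - I) * c (K - L))"
        using True by (subst sum.Sigma[symmetric])
          (auto simp: sum_distrib_left sum_distrib_right mult_ac intro: finite_subset)
      also have "\<dots> = (\<Sum>(I, J)\<in>Sigma (Pow K) (\<lambda>I. Pow (K - I)).
          gsign I (K - I) * gsign J (K - I - J) * a I * b J * c (K - I - J))"
      proof (rule sum.reindex_bij_witness[where i = "\<lambda>(I, J). (I \<union> J, I)" and j = "\<lambda>(L, I). (I, L - I)"])
        fix q assume "q \<in> Sigma (Pow K) Pow"
        then obtain L I where q: "q = (L, I)" "L \<subseteq> K" "I \<subseteq> L" by auto
        have fin: "finite I" "finite L" "finite (L - I)" "finite (K - L)"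
          using True q by (auto intro: finite_subset)
        have e1: "L = I \<union> (L - I)" and e2: "K - I = (L - I) \<union> (K - L)" and e3: "K - I - (L - I) = K - L"
          using q by auto
        have "gsign L (K - L) = gsign I (K - L) * gsign (L - I) (K - L)"
          by (subst e1, rule gsign_Un_left) (use fin in auto)
        moreover have "gsign I (K - I) = gsign I (L - I) * gsign I (K - L)"
          by (subst e2, rule gsign_Un_right) (use fin in auto)
        ultimately show "(case case q of (L, I) \<Rightarrow> (I, L - I) of (I, J) \<Rightarrow>
              gsign I (K - I) * gsign J (K - I - J) * a I * b J * c (K - I - J)) =
            (case q of (L, I) \<Rightarrow> gsign L (K - L) * gsign I (L - I) * a I * b (L - I) * c (K - L))"
          by (simp add: q(1) e3)
      qed auto
      also have "\<dots> = ?r"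
        using True by (subst sum.Sigma[symmetric])
          (auto simp: sum_distrib_left mult_ac)
      finally show ?thesis .
    qed (simp add: finite_Pow_iff)
  qed
qed

end

definition gbody :: "grassmann \<Rightarrow> real" where
  "gbody a = gcoeff a {}"

text \<open>Parities are natural numbers, of which only the residue modulo 2 matters.\<close>

definition has_parity :: "nat \<Rightarrow> grassmann \<Rightarrow> bool" where
  "has_parity k a \<longleftrightarrow> (\<forall>I. gcoeff a I \<noteq> 0 \<longrightarrow> even (card I) = even k)"

lift_definition ggen :: "nat \<Rightarrow> grassmann" is "\<lambda>k I. if I = {k} then 1 else 0"
  by auto

text \<open>The left derivative with respect to \<open>\<theta>\<^sub>k\<close>: write \<open>\<theta>\<^bsub>I \<union> {k}\<^esub>\<close> as \<open>gsign {k} I \<theta>\<^sub>k \<theta>\<^sub>I\<close>, drop \<open>\<theta>\<^sub>k\<close>.\<close>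

lift_definition gderiv_odd :: "nat \<Rightarrow> grassmann \<Rightarrow> grassmann" is
  "\<lambda>k a I. if k \<in> I then 0 else gsign {k} I * a (insert k I)"
  by simp

definition gabs :: "grassmann \<Rightarrow> grassmann" where
  "gabs a = sgn (gbody a) *\<^sub>R a"

text \<open>Logarithm of an element with positive body \<open>b\<close> in the subalgebra generated by \<open>\<theta>\<^sub>0, \<dots>, \<theta>\<^bsub>m-1\<^esub>\<close>:
  \<open>log a = ln b + log (1 + u)\<close> with \<open>u = a/b - 1\<close>, and \<open>u\<^bsup>m+1\<^esup> = 0\<close>.\<close>

definition gln :: "nat \<Rightarrow> grassmann \<Rightarrow> grassmann" where
  "gln m a = of_real (ln (gbody a)) +
    (\<Sum>k = 1..m. ((- 1) ^ (k + 1) / real k) *\<^sub>R (a /\<^sub>R gbody a - 1) ^ k)"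


section \<open>Berezinian\<close>

text \<open>A supermatrix of format \<open>n|m\<close> is a function of two indices below \<open>n + m\<close>; the
  indices below \<open>n\<close> are the even ones. Determinants are only taken of matrices with (commuting) even
  entries.\<close>

definition gdet :: "nat \<Rightarrow> (nat \<Rightarrow> nat \<Rightarrow> grassmann) \<Rightarrow> grassmann" where
  "gdet k A = (\<Sum>p | p permutes {..<k}. of_int (sign p) * prod_list (map (\<lambda>i. A i (p i)) [0..<k]))"

definition gmat_inv :: "nat \<Rightarrow> (nat \<Rightarrow> nat \<Rightarrow> grassmann) \<Rightarrow> nat \<Rightarrow> nat \<Rightarrow> grassmann" where
  "gmat_inv k A = (SOME B. \<forall>i<k. \<forall>j<k.
     (\<Sum>l<k. A i l * B l j) = (if i = j then 1 else 0) \<and>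
     (\<Sum>l<k. B i l * A l j) = (if i = j then 1 else 0))"

text \<open>\<open>Ber (A, B; C, D) = det (A - B D\<inverse> C) det D\<inverse>\<close>\<close>

definition berezinian :: "nat \<Rightarrow> nat \<Rightarrow> (nat \<Rightarrow> nat \<Rightarrow> grassmann) \<Rightarrow> grassmann" where
  "berezinian n m L =
    (let E = gmat_inv m (\<lambda>k l. L (n + k) (n + l)) in
     gdet n (\<lambda>i j. L i j - (\<Sum>k<m. \<Sum>l<m. L i (n + k) * E k l * L (n + l) j)) * gdet m E)"


section \<open>Functions on superdomains\<close>

text \<open>Points of \<open>\<real>\<^sup>n\<close> are the functions \<open>x :: nat \<Rightarrow> real\<close> vanishing at all \<open>k \<ge> n\<close>, i.e. the points of
  the library space \<open>Euclidean_space n\<close>. A function on a superdomain over the open set \<open>V\<close> of \<open>\<real>\<^sup>n\<close>, an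
  element of \<open>C\<^sup>\<infinity>(V) \<otimes> \<Lambda>(\<theta>\<^sub>0, \<dots>, \<theta>\<^bsub>m-1\<^esub>)\<close>, is represented by a map into the Grassmann algebra whose
  values outside \<open>V\<close> are irrelevant; hence restriction to smaller open sets is implicit, and two
  representatives are the same function on \<open>V\<close> iff they are equal at all points of \<open>V\<close>.\<close>

type_synonym sfun = "(nat \<Rightarrow> real) \<Rightarrow> grassmann"

definition partial :: "nat \<Rightarrow> ((nat \<Rightarrow> real) \<Rightarrow> real) \<Rightarrow> (nat \<Rightarrow> real) \<Rightarrow> real" where
  "partial k f x = deriv (\<lambda>t. f (x(k := t))) (x k)"

definition smooth :: "nat \<Rightarrow> (nat \<Rightarrow> real) set \<Rightarrow> ((nat \<Rightarrow> real) \<Rightarrow> real) \<Rightarrow> bool" where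
  "smooth n V f \<longleftrightarrow> (\<forall>ks. set ks \<subseteq> {..<n} \<longrightarrow>
     continuous_on V (foldr partial ks f) \<and>
     (\<forall>k<n. \<forall>x\<in>V. (\<lambda>t. foldr partial ks f (x(k := t))) differentiable (at (x k))))"

definition superfunctions :: "nat \<Rightarrow> nat \<Rightarrow> (nat \<Rightarrow> real) set \<Rightarrow> sfun set" where
  "superfunctions n m V =
    {F. \<forall>I. smooth n V (\<lambda>x. gcoeff (F x) I) \<and> (\<not> I \<subseteq> {..<m} \<longrightarrow> (\<forall>x\<in>V. gcoeff (F x) I = 0))}"

text \<open>Coordinates have indices below \<open>n + m\<close>, the even ones first.\<close>

definition par :: "nat \<Rightarrow> nat \<Rightarrow> nat" where
  "par n i = (if i < n then 0 else 1)"

definition coord :: "nat \<Rightarrow> nat \<Rightarrow> sfun" where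
  "coord n i x = (if i < n then of_real (x i) else ggen (i - n))"

lift_definition gpartial :: "nat \<Rightarrow> sfun \<Rightarrow> sfun" is
  "\<lambda>k F x I. if finite I then partial k (\<lambda>y. F y I) x else 0"
  by simp

definition pd :: "nat \<Rightarrow> nat \<Rightarrow> sfun \<Rightarrow> sfun" where
  "pd n i F x = (if i < n then gpartial i F x else gderiv_odd (i - n) (F x))"

definition superalgebra_hom ::
  "nat \<Rightarrow> nat \<Rightarrow> (nat \<Rightarrow> real) set \<Rightarrow> (nat \<Rightarrow> real) set \<Rightarrow> (sfun \<Rightarrow> sfun) \<Rightarrow> bool" where
  "superalgebra_hom n m V' V T \<longleftrightarrow>
    (\<forall>F \<in> superfunctions n m V'. T F \<in> superfunctions n m V \<and>
      (\<forall>k. (\<forall>y\<in>V'. has_parity k (F y)) \<longrightarrow> (\<forall>x\<in>V. has_parity k (T F x))) \<and>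
      (\<forall>r. \<forall>x\<in>V. T (\<lambda>y. r *\<^sub>R F y) x = r *\<^sub>R T F x) \<and>
      (\<forall>G \<in> superfunctions n m V'.
        ((\<forall>y\<in>V'. F y = G y) \<longrightarrow> (\<forall>x\<in>V. T F x = T G x)) \<and>
        (\<forall>x\<in>V. T (\<lambda>y. F y + G y) x = T F x + T G x) \<and>
        (\<forall>x\<in>V. T (\<lambda>y. F y * G y) x = T F x * T G x))) \<and>
    (\<forall>x\<in>V. T (\<lambda>_. 1) x = 1)"


section \<open>Supermanifolds\<close>

text \<open>A supermanifold is given by an atlas on its underlying topological space \<open>base\<close>. A chart \<open>c\<close> has
  the domain \<open>cdom c\<close>, open in \<open>base\<close>, and the map \<open>cmap c\<close> onto an open subset of \<open>\<real>\<^sup>n\<close>. The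
  coordinate change between \<open>c\<close> and \<open>d\<close> is an isomorphism of superdomains (as ringed spaces) over the
  homeomorphism \<open>cmap d \<circ> (cmap c)\<inverse>\<close>: for every open \<open>W \<subseteq> cdom c \<inter> cdom d\<close>, \<open>pull c d W\<close> expresses
  superfunctions of the coordinates \<open>d\<close> on \<open>cmap d ` W\<close> through the coordinates \<open>c\<close>.\<close>

record ('p, 'c) smfd =
  base :: "'p topology"
  charts :: "'c set"
  cdom :: "'c \<Rightarrow> 'p set"
  cmap :: "'c \<Rightarrow> 'p \<Rightarrow> nat \<Rightarrow> real"
  pull :: "'c \<Rightarrow> 'c \<Rightarrow> 'p set \<Rightarrow> sfun \<Rightarrow> sfun"

definition supermanifold :: "nat \<Rightarrow> nat \<Rightarrow> ('p, 'c) smfd \<Rightarrow> bool" where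
  "supermanifold n m M \<longleftrightarrow>
    Hausdorff_space (base M) \<and> second_countable (base M) \<and>
    (\<Union>c\<in>charts M. cdom M c) = topspace (base M) \<and>
    (\<forall>c\<in>charts M. openin (base M) (cdom M c) \<and>
      openin (Euclidean_space n) (cmap M c ` cdom M c) \<and>
      homeomorphic_map (subtopology (base M) (cdom M c))
        (subtopology (Euclidean_space n) (cmap M c ` cdom M c)) (cmap M c)) \<and>
    (\<forall>c\<in>charts M. \<forall>d\<in>charts M. \<forall>W. openin (base M) W \<and> W \<subseteq> cdom M c \<inter> cdom M d \<longrightarrow>
      superalgebra_hom n m (cmap M d ` W) (cmap M c ` W) (pull M c d W) \<and>
      (\<forall>F \<in> superfunctions n m (cmap M d ` W). \<forall>p\<in>W.
        gbody (pull M c d W F (cmap M c p)) = gbody (F (cmap M d p)) \<and>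
        (\<forall>W'. openin (base M) W' \<and> W' \<subseteq> W \<and> p \<in> W' \<longrightarrow>
          pull M c d W' F (cmap M c p) = pull M c d W F (cmap M c p)))) \<and>
    (\<forall>c\<in>charts M. \<forall>W. openin (base M) W \<and> W \<subseteq> cdom M c \<longrightarrow>
      (\<forall>F \<in> superfunctions n m (cmap M c ` W). \<forall>p\<in>W.
        pull M c c W F (cmap M c p) = F (cmap M c p))) \<and>
    (\<forall>c\<in>charts M. \<forall>d\<in>charts M. \<forall>e\<in>charts M. \<forall>W.
      openin (base M) W \<and> W \<subseteq> cdom M c \<inter> cdom M d \<inter> cdom M e \<longrightarrow>
      (\<forall>F \<in> superfunctions n m (cmap M e ` W). \<forall>p\<in>W.
        pull M c d W (pull M d e W F) (cmap M c p) = pull M c e W F (cmap M c p)))"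

text \<open>Sections over an open set \<open>W\<close> of the structure sheaf: compatible families of local
  expressions. For \<open>W = topspace (base M)\<close> this is \<open>C\<^sup>\<infinity>(M)\<close>.\<close>

definition sections :: "nat \<Rightarrow> nat \<Rightarrow> ('p, 'c) smfd \<Rightarrow> 'p set \<Rightarrow> ('c \<Rightarrow> sfun) set" where
  "sections n m M W = {f.
    (\<forall>c\<in>charts M. f c \<in> superfunctions n m (cmap M c ` (W \<inter> cdom M c))) \<and>
    (\<forall>c\<in>charts M. \<forall>d\<in>charts M. \<forall>p \<in> W \<inter> cdom M c \<inter> cdom M d.
      pull M c d (W \<inter> cdom M c \<inter> cdom M d) (f d) (cmap M c p) = f c (cmap M c p))}"

text \<open>Below, \<open>c\<close> is the chart with coordinates \<open>x\<close> and \<open>d\<close> the one with coordinates \<open>x'\<close>; everything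
  is written as superfunctions of \<open>x\<close>. In particular \<open>jac n M c d i i'\<close> is \<open>\<partial>x\<^bsup>i'\<^esup>/\<partial>x\<^sup>i\<close>.\<close>

abbreviation pullback :: "('p, 'c) smfd \<Rightarrow> 'c \<Rightarrow> 'c \<Rightarrow> sfun \<Rightarrow> sfun" where
  "pullback M c d \<equiv> pull M c d (cdom M c \<inter> cdom M d)"

definition jac :: "nat \<Rightarrow> ('p, 'c) smfd \<Rightarrow> 'c \<Rightarrow> 'c \<Rightarrow> nat \<Rightarrow> nat \<Rightarrow> sfun" where
  "jac n M c d i i' = pd n i (pullback M c d (coord n i'))"

definition log_J :: "nat \<Rightarrow> nat \<Rightarrow> ('p, 'c) smfd \<Rightarrow> 'c \<Rightarrow> 'c \<Rightarrow> sfun" where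
  "log_J n m M c d x = gln m (gabs (berezinian n m (\<lambda>i i'. jac n M c d i i' x)))"


section \<open>Geometric structures\<close>

text \<open>\<open>\<Gamma> c k i j\<close> is \<open>\<Gamma>\<^sup>k\<^bsub>ij\<^esub>\<close> in the chart \<open>c\<close>. The transformation law is obtained by inserting
  \<open>\<partial>\<^sub>i = a\<^sub>i\<^bsup>i'\<^esup> \<partial>\<^bsub>i'\<^esub>\<close>, \<open>a\<^sub>i\<^bsup>i'\<^esup> = \<partial>x\<^bsup>i'\<^esup>/\<partial>x\<^sup>i\<close>, into \<open>\<nabla>\<^bsub>\<partial>\<^sub>i\<^esub> \<partial>\<^sub>j = \<Gamma>\<^sup>k\<^bsub>ij\<^esub> \<partial>\<^sub>k\<close>: the right-hand side is
  \<open>\<Gamma>\<^sup>k\<^bsub>ij\<^esub> a\<^sub>k\<^bsup>k'\<^esup> \<partial>\<^bsub>k'\<^esub>\<close>, the left-hand side is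
  \<open>a\<^sub>i\<^bsup>i'\<^esup> \<nabla>\<^bsub>\<partial>\<^bsub>i'\<^esub>\<^esub> (a\<^sub>j\<^bsup>j'\<^esup> \<partial>\<^bsub>j'\<^esub>) = \<partial>\<^sub>i a\<^sub>j\<^bsup>k'\<^esup> \<partial>\<^bsub>k'\<^esub> + (-1)\<^bsup>i'(j + j')\<^esup> a\<^sub>i\<^bsup>i'\<^esup> a\<^sub>j\<^bsup>j'\<^esup> \<Gamma>\<^bsup>k'\<^esup>\<^bsub>i'j'\<^esub> \<partial>\<^bsub>k'\<^esub>\<close>.\<close>

definition symmetric_connection ::
  "nat \<Rightarrow> nat \<Rightarrow> ('p, 'c) smfd \<Rightarrow> ('c \<Rightarrow> nat \<Rightarrow> nat \<Rightarrow> nat \<Rightarrow> sfun) \<Rightarrow> bool" where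
  "symmetric_connection n m M \<Gamma> \<longleftrightarrow>
    (\<forall>c\<in>charts M. \<forall>i<n+m. \<forall>j<n+m. \<forall>k<n+m.
      \<Gamma> c k i j \<in> superfunctions n m (cmap M c ` cdom M c) \<and>
      (\<forall>x \<in> cmap M c ` cdom M c.
        has_parity (par n i + par n j + par n k) (\<Gamma> c k i j x) \<and>
        \<Gamma> c k i j x = (- 1) ^ (par n i * par n j) * \<Gamma> c k j i x)) \<and>
    (\<forall>c\<in>charts M. \<forall>d\<in>charts M. \<forall>x \<in> cmap M c ` (cdom M c \<inter> cdom M d).
      \<forall>i<n+m. \<forall>j<n+m. \<forall>k'<n+m.
        (\<Sum>k<n+m. \<Gamma> c k i j x * jac n M c d k k' x) =
        pd n i (jac n M c d j k') x +
        (\<Sum>i'<n+m. \<Sum>j'<n+m. (- 1) ^ (par n i' * (par n j + par n j')) *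
          jac n M c d i i' x * jac n M c d j j' x * pullback M c d (\<Gamma> d k' i' j') x))"

text \<open>\<open>projective_coeff n m G k j i\<close> is \<open>\<Pi>\<^sup>k\<^bsub>ji\<^esub>\<close>, computed from \<open>G k j i = \<Gamma>\<^sup>k\<^bsub>ji\<^esub>\<close>.\<close>

definition projective_coeff ::
  "nat \<Rightarrow> nat \<Rightarrow> (nat \<Rightarrow> nat \<Rightarrow> nat \<Rightarrow> sfun) \<Rightarrow> nat \<Rightarrow> nat \<Rightarrow> nat \<Rightarrow> sfun" where
  "projective_coeff n m G k j i x =
    G k j i x - (1 / (real n - real m + 1)) *\<^sub>R
      ((\<Sum>s<n+m. G s j s x * (if k = i then 1 else 0) * (- 1) ^ par n s) +
       (\<Sum>s<n+m. G s i s x * (if k = j then 1 else 0) * (- 1) ^ (par n i * par n j + par n s)))"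

text \<open>A projective class of symmetric linear connections is identified with the \<open>\<Pi>\<^sup>k\<^bsub>ji\<^esub>\<close> of its
  members, in all charts.\<close>

definition projective_class ::
  "nat \<Rightarrow> nat \<Rightarrow> ('p, 'c) smfd \<Rightarrow> ('c \<Rightarrow> nat \<Rightarrow> nat \<Rightarrow> nat \<Rightarrow> sfun) \<Rightarrow> bool" where
  "projective_class n m M P \<longleftrightarrow> (\<exists>\<Gamma>. symmetric_connection n m M \<Gamma> \<and>
    (\<forall>c\<in>charts M. \<forall>k<n+m. \<forall>j<n+m. \<forall>i<n+m. \<forall>x \<in> cmap M c ` cdom M c.
      P c k j i x = projective_coeff n m (\<Gamma> c) k j i x))"

text \<open>\<open>S c i j\<close> is \<open>S\<^bsup>ij\<^esup>\<close>. Well-definedness of the function \<open>S\<^bsup>ij\<^esup> p\<^sub>j p\<^sub>i\<close> on \<open>T\<^sup>*M\<close> is expressed on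
  Grassmann-valued points: the momenta \<open>p\<^bsub>i'\<^esub>\<close> range over all elements of parity \<open>i'\<close>. Because there are
  infinitely many generators, the odd momenta can be chosen independent of each other and of the
  odd coordinates.\<close>

definition symmetric_tensor ::
  "nat \<Rightarrow> nat \<Rightarrow> nat \<Rightarrow> ('p, 'c) smfd \<Rightarrow> ('c \<Rightarrow> nat \<Rightarrow> nat \<Rightarrow> sfun) \<Rightarrow> bool" where
  "symmetric_tensor n m s M S \<longleftrightarrow>
    (\<forall>c\<in>charts M. \<forall>i<n+m. \<forall>j<n+m.
      S c i j \<in> superfunctions n m (cmap M c ` cdom M c) \<and>
      (\<forall>x \<in> cmap M c ` cdom M c.
        has_parity (s + par n i + par n j) (S c i j x) \<and>
        S c i j x = (- 1) ^ (par n i * par n j) * S c j i x)) \<and>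
    (\<forall>c\<in>charts M. \<forall>d\<in>charts M. \<forall>x \<in> cmap M c ` (cdom M c \<inter> cdom M d).
      \<forall>p'. (\<forall>i'<n+m. has_parity (par n i') (p' i')) \<longrightarrow>
        (let p = (\<lambda>i. \<Sum>i'<n+m. jac n M c d i i' x * p' i') in
          (\<Sum>i<n+m. \<Sum>j<n+m. S c i j x * p j * p i) =
          (\<Sum>i'<n+m. \<Sum>j'<n+m. pullback M c d (S d i' j') x * p' j' * p' i')))"

text \<open>\<open>g c i\<close> is the coefficient \<open>\<gamma>\<^sup>i\<close> of \<open>\<nabla>\<^sup>i(f|Dx|) = (S\<^bsup>ij\<^esup> \<partial>\<^sub>j f + \<gamma>\<^sup>i f)|Dx|\<close> in the chart \<open>c\<close>.\<close>

definition upper_connection_coeffs ::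
  "nat \<Rightarrow> nat \<Rightarrow> nat \<Rightarrow> ('p, 'c) smfd \<Rightarrow> ('c \<Rightarrow> nat \<Rightarrow> nat \<Rightarrow> sfun) \<Rightarrow> ('c \<Rightarrow> nat \<Rightarrow> sfun) \<Rightarrow> bool" where
  "upper_connection_coeffs n m s M S g \<longleftrightarrow>
    (\<forall>c\<in>charts M. \<forall>i<n+m.
      g c i \<in> superfunctions n m (cmap M c ` cdom M c) \<and>
      (\<forall>x \<in> cmap M c ` cdom M c. has_parity (s + par n i) (g c i x))) \<and>
    (\<forall>c\<in>charts M. \<forall>d\<in>charts M. \<forall>x \<in> cmap M c ` (cdom M c \<inter> cdom M d). \<forall>i'<n+m.
      pullback M c d (g d i') x =
      (\<Sum>i<n+m. (g c i x + (\<Sum>j<n+m. S c i j x * pd n j (log_J n m M c d) x)) * jac n M c d i i' x))"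


section \<open>The operator and the upper connection\<close>

text \<open>\<open>\<partial>\<^sub>jS\<^bsup>ji\<^esup> (-1)\<^bsup>j(S + 1)\<^esup>\<close> and \<open>S\<^bsup>jk\<^esup> \<Pi>\<^sup>i\<^bsub>kj\<^esub>\<close>, in one chart\<close>

definition div_S :: "nat \<Rightarrow> nat \<Rightarrow> nat \<Rightarrow> (nat \<Rightarrow> nat \<Rightarrow> sfun) \<Rightarrow> nat \<Rightarrow> sfun" where
  "div_S n m s S i x = (\<Sum>j<n+m. pd n j (S j i) x * (- 1) ^ (par n j * (s + 1)))"

definition contr_SP ::
  "nat \<Rightarrow> nat \<Rightarrow> (nat \<Rightarrow> nat \<Rightarrow> sfun) \<Rightarrow> (nat \<Rightarrow> nat \<Rightarrow> nat \<Rightarrow> sfun) \<Rightarrow> nat \<Rightarrow> sfun" where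
  "contr_SP n m S P i x = (\<Sum>j<n+m. \<Sum>k<n+m. S j k x * P i k j x)"

definition proj_laplacian ::
  "nat \<Rightarrow> nat \<Rightarrow> nat \<Rightarrow> (nat \<Rightarrow> nat \<Rightarrow> sfun) \<Rightarrow> (nat \<Rightarrow> nat \<Rightarrow> nat \<Rightarrow> sfun) \<Rightarrow> sfun \<Rightarrow> sfun" where
  "proj_laplacian n m s S P F x =
    (\<Sum>i<n+m. \<Sum>j<n+m. S i j x * pd n j (pd n i F) x) +
    (\<Sum>i<n+m.
      ((2 / (real n - real m + 3)) *\<^sub>R div_S n m s S i x -
       ((real n - real m + 1) / (real n - real m + 3)) *\<^sub>R contr_SP n m S P i x) * pd n i F x)"

definition proj_gamma ::
  "nat \<Rightarrow> nat \<Rightarrow> nat \<Rightarrow> (nat \<Rightarrow> nat \<Rightarrow> sfun) \<Rightarrow> (nat \<Rightarrow> nat \<Rightarrow> nat \<Rightarrow> sfun) \<Rightarrow> nat \<Rightarrow> sfun" where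
  "proj_gamma n m s S P i x =
    ((real n - real m + 1) / (real n - real m + 3)) *\<^sub>R (div_S n m s S i x + contr_SP n m S P i x)"

end

theory Submission
  imports Defs "Jordan_Normal_Form.Determinant" "HOL-Library.Function_Algebras"
begin

text \<open>Let \<open>a\<^sub>i\<^bsup>i'\<^esup> = \<partial>\<^sub>i x\<^bsup>i'\<^esup>\<close>, let \<open>\<sigma>\<^sub>j\<close> be the supertrace of \<open>\<partial>\<^sub>j a a\<inverse>\<close> and \<open>\<Gamma>\<^sub>j = \<Gamma>\<^sup>s\<^bsub>js\<^esub> (-1)\<^sup>s\<close>. Since
  \<open>S\<^bsup>jk\<^esup> \<Pi>\<^sup>i\<^bsub>kj\<^esub> = S\<^bsup>jk\<^esup> \<Gamma>\<^sup>i\<^bsub>kj\<^esub> - 2/(n - m + 1) S\<^bsup>ij\<^esup> \<Gamma>\<^sub>j\<close>, the coefficients in (1) and (2) are linear combinations of the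
  divergence of \<open>S\<close>, of \<open>S\<^bsup>jk\<^esup> \<Gamma>\<^sup>i\<^bsub>kj\<^esub>\<close> and of \<open>S\<^bsup>ij\<^esup> \<Gamma>\<^sub>j\<close>. In the new coordinates these three become their
  contractions with \<open>a\<^sub>i\<^bsup>i'\<^esup>\<close> plus, respectively, \<open>S\<^bsup>ij\<^esup> \<partial>\<^sub>j a\<^sub>i\<^bsup>i'\<^esup> + S\<^bsup>ij\<^esup> \<sigma>\<^sub>j a\<^sub>i\<^bsup>i'\<^esup>\<close>, \<open>- S\<^bsup>ij\<^esup> \<partial>\<^sub>j a\<^sub>i\<^bsup>i'\<^esup>\<close> and
  \<open>- S\<^bsup>ij\<^esup> \<sigma>\<^sub>j a\<^sub>i\<^bsup>i'\<^esup>\<close>. In (1) the terms with \<open>\<sigma>\<close> cancel, and one copy of \<open>S\<^bsup>ij\<^esup> \<partial>\<^sub>j a\<^sub>i\<^bsup>i'\<^esup>\<close> is left to compensate the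
  transformation of \<open>S\<^bsup>ij\<^esup> \<partial>\<^sub>j \<partial>\<^sub>i\<close>; in (2) it is the other way round, and \<open>\<sigma>\<^sub>j = \<partial>\<^sub>j log J\<close> is the logarithmic derivative
  of the Berezinian. The symmetry of \<open>\<partial>\<^sub>j a\<^sub>i\<^bsup>i'\<^esup>\<close> follows from that of the two families \<open>\<Gamma>\<close>.

  A coordinate change is only given as a morphism of algebras. The defect of the chain rule is a
  derivation along it that vanishes on the coordinates, hence vanishes by Hadamard's lemma and
  nilpotency.\<close>

text \<open>Put N = n - m and let D, Z stand for S^{ij} \<partial>_j a_i^{i'} and S^{ij} \<sigma>_j
  a_i^{i'}. The constants are forced by \<open>\<kappa> + \<mu> = 1\<close> and \<kappa> * 2/(N+1) =
  \<mu>, that is \<kappa> = (N+1)/(N+3) and \<mu> = 2/(N+3). The second equation gives the trace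
  correction in \<Pi> the weight \<mu>; the inhomogeneous parts are then \<mu>(D + Z) + \<kappa> D -
  \<mu> Z = D in (1) and \<kappa>(D + Z - D) + \<mu> Z = Z in (2). Three obstacles shape the work.
  Pullbacks have no explicit formula, so smoothness of the auxiliary quantities must come from
  algebra: the odd-odd block of the Jacobian is inverted by a finite geometric series in blocks of
  the Jacobian and its inverse. Hadamard's lemma needs a region in which single coordinates can be
  contracted, so the chain rule is proved over cubes and transferred by restriction. The law for S
  is an equality of quadratic functions, from which the components have to be recovered by
  polarization with fresh odd constants.\<close>

section \<open>Coefficients and bodies in the Grassmann algebra\<close>

lemma gcoeff_zero [simp]: "gcoeff 0 I = 0"
  by (simp add: zero_grassmann.rep_eq)

lemma gcoeff_one: "gcoeff 1 I = (if I = {} then 1 else 0)"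
  by (simp add: one_grassmann.rep_eq)

lemma gcoeff_add [simp]: "gcoeff (a + b) I = gcoeff a I + gcoeff b I"
  by (simp add: plus_grassmann.rep_eq)

lemma gcoeff_diff [simp]: "gcoeff (a - b) I = gcoeff a I - gcoeff b I"
  by (simp add: minus_grassmann.rep_eq)

lemma gcoeff_minus [simp]: "gcoeff (- a) I = - gcoeff a I"
  by (simp add: uminus_grassmann.rep_eq)

lemma gcoeff_scaleR [simp]: "gcoeff (r *\<^sub>R a) I = r * gcoeff a I"
  by (simp add: scaleR_grassmann.rep_eq)

lemma gcoeff_sum [simp]: "gcoeff (\<Sum>i\<in>A. f i) I = (\<Sum>i\<in>A. gcoeff (f i) I)"
  by (induction A rule: infinite_finite_induct) auto

lemma gcoeff_of_real: "gcoeff (of_real r) I = (if I = {} then r else 0)"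
  by (simp add: of_real_def gcoeff_one)

lemma gcoeff_mult: "gcoeff (a * b) K = (\<Sum>I\<in>Pow K. gsign I (K - I) * gcoeff a I * gcoeff b (K - I))"
  by (simp add: times_grassmann.rep_eq)

lemma gcoeff_ggen: "gcoeff (ggen k) I = (if I = {k} then 1 else 0)"
  by (simp add: ggen.rep_eq)

lemma gcoeff_gderiv_odd:
  "gcoeff (gderiv_odd k a) I = (if k \<in> I then 0 else gsign {k} I * gcoeff a (insert k I))"
  by (simp add: gderiv_odd.rep_eq)

lemma gcoeff_infinite: "infinite I \<Longrightarrow> gcoeff a I = 0"
  using gcoeff[of a] by simp

lemma grassmann_eqI: "(\<And>I. finite I \<Longrightarrow> gcoeff a I = gcoeff b I) \<Longrightarrow> a = b"
  by (metis gcoeff_infinite gcoeff_inject ext)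

text \<open>Common source of the facts on products below that are phrased through nonvanishing
  coefficients: parity, order, support and freeness from a generator can all be read off a disjoint
  splitting of the index set.\<close>

lemma gcoeff_mult_nonzeroE:
  assumes "gcoeff (a * b) K \<noteq> 0"
  obtains I J where "K = I \<union> J" "I \<inter> J = {}" "finite I" "finite J" "gcoeff a I \<noteq> 0" "gcoeff b J \<noteq> 0"
proof -
  have "\<exists>I\<in>Pow K. gsign I (K - I) * gcoeff a I * gcoeff b (K - I) \<noteq> 0"
  proof (rule ccontr)
    assume "\<not> ?thesis"
    then have "gcoeff (a * b) K = 0" unfolding gcoeff_mult by (intro sum.neutral) blast
    with assms show False by simp
  qed
  then obtain I where "I \<subseteq> K" "gcoeff a I \<noteq> 0" "gcoeff b (K - I) \<noteq> 0" by auto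
  moreover from this have "finite I" "finite (K - I)"
    using gcoeff_infinite by blast+
  ultimately show thesis
    using that[of I "K - I"] by (metis Diff_disjoint Diff_partition)
qed

lemma gbody_simps [simp]:
  "gbody 0 = 0" "gbody 1 = 1" "gbody (a + b) = gbody a + gbody b" "gbody (a - b) = gbody a - gbody b"
  "gbody (- a) = - gbody a" "gbody (r *\<^sub>R a) = r * gbody a" "gbody (of_real r) = r"
  "gbody (\<Sum>i\<in>A. f i) = (\<Sum>i\<in>A. gbody (f i))" "gbody (a * b) = gbody a * gbody b"
  by (simp_all add: gbody_def gcoeff_one gcoeff_of_real gcoeff_mult)

lemma gbody_of_int [simp]: "gbody (of_int k) = of_int k"
  by (metis gbody_simps(7) of_real_of_int_eq)

lemma gbody_prod_list [simp]: "gbody (prod_list xs) = prod_list (map gbody xs)"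
  by (induction xs) auto


subsection \<open>Parity\<close>

lemma has_parity_cong: "even p = even q \<Longrightarrow> has_parity p a = has_parity q a"
  by (simp add: has_parity_def)

lemma has_parity_zero [simp]: "has_parity p 0"
  by (simp add: has_parity_def)

lemma has_parity_one [simp]: "has_parity 0 1"
  by (simp add: has_parity_def gcoeff_one)

lemma has_parity_of_real [simp]: "has_parity 0 (of_real r)"
  by (simp add: has_parity_def gcoeff_of_real)

lemma has_parity_add: "has_parity p a \<Longrightarrow> has_parity p b \<Longrightarrow> has_parity p (a + b)"
  unfolding has_parity_def gcoeff_add by (metis add.right_neutral)

lemma has_parity_minus: "has_parity p a \<Longrightarrow> has_parity p (- a)"
  by (auto simp: has_parity_def)

lemma has_parity_diff: "has_parity p a \<Longrightarrow> has_parity p b \<Longrightarrow> has_parity p (a - b)"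
  using has_parity_add[of p a "- b"] has_parity_minus by auto

lemma has_parity_scaleR: "has_parity p a \<Longrightarrow> has_parity p (r *\<^sub>R a)"
  by (auto simp: has_parity_def)

lemma has_parity_sum: "(\<And>i. i \<in> A \<Longrightarrow> has_parity p (f i)) \<Longrightarrow> has_parity p (\<Sum>i\<in>A. f i)"
  by (induction A rule: infinite_finite_induct) (auto intro: has_parity_add)

lemma has_parity_mult:
  assumes "has_parity p a" "has_parity q b"
  shows "has_parity (p + q) (a * b)"
  unfolding has_parity_def
proof (intro allI impI)
  fix K assume "gcoeff (a * b) K \<noteq> 0"
  then show "even (card K) = even (p + q)"
    using assms by (elim gcoeff_mult_nonzeroE) (auto simp: has_parity_def card_Un_disjoint)
qed

lemma has_parity_power: "has_parity 0 a \<Longrightarrow> has_parity 0 (a ^ k)"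
  by (induction k) (auto dest: has_parity_mult)

lemma has_parity_ggen: "has_parity 1 (ggen k)"
  by (auto simp: has_parity_def gcoeff_ggen)

lemma gbody_odd: "has_parity p a \<Longrightarrow> odd p \<Longrightarrow> gbody a = 0"
  by (auto simp: has_parity_def gbody_def)

text \<open>Each pair in I x J is an inversion either for (I, J) or, after swapping, for (J, I), so
  the two exponents add up to \<open>card I * card J\<close>.\<close>

lemma gsign_flip:
  assumes "finite I" "finite J" "I \<inter> J = {}"
  shows "gsign J I = (- 1) ^ (card I * card J) * gsign I J"
proof -
  let ?A = "{(i, j). i \<in> I \<and> j \<in> J \<and> j < i}" and ?B = "{(j, i). j \<in> J \<and> i \<in> I \<and> i < j}"
  have "I \<times> J = ?A \<union> prod.swap ` ?B"
    using assms(3) by (force simp: image_iff not_less_iff_gr_or_eq)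
  moreover have "?A \<inter> prod.swap ` ?B = {}" by auto
  moreover have "finite ?A" "finite ?B"
    using assms finite_gsign by blast+
  moreover have "card (prod.swap ` ?B) = card ?B"
    by (rule card_image) (simp add: inj_on_def)
  ultimately have c: "card I * card J = card ?A + card ?B"
    using card_Un_disjoint[of ?A "prod.swap ` ?B"] card_cartesian_product[of I J] by simp
  have "(- 1 :: real) ^ (card ?A + card ?B) * (- 1) ^ card ?A = (- 1) ^ card ?B"
    by (simp add: minus_one_power_iff)
  then show ?thesis
    unfolding gsign_def c by simp
qed

lemma gsign_sq [simp]: "gsign I J * gsign I J = 1" "gsign I J * (gsign I J * x) = x"
  by (simp_all add: gsign_def flip: power_mult_distrib mult.assoc)

lemma minus_one_power_grassmann: "(- 1) ^ k = ((- 1) ^ k :: real) *\<^sub>R (1 :: grassmann)"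
  by (induction k) auto

text \<open>Replacing index sets by their complements in K exchanges the factors at the price of
  \<open>gsign_flip\<close>; wherever both coefficients are nonzero, the parities of a and b
  determine that sign.\<close>

lemma mult_commute_parity:
  assumes "has_parity p a" "has_parity q b"
  shows "a * b = ((- 1) ^ (p * q) :: real) *\<^sub>R (b * a)"
proof (rule grassmann_eqI)
  fix K :: "nat set" assume K: "finite K"
  have "gcoeff (a * b) K = (\<Sum>I\<in>Pow K. gsign (K - I) I * gcoeff a (K - I) * gcoeff b I)"
    unfolding gcoeff_mult
    by (rule sum.reindex_bij_witness[where i = "\<lambda>I. K - I" and j = "\<lambda>I. K - I"])
      (auto simp: double_diff)
  also have "\<dots> = (\<Sum>I\<in>Pow K. (- 1) ^ (p * q) * (gsign I (K - I) * gcoeff b I * gcoeff a (K - I)))"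
  proof (rule sum.cong)
    fix I assume I: "I \<in> Pow K"
    show "gsign (K - I) I * gcoeff a (K - I) * gcoeff b I =
        (- 1) ^ (p * q) * (gsign I (K - I) * gcoeff b I * gcoeff a (K - I))"
    proof (cases "gcoeff a (K - I) = 0 \<or> gcoeff b I = 0")
      case False
      then have "even (card (K - I)) = even p" "even (card I) = even q"
        using assms by (auto simp: has_parity_def)
      then have "(- 1 :: real) ^ (card I * card (K - I)) = (- 1) ^ (p * q)"
        by (simp add: minus_one_power_iff)
      then show ?thesis
        using I K gsign_flip[of I "K - I"] by (auto intro: finite_subset)
    qed auto
  qed simp
  also have "\<dots> = gcoeff ((- 1) ^ (p * q) *\<^sub>R (b * a)) K"
    by (simp add: gcoeff_mult sum_distrib_left)
  finally show "gcoeff (a * b) K = gcoeff ((- 1) ^ (p * q) *\<^sub>R (b * a)) K" .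
qed

lemma mult_commute_even: "has_parity 0 a \<Longrightarrow> has_parity q b \<Longrightarrow> a * b = b * a"
  using mult_commute_parity[of 0 a q b] by simp

text \<open>An even element is central even against inhomogeneous b, because b splits into its even
  part \<open>c 0\<close> and its odd part \<open>c 1\<close>.\<close>

lemma mult_commute_even':
  assumes "has_parity 0 a"
  shows "a * b = b * a"
proof -
  define c :: "nat \<Rightarrow> grassmann" where
    "c q = Abs_grassmann (\<lambda>I. if even (card I) = even q then gcoeff b I else 0)" for q
  have c: "gcoeff (c q) I = (if even (card I) = even q then gcoeff b I else 0)" for q I
    unfolding c_def by (subst Abs_grassmann_inverse) (auto simp: gcoeff_infinite)
  have "b = c 0 + c 1" by (rule grassmann_eqI) (auto simp: c)
  moreover have "a * c q = c q * a" for q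
    using mult_commute_even[OF assms, of q "c q"] by (auto simp: has_parity_def c)
  ultimately show ?thesis by (metis distrib_left distrib_right)
qed


subsection \<open>The filtration by degree and the number of generators\<close>

definition gorder_ge :: "nat \<Rightarrow> grassmann \<Rightarrow> bool" where
  "gorder_ge r a \<longleftrightarrow> (\<forall>I. gcoeff a I \<noteq> 0 \<longrightarrow> r \<le> card I)"

definition gsupported :: "nat \<Rightarrow> grassmann \<Rightarrow> bool" where
  "gsupported m a \<longleftrightarrow> (\<forall>I. gcoeff a I \<noteq> 0 \<longrightarrow> I \<subseteq> {..<m})"

lemma gorder_ge_0 [simp]: "gorder_ge 0 a"
  by (simp add: gorder_ge_def)

lemma gorder_ge_zero [simp]: "gorder_ge r 0"
  by (simp add: gorder_ge_def)

lemma gorder_ge_add: "gorder_ge r a \<Longrightarrow> gorder_ge r b \<Longrightarrow> gorder_ge r (a + b)"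
  by (auto simp: gorder_ge_def) (metis add.right_neutral)

lemma gorder_ge_sum: "(\<And>i. i \<in> A \<Longrightarrow> gorder_ge r (f i)) \<Longrightarrow> gorder_ge r (\<Sum>i\<in>A. f i)"
  by (induction A rule: infinite_finite_induct) (auto intro: gorder_ge_add)

lemma gorder_ge_mult:
  assumes "gorder_ge r a" "gorder_ge t b"
  shows "gorder_ge (r + t) (a * b)"
  unfolding gorder_ge_def
proof (intro allI impI)
  fix K assume "gcoeff (a * b) K \<noteq> 0"
  then show "r + t \<le> card K"
    using assms by (elim gcoeff_mult_nonzeroE) (auto simp: gorder_ge_def card_Un_disjoint intro: add_mono)
qed

lemma gorder_ge_power: "gorder_ge r a \<Longrightarrow> gorder_ge (k * r) (a ^ k)"
  by (induction k) (auto dest: gorder_ge_mult)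

lemma gorder_ge_1: "gbody a = 0 \<Longrightarrow> gorder_ge 1 a"
  unfolding gorder_ge_def gbody_def
  by (metis One_nat_def Suc_leI card_gt_0_iff gcoeff_infinite)

lemma gsupported_zero [simp]: "gsupported m 0"
  by (simp add: gsupported_def)

lemma gsupported_of_real [simp]: "gsupported m (of_real r)"
  by (simp add: gsupported_def gcoeff_of_real)

lemma gsupported_one [simp]: "gsupported m 1"
  by (simp add: gsupported_def gcoeff_one)

lemma gsupported_add: "gsupported m a \<Longrightarrow> gsupported m b \<Longrightarrow> gsupported m (a + b)"
  by (auto simp: gsupported_def) (metis add.right_neutral lessThan_iff subsetD)

lemma gsupported_scaleR: "gsupported m a \<Longrightarrow> gsupported m (c *\<^sub>R a)"
  by (auto simp: gsupported_def)

lemma gsupported_minus: "gsupported m a \<Longrightarrow> gsupported m (- a)"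
  by (auto simp: gsupported_def)

lemma gsupported_diff: "gsupported m a \<Longrightarrow> gsupported m b \<Longrightarrow> gsupported m (a - b)"
  using gsupported_add[of m a "- b"] gsupported_minus by auto

lemma gsupported_mult: 
  assumes "gsupported m a" "gsupported m b"
  shows "gsupported m (a * b)"
  unfolding gsupported_def
proof (intro allI impI)
  fix K assume "gcoeff (a * b) K \<noteq> 0"
  then show "K \<subseteq> {..<m}"
    using assms by (elim gcoeff_mult_nonzeroE) (auto simp: gsupported_def)
qed

lemma gsupported_power: "gsupported m a \<Longrightarrow> gsupported m (a ^ k)"
  by (induction k) (auto intro: gsupported_mult)

lemma gsupported_sum: "(\<And>i. i \<in> A \<Longrightarrow> gsupported m (f i)) \<Longrightarrow> gsupported m (\<Sum>i\<in>A. f i)"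
  by (induction A rule: infinite_finite_induct) (auto intro: gsupported_add)

text \<open>The place where nilpotency enters: among m generators there is no monomial of degree
  above m.\<close>

lemma gorder_ge_eq_0:
  assumes "gsupported m a" "gorder_ge r a" "m < r"
  shows "a = 0"
proof (rule grassmann_eqI)
  fix I :: "nat set"
  show "gcoeff a I = gcoeff 0 I"
  proof (rule ccontr)
    assume "gcoeff a I \<noteq> gcoeff 0 I"
    then have "I \<subseteq> {..<m}" "r \<le> card I" using assms by (auto simp: gsupported_def gorder_ge_def)
    then show False using assms(3) card_mono[of "{..<m}" I] by simp
  qed
qed

text \<open>Up to a real factor a is 1 - u with u without body. Then z = u z, and iterating pushes
  the order of z beyond every bound, so each coefficient at a finite set vanishes. This replaces
  division by a.\<close>

lemma gbody_nonzero_cancel: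
  assumes "a * z = 0" "gbody a \<noteq> 0"
  shows "z = 0"
proof -
  define u where "u = 1 - a /\<^sub>R gbody a"
  have "gorder_ge 1 u" using assms(2) by (intro gorder_ge_1) (simp add: u_def)
  have z: "z = u * z" by (simp add: u_def left_diff_distrib assms(1))
  have "gorder_ge r z" for r
  proof (induction r)
    case (Suc r)
    from gorder_ge_mult[OF \<open>gorder_ge 1 u\<close> this] show ?case by (subst z) simp
  qed simp
  then show ?thesis
    by (intro grassmann_eqI) (metis gcoeff_zero gorder_ge_def not_less_eq_eq le_refl)
qed

subsection \<open>The left derivative with respect to a generator\<close>

text \<open>The parity involution. It carries the sign in the Leibniz rule of an odd derivation,
  which can thus be proved without splitting the first factor into homogeneous parts.\<close>

definition ginvol :: "grassmann \<Rightarrow> grassmann" where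
  "ginvol a = Abs_grassmann (\<lambda>I. (- 1) ^ card I * gcoeff a I)"

lemma gcoeff_ginvol: "gcoeff (ginvol a) I = (- 1) ^ card I * gcoeff a I"
  unfolding ginvol_def by (subst Abs_grassmann_inverse) (auto simp: gcoeff_infinite)

lemma ginvol_parity: "has_parity p a \<Longrightarrow> ginvol a = ((- 1) ^ p :: real) *\<^sub>R a"
  by (intro grassmann_eqI) (auto simp: gcoeff_ginvol has_parity_def minus_one_power_iff)

lemma gsign_insert_right:
  "finite I \<Longrightarrow> finite J \<Longrightarrow> k \<notin> J \<Longrightarrow> gsign I (insert k J) = gsign I {k} * gsign I J"
  using gsign_Un_right[of I "{k}" J] by simp

lemma gsign_insert_left:
  "finite I \<Longrightarrow> finite J \<Longrightarrow> k \<notin> I \<Longrightarrow> gsign (insert k I) J = gsign {k} J * gsign I J"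
  using gsign_Un_left[of "{k}" I J] by simp

lemma gsign_single_flip:
  "finite I \<Longrightarrow> k \<notin> I \<Longrightarrow> gsign I {k} = (- 1) ^ card I * gsign {k} I"
  using gsign_flip[of "{k}" I] by simp

lemma sum_Pow_insert:
  assumes "finite K" "k \<notin> K"
  shows "(\<Sum>I\<in>Pow (insert k K). f I) = (\<Sum>I\<in>Pow K. f I) + (\<Sum>I\<in>Pow K. f (insert k I))"
proof -
  have "inj_on (insert k) (Pow K)" using assms(2) by (auto simp: inj_on_def)
  moreover have "Pow K \<inter> insert k ` Pow K = {}" using assms(2) by auto
  ultimately show ?thesis
    using assms by (simp add: Pow_insert sum.union_disjoint sum.reindex)
qed

text \<open>Needed for coefficients of the Leibniz rule at sets containing k: the terms in which the
  second \<theta>_k stems from the right factor and those in which it stems from the left one cancel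
  in pairs.\<close>

lemma gsign_insert_cancel:
  assumes "finite I" "finite J" "k \<notin> I" "k \<notin> J"
  shows "gsign I (insert k J) * (gsign {k} I * x) * y +
    gsign (insert k I) J * ((- 1) ^ card (insert k I) * x) * (gsign {k} J * y) = 0"
proof -
  have "gsign I (insert k J) = (- 1) ^ card I * gsign {k} I * gsign I J"
    using assms by (simp only: gsign_insert_right gsign_single_flip not_False_eq_True)
  moreover have "gsign (insert k I) J = gsign {k} J * gsign I J"
    using assms by (simp only: gsign_insert_left not_False_eq_True)
  moreover have "(- 1 :: real) ^ card (insert k I) = - ((- 1) ^ card I)"
    using assms by simp
  ultimately have "gsign I (insert k J) * (gsign {k} I * x) * y +
      gsign (insert k I) J * ((- 1) ^ card (insert k I) * x) * (gsign {k} J * y) =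
    (- 1) ^ card I * gsign I J * x * y * (gsign {k} I * gsign {k} I - gsign {k} J * gsign {k} J)"
    by (simp only: algebra_simps)
  then show ?thesis by (simp only: gsign_sq diff_self mult_zero_right)
qed

text \<open>At K without k, the splittings of \<open>insert k K\<close> are sorted by the factor
  that receives \<theta>_k, which yields the two summands. At K with k, the left side is zero and
  the right side cancels after pairing I with \<open>insert k I\<close>.\<close>

lemma gderiv_odd_mult_ginvol:
  "gderiv_odd k (a * b) = gderiv_odd k a * b + ginvol a * gderiv_odd k b"
proof (rule grassmann_eqI)
  fix K :: "nat set" assume K: "finite K"
  show "gcoeff (gderiv_odd k (a * b)) K = gcoeff (gderiv_odd k a * b + ginvol a * gderiv_odd k b) K"
  proof (cases "k \<in> K")
    case False
    have "gcoeff (gderiv_odd k (a * b)) K = (\<Sum>I\<in>Pow K.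
        gsign {k} K * (gsign I (insert k K - I) * gcoeff a I * gcoeff b (insert k K - I))) +
       (\<Sum>I\<in>Pow K. gsign {k} K * (gsign (insert k I) (insert k K - insert k I) *
          gcoeff a (insert k I) * gcoeff b (insert k K - insert k I)))"
      using K False by (simp add: gcoeff_gderiv_odd gcoeff_mult sum_Pow_insert distrib_left sum_distrib_left)
    also have "(\<Sum>I\<in>Pow K. gsign {k} K * (gsign (insert k I) (insert k K - insert k I) *
          gcoeff a (insert k I) * gcoeff b (insert k K - insert k I))) = gcoeff (gderiv_odd k a * b) K"
      unfolding gcoeff_mult
    proof (rule sum.cong)
      fix I assume I: "I \<in> Pow K"
      then have fin: "finite I" "finite (K - I)" and k: "k \<notin> I" "insert k K - insert k I = K - I"
        using K False by (auto intro: finite_subset)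
      have "gsign {k} K = gsign {k} I * gsign {k} (K - I)"
        using gsign_Un_right[of "{k}" I "K - I"] fin I by (simp add: Un_absorb1)
      then show "gsign {k} K * (gsign (insert k I) (insert k K - insert k I) *
          gcoeff a (insert k I) * gcoeff b (insert k K - insert k I)) =
         gsign I (K - I) * gcoeff (gderiv_odd k a) I * gcoeff b (K - I)"
        using fin k(1) unfolding k(2) gcoeff_gderiv_odd
        by (simp only: gsign_insert_left if_False not_False_eq_True) (simp add: mult_ac)
    qed simp
    also have "(\<Sum>I\<in>Pow K. gsign {k} K * (gsign I (insert k K - I) * gcoeff a I * gcoeff b (insert k K - I)))
        = gcoeff (ginvol a * gderiv_odd k b) K"
      unfolding gcoeff_mult
    proof (rule sum.cong)
      fix I assume I: "I \<in> Pow K"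
      then have fin: "finite I" "finite (K - I)" and k: "k \<notin> I" "k \<notin> K - I" "insert k K - I = insert k (K - I)"
        using K False by (auto intro: finite_subset)
      have "gsign {k} K = gsign {k} I * gsign {k} (K - I)"
        using gsign_Un_right[of "{k}" I "K - I"] fin I by (simp add: Un_absorb1)
      then show "gsign {k} K * (gsign I (insert k K - I) * gcoeff a I * gcoeff b (insert k K - I)) =
         gsign I (K - I) * gcoeff (ginvol a) I * gcoeff (gderiv_odd k b) (K - I)"
        using fin k(1,2) unfolding k(3) gcoeff_gderiv_odd gcoeff_ginvol
        by (simp only: gsign_insert_right gsign_single_flip if_False not_False_eq_True) (simp add: mult_ac)
    qed simp
    finally show ?thesis by simp
  next
    case True
    then obtain L where L: "K = insert k L" "k \<notin> L" "finite L"
      using K by (metis finite_insert mk_disjoint_insert)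
    have "gcoeff (gderiv_odd k a * b + ginvol a * gderiv_odd k b) K =
       (\<Sum>I\<in>Pow L. gsign I (K - I) * gcoeff (gderiv_odd k a) I * gcoeff b (K - I)) +
       (\<Sum>I\<in>Pow L. gsign (insert k I) (K - insert k I) * gcoeff (ginvol a) (insert k I) *
         gcoeff (gderiv_odd k b) (K - insert k I)) +
       (\<Sum>I\<in>Pow L. gsign I (K - I) * gcoeff (ginvol a) I * gcoeff (gderiv_odd k b) (K - I)) +
       (\<Sum>I\<in>Pow L. gsign (insert k I) (K - insert k I) * gcoeff (gderiv_odd k a) (insert k I) *
         gcoeff b (K - insert k I))"
      using L by (simp add: gcoeff_mult sum_Pow_insert)
    also have "\<dots> = (\<Sum>I\<in>Pow L. gsign I (K - I) * gcoeff (gderiv_odd k a) I * gcoeff b (K - I) +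
        gsign (insert k I) (K - insert k I) * gcoeff (ginvol a) (insert k I) *
         gcoeff (gderiv_odd k b) (K - insert k I) +
        gsign I (K - I) * gcoeff (ginvol a) I * gcoeff (gderiv_odd k b) (K - I) +
        gsign (insert k I) (K - insert k I) * gcoeff (gderiv_odd k a) (insert k I) * gcoeff b (K - insert k I))"
      by (simp add: sum.distrib)
    \<comment> \<open>The last two summands vanish separately, since a derivative by \<theta>_k has
      no coefficient at sets containing k; the first two cancel each other.\<close>
    also have "\<dots> = 0"
    proof (intro sum.neutral ballI)
      fix I assume I: "I \<in> Pow L"
      then have fin: "finite I" "finite (L - I)" and k: "k \<notin> I" "K - I = insert k (L - I)"
          "K - insert k I = L - I"
        using L by (auto intro: finite_subset)
      show "gsign I (K - I) * gcoeff (gderiv_odd k a) I * gcoeff b (K - I) +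
        gsign (insert k I) (K - insert k I) * gcoeff (ginvol a) (insert k I) *
         gcoeff (gderiv_odd k b) (K - insert k I) +
        gsign I (K - I) * gcoeff (ginvol a) I * gcoeff (gderiv_odd k b) (K - I) +
        gsign (insert k I) (K - insert k I) * gcoeff (gderiv_odd k a) (insert k I) * gcoeff b (K - insert k I) = 0"
        unfolding k(2,3) using gsign_insert_cancel[of I "L - I" k] fin k(1) L(2)
        by (simp add: gcoeff_gderiv_odd gcoeff_ginvol)
    qed
    finally show ?thesis using True by (simp add: gcoeff_gderiv_odd)
  qed
qed

lemma gderiv_odd_mult:
  "has_parity p a \<Longrightarrow>
    gderiv_odd k (a * b) = gderiv_odd k a * b + ((- 1) ^ p :: real) *\<^sub>R (a * gderiv_odd k b)"
  by (simp add: gderiv_odd_mult_ginvol ginvol_parity)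

lemma gderiv_odd_linear [simp]:
  "gderiv_odd k 0 = 0" "gderiv_odd k (a + b) = gderiv_odd k a + gderiv_odd k b"
  "gderiv_odd k (a - b) = gderiv_odd k a - gderiv_odd k b"
  "gderiv_odd k (r *\<^sub>R a) = r *\<^sub>R gderiv_odd k a" "gderiv_odd k (of_real r) = 0"
  by (rule grassmann_eqI; simp add: gcoeff_gderiv_odd gcoeff_of_real algebra_simps)+

lemma gderiv_odd_ggen: "gderiv_odd k (ggen l) = (if k = l then 1 else 0)"
  by (rule grassmann_eqI) (auto simp: gcoeff_gderiv_odd gcoeff_ggen gcoeff_one)

lemma has_parity_gderiv_odd: "has_parity p a \<Longrightarrow> has_parity (p + 1) (gderiv_odd k a)"
  unfolding has_parity_def gcoeff_gderiv_odd
  by (metis card_insert_disjoint even_Suc gcoeff_infinite finite_insert mult_eq_0_iff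
      Suc_eq_plus1)

lemma gsupported_gderiv_odd: "gsupported m a \<Longrightarrow> gsupported m (gderiv_odd k a)"
  by (auto simp: gsupported_def gcoeff_gderiv_odd split: if_splits)


subsection \<open>Smooth functions\<close>

lemma eventually_line_in:
  assumes "openin (Euclidean_space n) V" "x \<in> V" "k < n"
  shows "\<forall>\<^sub>F t in nhds (x k). x(k := t) \<in> V"
proof -
  obtain U where "openin (powertop_real UNIV) U" "V = U \<inter> {x. \<forall>i\<ge>n. x i = 0}"
    using assms(1) by (auto simp: Euclidean_space_def openin_subtopology)
  then have U: "open U" "V = U \<inter> {x. \<forall>i\<ge>n. x i = 0}"
    by (simp_all add: open_fun_def)
  have "continuous_on UNIV (\<lambda>t. x(k := t))"
  proof (rule continuous_on_coordinatewise_then_product)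
    fix i show "continuous_on UNIV (\<lambda>t. (x(k := t)) i)" by (cases "i = k") auto
  qed
  then have "open ((\<lambda>t. x(k := t)) -` U)"
    using U(1) by (simp add: continuous_on_open_vimage[OF open_UNIV])
  moreover have "x k \<in> (\<lambda>t. x(k := t)) -` U"
    using assms(2) U(2) by simp
  ultimately have "\<forall>\<^sub>F t in nhds (x k). t \<in> (\<lambda>t. x(k := t)) -` U"
    by (rule eventually_nhds_in_open)
  then show ?thesis
    by eventually_elim (use assms(2,3) U(2) in auto)
qed

definition line_differentiable :: "nat \<Rightarrow> ((nat \<Rightarrow> real) \<Rightarrow> real) \<Rightarrow> (nat \<Rightarrow> real) \<Rightarrow> bool" where
  "line_differentiable k f x \<longleftrightarrow> (\<lambda>t. f (x(k := t))) differentiable (at (x k))"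

lemma line_differentiable_iff:
  "line_differentiable k f x \<longleftrightarrow> ((\<lambda>t. f (x(k := t))) has_real_derivative partial k f x) (at (x k))"
  unfolding line_differentiable_def partial_def
  by (simp add: DERIV_deriv_iff_real_differentiable)

lemma line_differentiableI:
  "((\<lambda>t. f (x(k := t))) has_real_derivative D) (at (x k)) \<Longrightarrow> line_differentiable k f x"
  unfolding line_differentiable_def by (metis real_differentiable_def)

lemma partial_eqI: "((\<lambda>t. f (x(k := t))) has_real_derivative D) (at (x k)) \<Longrightarrow> partial k f x = D"
  unfolding partial_def by (rule DERIV_imp_deriv)

lemma line_derivative_cong:
  assumes "openin (Euclidean_space n) V" "x \<in> V" "k < n" "\<And>y. y \<in> V \<Longrightarrow> f y = g y"
  shows "((\<lambda>t. f (x(k := t))) has_real_derivative D) (at (x k)) \<longleftrightarrow>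
    ((\<lambda>t. g (x(k := t))) has_real_derivative D) (at (x k))"
  by (rule DERIV_cong_ev)
    (use eventually_line_in[OF assms(1-3)] assms(4) in \<open>auto elim: eventually_mono\<close>)

lemma partial_cong:
  assumes "openin (Euclidean_space n) V" "x \<in> V" "k < n" "\<And>y. y \<in> V \<Longrightarrow> f y = g y"
  shows "partial k f x = partial k g x"
  unfolding partial_def
  by (rule deriv_cong_ev)
    (use eventually_line_in[OF assms(1-3)] assms(4) in \<open>auto elim: eventually_mono\<close>)

lemma line_derivative_partial:
  "line_differentiable k f x \<Longrightarrow> ((\<lambda>t. f (x(k := t))) has_real_derivative partial k f x) (at (x k))"
  by (simp add: line_differentiable_iff)

text \<open>Class C^r by recursion on r. \<open>smooth\<close> speaks about all words of partial
  derivatives, whereas closure under sums, products and parameter integrals is an induction in which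
  only the innermost derivative is computed.\<close>

primrec Cdiff :: "nat \<Rightarrow> (nat \<Rightarrow> real) set \<Rightarrow> nat \<Rightarrow> ((nat \<Rightarrow> real) \<Rightarrow> real) \<Rightarrow> bool" where
  "Cdiff n V 0 f \<longleftrightarrow> continuous_on V f"
| "Cdiff n V (Suc r) f \<longleftrightarrow> continuous_on V f \<and>
    (\<forall>k<n. (\<forall>x\<in>V. line_differentiable k f x) \<and> Cdiff n V r (partial k f))"

lemma Cdiff_continuous: "Cdiff n V r f \<Longrightarrow> continuous_on V f"
  by (cases r) auto

lemma Cdiff_Suc: "Cdiff n V (Suc r) f \<Longrightarrow> Cdiff n V r f"
  by (induction r arbitrary: f) auto

lemma smooth_partial:
  assumes "smooth n V f" "k < n"
  shows "smooth n V (partial k f)"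
  unfolding smooth_def
proof (intro allI impI)
  fix ks assume "set ks \<subseteq> {..<n}"
  then have "set (ks @ [k]) \<subseteq> {..<n}" using assms(2) by simp
  with assms(1) have "continuous_on V (foldr partial (ks @ [k]) f) \<and>
     (\<forall>k'<n. \<forall>x\<in>V. (\<lambda>t. foldr partial (ks @ [k]) f (x(k' := t))) differentiable (at (x k')))"
    unfolding smooth_def by blast
  then show "continuous_on V (foldr partial ks (partial k f)) \<and>
     (\<forall>k'<n. \<forall>x\<in>V. (\<lambda>t. foldr partial ks (partial k f) (x(k' := t))) differentiable (at (x k')))"
    by simp
qed

lemma smooth_continuous: "smooth n V f \<Longrightarrow> continuous_on V f"
  unfolding smooth_def by (metis empty_set empty_subsetI foldr.simps(1) id_apply)

lemma smooth_line_differentiable: "smooth n V f \<Longrightarrow> k < n \<Longrightarrow> x \<in> V \<Longrightarrow> line_differentiable k f x"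
  unfolding smooth_def line_differentiable_def by (metis empty_set empty_subsetI foldr.simps(1) id_apply)

lemma smooth_iff_Cdiff: "smooth n V f \<longleftrightarrow> (\<forall>r. Cdiff n V r f)"
proof
  assume "smooth n V f"
  then have "Cdiff n V r f" for r
  proof (induction r arbitrary: f)
    case 0
    then show ?case by (simp add: smooth_continuous)
  next
    case (Suc r)
    then show ?case using smooth_continuous smooth_line_differentiable smooth_partial by auto
  qed
  then show "\<forall>r. Cdiff n V r f" ..
next
  assume f: "\<forall>r. Cdiff n V r f"
  have "Cdiff n V r (foldr partial ks f)" if "set ks \<subseteq> {..<n}" for ks r
    using that
  proof (induction ks arbitrary: r)
    case (Cons k ks)
    then show ?case using Cons.IH[of "Suc r"] by simp
  qed (use f in simp)
  then have "continuous_on V (foldr partial ks f)" "Cdiff n V (Suc 0) (foldr partial ks f)"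
    if "set ks \<subseteq> {..<n}" for ks using Cdiff_continuous that by blast+
  then show "smooth n V f"
    unfolding smooth_def by (auto simp: line_differentiable_def)
qed

lemma Cdiff_cong:
  assumes V: "openin (Euclidean_space n) V"
  shows "(\<And>x. x \<in> V \<Longrightarrow> f x = g x) \<Longrightarrow> Cdiff n V r f \<Longrightarrow> Cdiff n V r g"
proof (induction r arbitrary: f g)
  case 0
  then show ?case using continuous_on_cong[of V V f g] by simp
next
  case (Suc r)
  have "continuous_on V g"
    using Suc.prems continuous_on_cong[of V V f g] by simp
  moreover have "line_differentiable k g x" if "k < n" "x \<in> V" for k x
    by (rule line_differentiableI, rule iffD1[OF line_derivative_cong[OF V that(2,1) Suc.prems(1)]])
      (use Suc.prems(2) that in \<open>auto intro!: line_derivative_partial simp del: fun_upd_apply\<close>)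
  moreover have "Cdiff n V r (partial k g)" if "k < n" for k
    using Suc.IH[of "partial k f" "partial k g"] partial_cong[OF V _ that Suc.prems(1)] Suc.prems(2) that
    by auto
  ultimately show ?case by simp
qed

lemma smooth_cong:
  assumes "openin (Euclidean_space n) V" "smooth n V f" "\<And>x. x \<in> V \<Longrightarrow> f x = g x"
  shows "smooth n V g"
  using assms Cdiff_cong unfolding smooth_iff_Cdiff by metis

lemma Cdiff_subset: "Cdiff n V r f \<Longrightarrow> V' \<subseteq> V \<Longrightarrow> Cdiff n V' r f"
  by (induction r arbitrary: f) (auto intro: continuous_on_subset)

lemma smooth_subset: "smooth n V f \<Longrightarrow> V' \<subseteq> V \<Longrightarrow> smooth n V' f"
  using Cdiff_subset unfolding smooth_iff_Cdiff by blast

lemma Cdiff_const: "Cdiff n V r (\<lambda>_. c)"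
proof (induction r arbitrary: c)
  case (Suc r)
  have "partial k (\<lambda>_. c) = (\<lambda>_. 0)" for k by (rule ext) (simp add: partial_eqI)
  with Suc show ?case by (simp add: line_differentiable_def)
qed simp

lemma smooth_const: "smooth n V (\<lambda>_. c)"
  by (simp add: smooth_iff_Cdiff Cdiff_const)

lemma smooth_coordinate: "smooth n V (\<lambda>x. x i)"
  unfolding smooth_iff_Cdiff
proof
  fix r
  have c: "continuous_on V (\<lambda>x. x i)"
    by (rule continuous_on_subset[OF continuous_on_product_coordinates]) simp
  have d: "((\<lambda>t. (x(k := t)) i) has_real_derivative (if i = k then 1 else 0)) (at (x k))" for x k
    by (auto simp: fun_upd_def)
  then have "partial k (\<lambda>x. x i) = (\<lambda>_. if i = k then 1 else 0)" for k
    by (intro ext partial_eqI)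
  moreover have "line_differentiable k (\<lambda>x. x i) x" for k x
    by (rule line_differentiableI[OF d])
  ultimately show "Cdiff n V r (\<lambda>x. x i)"
    by (cases r) (use c Cdiff_const in auto)
qed

lemma Cdiff_add:
  assumes V: "openin (Euclidean_space n) V"
  shows "Cdiff n V r f \<Longrightarrow> Cdiff n V r g \<Longrightarrow> Cdiff n V r (\<lambda>x. f x + g x)"
proof (induction r arbitrary: f g)
  case 0
  then show ?case by (auto intro: continuous_on_add)
next
  case (Suc r)
  have d: "((\<lambda>t. f (x(k := t)) + g (x(k := t))) has_real_derivative partial k f x + partial k g x) (at (x k))"
    if "k < n" "x \<in> V" for k x
    using Suc.prems that by (auto intro!: DERIV_add line_derivative_partial)
  have "Cdiff n V r (partial k (\<lambda>x. f x + g x))" if "k < n" for k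
    by (rule Cdiff_cong[OF V, of "\<lambda>x. partial k f x + partial k g x"])
      (use Suc that in \<open>auto simp: partial_eqI[OF d]\<close>)
  with d Suc.prems show ?case
    by (auto intro!: continuous_on_add line_differentiableI)
qed

lemma Cdiff_mult:
  assumes V: "openin (Euclidean_space n) V"
  shows "Cdiff n V r f \<Longrightarrow> Cdiff n V r g \<Longrightarrow> Cdiff n V r (\<lambda>x. f x * g x)"
proof (induction r arbitrary: f g)
  case 0
  then show ?case by (auto intro: continuous_on_mult)
next
  case (Suc r)
  have d: "((\<lambda>t. f (x(k := t)) * g (x(k := t))) has_real_derivative
      partial k f x * g x + f x * partial k g x) (at (x k))"
    if "k < n" "x \<in> V" for k x
    using DERIV_mult[OF line_derivative_partial[of k f x] line_derivative_partial[of k g x]] Suc.prems that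
    by (simp add: add.commute mult.commute)
  have "Cdiff n V r (partial k (\<lambda>x. f x * g x))" if "k < n" for k
    by (rule Cdiff_cong[OF V, of "\<lambda>x. partial k f x * g x + f x * partial k g x"])
      (use Suc.prems that Cdiff_Suc in \<open>auto simp: partial_eqI[OF d] intro!: Cdiff_add[OF V] Suc.IH\<close>)
  with d Suc.prems show ?case
    by (auto intro!: continuous_on_mult line_differentiableI)
qed

lemma smooth_add:
  "openin (Euclidean_space n) V \<Longrightarrow> smooth n V f \<Longrightarrow> smooth n V g \<Longrightarrow> smooth n V (\<lambda>x. f x + g x)"
  by (simp add: smooth_iff_Cdiff Cdiff_add)

lemma smooth_mult:
  "openin (Euclidean_space n) V \<Longrightarrow> smooth n V f \<Longrightarrow> smooth n V g \<Longrightarrow> smooth n V (\<lambda>x. f x * g x)"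
  by (simp add: smooth_iff_Cdiff Cdiff_mult)

lemma smooth_sum:
  assumes "openin (Euclidean_space n) V" "\<And>i. i \<in> A \<Longrightarrow> smooth n V (f i)"
  shows "smooth n V (\<lambda>x. \<Sum>i\<in>A. f i x)"
  using assms(2)
  by (induction A rule: infinite_finite_induct) (auto intro: smooth_const smooth_add[OF assms(1)])


subsection \<open>Partial derivatives of Grassmann-valued functions\<close>

text \<open>A relation instead of the total function \<open>pd\<close>: existence of the derivative
  in the even directions travels with its value, and even and odd directions obey the same calculus
  rules.\<close>

definition has_pd :: "nat \<Rightarrow> nat \<Rightarrow> sfun \<Rightarrow> grassmann \<Rightarrow> (nat \<Rightarrow> real) \<Rightarrow> bool" where
  "has_pd n i F D x \<longleftrightarrow>
    (if i < n then \<forall>I. ((\<lambda>t. gcoeff (F (x(i := t))) I) has_real_derivative gcoeff D I) (at (x i))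
     else gderiv_odd (i - n) (F x) = D)"

lemma gcoeff_gpartial: "gcoeff (gpartial k F x) I = partial k (\<lambda>y. gcoeff (F y) I) x"
  by (simp add: gpartial.rep_eq gcoeff_infinite partial_def)

lemma pd_eqI: "has_pd n i F D x \<Longrightarrow> pd n i F x = D"
  unfolding has_pd_def pd_def
  by (auto simp: gcoeff_gpartial partial_eqI intro: grassmann_eqI split: if_splits)

lemma has_pd_unique: "has_pd n i F D x \<Longrightarrow> has_pd n i F D' x \<Longrightarrow> D = D'"
  using pd_eqI by blast

lemma has_pd_cong:
  assumes "openin (Euclidean_space n) V" "x \<in> V" "\<And>y. y \<in> V \<Longrightarrow> F y = G y" "has_pd n i F D x"
  shows "has_pd n i G D x"
proof (cases "i < n")
  case True
  have "((\<lambda>t. gcoeff (G (x(i := t))) I) has_real_derivative gcoeff D I) (at (x i))" for I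
    by (rule iffD1[OF line_derivative_cong[OF assms(1,2) True, of "\<lambda>y. gcoeff (F y) I"]])
      (use assms(3,4) True in \<open>auto simp: has_pd_def\<close>)
  with True show ?thesis by (simp add: has_pd_def)
qed (use assms in \<open>simp add: has_pd_def\<close>)

lemma pd_cong:
  assumes "openin (Euclidean_space n) V" "x \<in> V" "\<And>y. y \<in> V \<Longrightarrow> F y = G y"
  shows "pd n i F x = pd n i G x"
proof (cases "i < n")
  case True
  have "partial i (\<lambda>y. gcoeff (F y) I) x = partial i (\<lambda>y. gcoeff (G y) I) x" for I
    by (rule partial_cong[OF assms(1,2) True]) (simp add: assms(3))
  with True show ?thesis by (simp add: pd_def gcoeff_gpartial grassmann_eqI)
qed (use assms in \<open>simp add: pd_def\<close>)

lemma has_pd_const: "has_pd n i (\<lambda>_. of_real c) 0 x"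
  by (simp add: has_pd_def)

lemma has_pd_zero: "has_pd n i (\<lambda>_. 0) 0 x"
  using has_pd_const[of n i 0] by simp

lemma has_pd_one: "has_pd n i (\<lambda>_. 1) 0 x"
  using has_pd_const[of n i 1] by simp

lemma has_pd_of_real:
  "(i < n \<Longrightarrow> ((\<lambda>t. f (x(i := t))) has_real_derivative D) (at (x i))) \<Longrightarrow> (n \<le> i \<Longrightarrow> D = 0) \<Longrightarrow>
    has_pd n i (\<lambda>y. of_real (f y)) (of_real D) x"
  by (simp add: has_pd_def gcoeff_of_real)

lemma has_pd_add:
  "has_pd n i F D x \<Longrightarrow> has_pd n i G D' x \<Longrightarrow> has_pd n i (\<lambda>y. F y + G y) (D + D') x"
  by (auto simp: has_pd_def intro!: DERIV_add split: if_splits)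

lemma has_pd_scaleR: "has_pd n i F D x \<Longrightarrow> has_pd n i (\<lambda>y. c *\<^sub>R F y) (c *\<^sub>R D) x"
  by (auto simp: has_pd_def intro!: DERIV_cmult split: if_splits)

lemma has_pd_diff:
  "has_pd n i F D x \<Longrightarrow> has_pd n i G D' x \<Longrightarrow> has_pd n i (\<lambda>y. F y - G y) (D - D') x"
  by (auto simp: has_pd_def intro!: DERIV_diff split: if_splits)

lemma has_pd_sum:
  "(\<And>j. j \<in> A \<Longrightarrow> has_pd n i (F j) (D j) x) \<Longrightarrow> has_pd n i (\<lambda>y. \<Sum>j\<in>A. F j y) (\<Sum>j\<in>A. D j) x"
  by (induction A rule: infinite_finite_induct) (auto intro: has_pd_zero has_pd_add)

text \<open>In an even direction the sign is 1 and the rule is the ordinary product rule inside the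
  finite sum for each coefficient; in an odd direction it is the algebraic Leibniz rule.\<close>

lemma has_pd_mult:
  assumes F: "has_pd n i F D x" and G: "has_pd n i G D' x" and p: "has_parity p (F x)"
  shows "has_pd n i (\<lambda>y. F y * G y) (D * G x + ((- 1) ^ (par n i * p) :: real) *\<^sub>R (F x * D')) x"
proof (cases "i < n")
  case True
  have "((\<lambda>t. gcoeff (F (x(i := t)) * G (x(i := t))) K) has_real_derivative gcoeff (D * G x + F x * D') K) (at (x i))"
    for K
  proof -
    have "((\<lambda>t. \<Sum>I\<in>Pow K. gsign I (K - I) * gcoeff (F (x(i := t))) I * gcoeff (G (x(i := t))) (K - I))
      has_real_derivative (\<Sum>I\<in>Pow K. gsign I (K - I) * gcoeff D I * gcoeff (G x) (K - I) +
        gsign I (K - I) * gcoeff (F x) I * gcoeff D' (K - I))) (at (x i))"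
    proof (rule DERIV_sum)
      fix I
      have "((\<lambda>t. gcoeff (F (x(i := t))) I) has_real_derivative gcoeff D I) (at (x i))"
        "((\<lambda>t. gcoeff (G (x(i := t))) (K - I)) has_real_derivative gcoeff D' (K - I)) (at (x i))"
        using F G True by (simp_all add: has_pd_def)
      from DERIV_mult[OF DERIV_cmult[OF this(1), of "gsign I (K - I)"] this(2)]
      show "((\<lambda>t. gsign I (K - I) * gcoeff (F (x(i := t))) I * gcoeff (G (x(i := t))) (K - I))
        has_real_derivative gsign I (K - I) * gcoeff D I * gcoeff (G x) (K - I) +
          gsign I (K - I) * gcoeff (F x) I * gcoeff D' (K - I)) (at (x i))"
        by (simp add: mult_ac)
    qed
    then show ?thesis by (simp add: gcoeff_mult sum.distrib)
  qed
  with True show ?thesis by (simp add: has_pd_def par_def)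
next
  case False
  then show ?thesis using F G gderiv_odd_mult[OF p] by (simp add: has_pd_def par_def)
qed


subsection \<open>Superfunctions\<close>

lemma superfunctions_iff:
  "F \<in> superfunctions n m V \<longleftrightarrow>
    (\<forall>I. finite I \<longrightarrow> smooth n V (\<lambda>x. gcoeff (F x) I)) \<and> (\<forall>x\<in>V. gsupported m (F x))"
proof -
  have "smooth n V (\<lambda>x. gcoeff (F x) I)" if "infinite I" for I
    using that by (simp add: gcoeff_infinite smooth_const)
  then show ?thesis unfolding superfunctions_def gsupported_def by blast
qed

lemma superfunctions_smooth: "F \<in> superfunctions n m V \<Longrightarrow> smooth n V (\<lambda>x. gcoeff (F x) I)"
  by (simp add: superfunctions_def)

lemma superfunctions_gsupported: "F \<in> superfunctions n m V \<Longrightarrow> x \<in> V \<Longrightarrow> gsupported m (F x)"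
  by (simp add: superfunctions_iff)

lemma has_pd_superfunction:
  assumes "F \<in> superfunctions n m V" "x \<in> V"
  shows "has_pd n i F (pd n i F x) x"
proof (cases "i < n")
  case True
  then show ?thesis
    using line_derivative_partial[OF smooth_line_differentiable[OF superfunctions_smooth[OF assms(1)] True assms(2)]]
    by (simp add: has_pd_def pd_def gcoeff_gpartial)
qed (simp add: has_pd_def pd_def)

lemma superfunctions_cong:
  assumes "openin (Euclidean_space n) V" "F \<in> superfunctions n m V" "\<And>x. x \<in> V \<Longrightarrow> F x = G x"
  shows "G \<in> superfunctions n m V"
  unfolding superfunctions_iff
proof (intro conjI allI impI ballI)
  show "smooth n V (\<lambda>x. gcoeff (G x) I)" for I
    by (rule smooth_cong[OF assms(1) superfunctions_smooth[OF assms(2)]]) (simp add: assms(3))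
  show "gsupported m (G x)" if "x \<in> V" for x
    using superfunctions_gsupported[OF assms(2) that] assms(3)[OF that] by simp
qed

lemma superfunctions_subset: "F \<in> superfunctions n m V \<Longrightarrow> V' \<subseteq> V \<Longrightarrow> F \<in> superfunctions n m V'"
  by (auto simp: superfunctions_iff intro: smooth_subset)

lemma superfunctions_of_real: "smooth n V f \<Longrightarrow> (\<lambda>x. of_real (f x)) \<in> superfunctions n m V"
  unfolding superfunctions_iff
proof (intro conjI allI impI ballI)
  show "smooth n V (\<lambda>x. gcoeff (of_real (f x)) I)" if "smooth n V f" for I
    using that by (cases "I = {}") (simp_all add: gcoeff_of_real smooth_const)
qed simp

lemma superfunctions_const: "gsupported m c \<Longrightarrow> (\<lambda>_. c) \<in> superfunctions n m V"
  by (simp add: superfunctions_iff smooth_const)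

lemma superfunctions_zero: "(\<lambda>_. 0) \<in> superfunctions n m V"
  by (simp add: superfunctions_const)

lemma superfunctions_coord: "i < n + m \<Longrightarrow> coord n i \<in> superfunctions n m V"
  by (cases "i < n")
    (auto intro!: superfunctions_of_real smooth_coordinate superfunctions_const
      simp: coord_def[abs_def] gsupported_def gcoeff_ggen split: if_splits)

context
  fixes n m :: nat and V :: "(nat \<Rightarrow> real) set"
  assumes V: "openin (Euclidean_space n) V"
begin

lemma superfunctions_add:
  "F \<in> superfunctions n m V \<Longrightarrow> G \<in> superfunctions n m V \<Longrightarrow> (\<lambda>x. F x + G x) \<in> superfunctions n m V"
  by (auto simp: superfunctions_iff intro: smooth_add[OF V] gsupported_add)

lemma superfunctions_scaleR:
  "F \<in> superfunctions n m V \<Longrightarrow> (\<lambda>x. c *\<^sub>R F x) \<in> superfunctions n m V"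
  by (auto simp: superfunctions_iff intro: smooth_mult[OF V smooth_const] gsupported_scaleR)

lemma superfunctions_minus:
  "F \<in> superfunctions n m V \<Longrightarrow> (\<lambda>x. - F x) \<in> superfunctions n m V"
  using superfunctions_scaleR[of F "-1"] by simp

lemma superfunctions_diff:
  "F \<in> superfunctions n m V \<Longrightarrow> G \<in> superfunctions n m V \<Longrightarrow> (\<lambda>x. F x - G x) \<in> superfunctions n m V"
  using superfunctions_add[of F "\<lambda>x. - G x"] superfunctions_minus[of G] by simp

lemma superfunctions_sum:
  "(\<And>i. i \<in> A \<Longrightarrow> F i \<in> superfunctions n m V) \<Longrightarrow> (\<lambda>x. \<Sum>i\<in>A. F i x) \<in> superfunctions n m V"
  by (induction A rule: infinite_finite_induct) (auto intro: superfunctions_zero superfunctions_add)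

lemma superfunctions_mult:
  assumes "F \<in> superfunctions n m V" "G \<in> superfunctions n m V"
  shows "(\<lambda>x. F x * G x) \<in> superfunctions n m V"
  unfolding superfunctions_iff
proof (intro conjI allI impI ballI)
  show "smooth n V (\<lambda>x. gcoeff (F x * G x) I)" for I
    unfolding gcoeff_mult
    by (intro smooth_sum[OF V] smooth_mult[OF V] smooth_const superfunctions_smooth[OF assms(1)]
        superfunctions_smooth[OF assms(2)])
  show "gsupported m (F x * G x)" if "x \<in> V" for x
    using assms that superfunctions_gsupported gsupported_mult by blast
qed

lemma superfunctions_pd:
  assumes F: "F \<in> superfunctions n m V"
  shows "pd n i F \<in> superfunctions n m V"
proof (cases "i < n")
  case True
  show ?thesis unfolding superfunctions_iff
  proof (intro conjI allI impI ballI)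
    show "smooth n V (\<lambda>x. gcoeff (pd n i F x) I)" for I
      using smooth_partial[OF superfunctions_smooth[OF F] True] True by (simp add: pd_def gcoeff_gpartial)
    show "gsupported m (pd n i F x)" if "x \<in> V" for x
      unfolding gsupported_def
    proof (intro allI impI, rule ccontr)
      fix I assume I: "gcoeff (pd n i F x) I \<noteq> 0" "\<not> I \<subseteq> {..<m}"
      have "gcoeff (F y) I = 0" if "y \<in> V" for y
        using superfunctions_gsupported[OF F that] I(2) unfolding gsupported_def by blast
      then have "partial i (\<lambda>y. gcoeff (F y) I) x = partial i (\<lambda>y. 0) x"
        by (rule partial_cong[OF V that True])
      with I True show False by (simp add: pd_def gcoeff_gpartial partial_eqI)
    qed
  qed
next
  case False
  have "smooth n V (\<lambda>x. gcoeff (pd n i F x) I)" for I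
    using False smooth_mult[OF V smooth_const superfunctions_smooth[OF F]]
    by (cases "i - n \<in> I") (simp_all add: pd_def gcoeff_gderiv_odd smooth_const)
  with False show ?thesis
    using superfunctions_gsupported[OF F] by (auto simp: superfunctions_iff pd_def gsupported_gderiv_odd)
qed

lemma has_parity_pd:
  assumes "\<And>y. y \<in> V \<Longrightarrow> has_parity p (F y)" "x \<in> V"
  shows "has_parity (p + par n i) (pd n i F x)"
proof (cases "i < n")
  case True
  show ?thesis unfolding has_parity_def
  proof (intro allI impI, rule ccontr)
    fix I assume I: "gcoeff (pd n i F x) I \<noteq> 0" "even (card I) \<noteq> even (p + par n i)"
    have "gcoeff (F y) I = 0" if "y \<in> V" for y
      using assms(1)[OF that] I(2) True unfolding has_parity_def par_def by fastforce
    then have "partial i (\<lambda>y. gcoeff (F y) I) x = partial i (\<lambda>y. 0) x"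
      by (rule partial_cong[OF V assms(2) True])
    with I True show False by (simp add: pd_def gcoeff_gpartial partial_eqI)
  qed
qed (use assms has_parity_gderiv_odd[of p "F x"] in \<open>simp add: pd_def par_def\<close>)

end

lemma pd_coord:
  assumes "j < n + m"
  shows "pd n i (coord n j) x = (if i = j then 1 else 0)"
proof (rule pd_eqI)
  have e: "of_real (if i = j then 1 else 0) = (if i = j then 1 else 0 :: grassmann)" by (cases "i = j") simp_all
  consider "j < n" | "i < n" "\<not> j < n" | "\<not> i < n" "\<not> j < n" by blast
  then show "has_pd n i (coord n j) (if i = j then 1 else 0) x"
  proof cases
    case 1
    have "has_pd n i (\<lambda>y. of_real (y j)) (of_real (if i = j then 1 else 0)) x"
      by (rule has_pd_of_real) (use 1 in \<open>auto simp: fun_upd_def\<close>)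
    with 1 show ?thesis by (simp only: coord_def[abs_def] if_True e)
  next
    case 2
    then have "i \<noteq> j" by auto
    with 2 show ?thesis by (simp add: has_pd_def coord_def)
  next
    case 3
    then have "(i - n = j - n) = (i = j)" by auto
    with 3 show ?thesis by (simp add: has_pd_def coord_def gderiv_odd_ggen)
  qed
qed

lemma has_parity_coord: "has_parity (par n i) (coord n i x)"
  using has_parity_ggen[of "i - n"] by (auto simp: par_def coord_def)


subsection \<open>Hadamard's lemma on a cube\<close>

text \<open>A box is chosen because it is stable under moving a single coordinate towards its value
  at the centre, which is how Hadamard's lemma is proved.\<close>

definition cube :: "nat \<Rightarrow> (nat \<Rightarrow> real) \<Rightarrow> real \<Rightarrow> (nat \<Rightarrow> real) set" where
  "cube n y e = {x. (\<forall>i<n. \<bar>x i - y i\<bar> < e) \<and> (\<forall>i\<ge>n. x i = 0)}"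

lemma openin_cube: "openin (Euclidean_space n) (cube n y e)"
proof -
  have "open (\<Inter>i\<in>{..<n}. {x :: nat \<Rightarrow> real. \<bar>x i - y i\<bar> < e})"
    by (intro open_INT ballI open_Collect_less continuous_intros) auto
  then show ?thesis
    unfolding Euclidean_space_def openin_subtopology open_fun_def
    by (intro exI[of _ "\<Inter>i\<in>{..<n}. {x. \<bar>x i - y i\<bar> < e}"]) (auto simp: cube_def)
qed

lemma cube_subset:
  assumes "openin (Euclidean_space n) V" "y \<in> V"
  obtains e where "e > 0" "y \<in> cube n y e" "cube n y e \<subseteq> V"
proof -
  obtain U where U: "openin (powertop_real UNIV) U" "V = U \<inter> {x. \<forall>i\<ge>n. x i = 0}"
    using assms(1) by (auto simp: Euclidean_space_def openin_subtopology)
  then obtain X where X: "y \<in> (\<Pi>\<^sub>E i\<in>UNIV. X i)" "\<And>i. open (X i)" "(\<Pi>\<^sub>E i\<in>UNIV. X i) \<subseteq> U"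
    using product_topology_open_contains_basis[of "\<lambda>_. euclideanreal" UNIV U y] assms(2) by auto
  have "\<exists>d>0. ball (y i) d \<subseteq> X i" for i
    using X(1) X(2)[of i] by (auto simp: open_contains_ball)
  then obtain d where d: "\<And>i. d i > 0" "\<And>i. ball (y i) (d i) \<subseteq> X i" by metis
  \<comment> \<open>The inserted 1 keeps the minimum meaningful for n = 0.\<close>
  define e where "e = Min (insert 1 (d ` {..<n}))"
  have e: "e > 0" "\<And>i. i < n \<Longrightarrow> e \<le> d i"
    unfolding e_def using d(1) by auto
  have y0: "y i = 0" if "n \<le> i" for i using assms(2) U(2) that by auto
  show thesis
  proof
    show "y \<in> cube n y e" using e(1) y0 by (auto simp: cube_def)
    show "cube n y e \<subseteq> V"
    proof
      fix x assume x: "x \<in> cube n y e"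
      have "x i \<in> X i" for i
      proof (cases "i < n")
        case True
        then have "dist (y i) (x i) < d i"
          using x e(2)[of i] by (auto simp: cube_def dist_real_def)
        then show ?thesis using d(2)[of i] by auto
      next
        case False
        then have "x i = y i" using x y0 by (simp add: cube_def)
        then show ?thesis using X(1) by auto
      qed
      with x X(3) U(2) show "x \<in> V" by (auto simp: cube_def PiE_def Pi_def)
    qed
  qed (rule e)
qed

context
  fixes n :: nat and y :: "nat \<Rightarrow> real" and e :: real and k :: nat
  assumes k: "k < n"
begin

definition contract_coord :: "(nat \<Rightarrow> real) \<Rightarrow> real \<Rightarrow> nat \<Rightarrow> real" where
  "contract_coord x t = x(k := y k + t * (x k - y k))"

lemma contract_coord_in_cube:
  assumes "x \<in> cube n y e" "t \<in> {0..1}"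
  shows "contract_coord x t \<in> cube n y e"
proof -
  have "\<bar>t * (x k - y k)\<bar> \<le> \<bar>x k - y k\<bar>"
    using assms(2) by (simp add: abs_mult mult_left_le_one_le)
  then show ?thesis using assms(1) k by (auto simp: cube_def contract_coord_def)
qed

lemma continuous_on_contract_coord:
  "continuous_on S f \<Longrightarrow> continuous_on S g \<Longrightarrow> continuous_on S (\<lambda>p. contract_coord (f p) (g p))"
proof (rule continuous_on_coordinatewise_then_product)
  fix i assume fg: "continuous_on S f" "continuous_on S g"
  have "continuous_on S (\<lambda>p. f p i)" for i
    using fg(1) by (rule continuous_on_product_then_coordinatewise)
  with fg(2) show "continuous_on S (\<lambda>p. contract_coord (f p) (g p) i)"
    by (cases "i = k") (auto simp: contract_coord_def intro!: continuous_intros)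
qed

text \<open>Hadamard's quotient is the case p = 0. The weight t^p is included because
  differentiating under the integral in direction k produces a factor t; with it, the family is
  closed under all partial derivatives.\<close>

definition mean_along :: "nat \<Rightarrow> ((nat \<Rightarrow> real) \<Rightarrow> real) \<Rightarrow> (nat \<Rightarrow> real) \<Rightarrow> real" where
  "mean_along p g x = integral (cbox 0 1) (\<lambda>t. t ^ p * g (contract_coord x t))"

lemma continuous_on_mean_integrand:
  assumes g: "continuous_on (cube n y e) g" and f: "continuous_on S f" "f ` S \<subseteq> cube n y e"
  shows "continuous_on (S \<times> cbox 0 1) (\<lambda>(s, t). t ^ p * g (contract_coord (f s) t))"
proof -
  have "continuous_on (S \<times> cbox 0 1) (\<lambda>q. f (fst q))"
    by (rule continuous_on_compose2[OF f(1)]) (auto intro: continuous_intros)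
  then have "continuous_on (S \<times> cbox 0 1) (\<lambda>q. contract_coord (f (fst q)) (snd q))"
    by (rule continuous_on_contract_coord) (rule continuous_on_snd[OF continuous_on_id])
  then have "continuous_on (S \<times> cbox 0 1) (\<lambda>q. g (contract_coord (f (fst q)) (snd q)))"
    by (rule continuous_on_compose2[OF g]) (use f(2) contract_coord_in_cube in auto)
  then show ?thesis by (auto simp: case_prod_beta intro!: continuous_intros)
qed

lemma line_in_cube: "x \<in> cube n y e \<Longrightarrow> j < n \<Longrightarrow> s \<in> {y j - e<..<y j + e} \<Longrightarrow> x(j := s) \<in> cube n y e"
  by (auto simp: cube_def)

lemma mean_along_derivative:
  assumes g: "continuous_on (cube n y e) g" "\<And>x. x \<in> cube n y e \<Longrightarrow> line_differentiable j g x"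
    "continuous_on (cube n y e) (partial j g)" and x: "x \<in> cube n y e" and j: "j < n"
  shows "((\<lambda>s. mean_along p g (x(j := s))) has_real_derivative
    mean_along (if j = k then Suc p else p) (partial j g) x) (at (x j))"
proof -
  let ?U = "{y j - e<..<y j + e}" and ?q = "if j = k then Suc p else p"
  have xj: "x j \<in> ?U" using x j by (auto simp: cube_def abs_less_iff)
  have line: "continuous_on ?U (\<lambda>s. x(j := s))"
  proof (rule continuous_on_coordinatewise_then_product)
    fix i show "continuous_on ?U (\<lambda>s. (x(j := s)) i)" by (cases "i = j") auto
  qed
  have im: "(\<lambda>s. x(j := s)) ` ?U \<subseteq> cube n y e" using line_in_cube[OF x j] by blast
  have "((\<lambda>s. integral (cbox 0 1) (\<lambda>t. t ^ p * g (contract_coord (x(j := s)) t))) has_field_derivative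
      integral (cbox 0 1) (\<lambda>t. t ^ ?q * partial j g (contract_coord (x(j := x j)) t))) (at (x j) within ?U)"
  proof (rule leibniz_rule_field_derivative[where U = ?U
        and fx = "\<lambda>s t. t ^ ?q * partial j g (contract_coord (x(j := s)) t)"])
    show "continuous_on (?U \<times> cbox 0 1) (\<lambda>(s, t). t ^ ?q * partial j g (contract_coord (x(j := s)) t))"
      by (rule continuous_on_mean_integrand[OF g(3) line im])
    show "(\<lambda>t. t ^ p * g (contract_coord (x(j := s)) t)) integrable_on cbox 0 1" if "s \<in> ?U" for s
    proof (rule integrable_continuous)
      have "continuous_on (cbox 0 1) (\<lambda>t. g (contract_coord (x(j := s)) t))"
        by (rule continuous_on_compose2[OF g(1) continuous_on_contract_coord])
          (use contract_coord_in_cube[OF line_in_cube[OF x j that]] in \<open>auto intro!: continuous_intros\<close>)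
      then show "continuous_on (cbox 0 1) (\<lambda>t. t ^ p * g (contract_coord (x(j := s)) t))"
        by (intro continuous_intros)
    qed
    show "((\<lambda>s. t ^ p * g (contract_coord (x(j := s)) t)) has_field_derivative
        t ^ ?q * partial j g (contract_coord (x(j := s)) t)) (at s within ?U)"
      if s: "s \<in> ?U" and t: "t \<in> cbox 0 1" for s t
    proof -
      let ?z = "contract_coord (x(j := s)) t"
      have "?z \<in> cube n y e"
        using contract_coord_in_cube[OF line_in_cube[OF x j s]] t by simp
      from line_derivative_partial[OF g(2)[OF this]]
      have d: "((\<lambda>r. g (?z(j := r))) has_real_derivative partial j g ?z) (at (?z j))" .
      have "((\<lambda>s. g (contract_coord (x(j := s)) t)) has_real_derivative
          (if j = k then t else 1) * partial j g ?z) (at s)"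
      proof (cases "j = k")
        case True
        have e1: "g (contract_coord (x(j := s')) t) = g (?z(j := y k + t * (s' - y k)))" for s'
          using True by (simp add: contract_coord_def)
        have zj: "?z j = y k + t * (s - y k)" using True by (simp add: contract_coord_def)
        have "((\<lambda>s'. g (?z(j := y k + t * (s' - y k)))) has_real_derivative partial j g ?z * t) (at s)"
          by (rule DERIV_chain2[where f = "\<lambda>r. g (?z(j := r))" and g = "\<lambda>s'. y k + t * (s' - y k)" and x = s,
                OF d[unfolded zj]]) (auto intro!: derivative_eq_intros)
        then show ?thesis unfolding e1 using True by (simp add: mult.commute)
      next
        case False
        then have "contract_coord (x(j := s')) t = ?z(j := s')" for s'
          by (auto simp: contract_coord_def)
        with d False show ?thesis by (simp add: contract_coord_def)
      qed
      from DERIV_cmult[OF this, of "t ^ p"]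
      have "((\<lambda>s. t ^ p * g (contract_coord (x(j := s)) t)) has_field_derivative
        t ^ ?q * partial j g ?z) (at s)"
        by (auto simp: mult_ac split: if_splits)
      then show ?thesis by (rule has_field_derivative_at_within)
    qed
  qed (use xj in auto)
  then show ?thesis
    unfolding mean_along_def using xj by (simp add: at_within_open[of _ ?U])
qed

text \<open>The induction must vary p together with g, since a derivative in direction k raises
  p.\<close>

lemma Cdiff_mean_along: "Cdiff n (cube n y e) r g \<Longrightarrow> Cdiff n (cube n y e) r (mean_along p g)"
proof (induction r arbitrary: p g)
  have c: "continuous_on (cube n y e) (mean_along p g)" if "continuous_on (cube n y e) g" for p g
    unfolding mean_along_def[abs_def]
    by (rule integral_continuous_on_param, rule continuous_on_mean_integrand[OF that]) auto
  {
    case 0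
    then show ?case by (simp add: c)
  next
    case (Suc r)
    have d: "((\<lambda>s. mean_along p g (x(j := s))) has_real_derivative
      mean_along (if j = k then Suc p else p) (partial j g) x) (at (x j))"
      if "x \<in> cube n y e" "j < n" for x j
      using Suc.prems that by (intro mean_along_derivative) (auto intro: Cdiff_continuous)
    have "Cdiff n (cube n y e) r (partial j (mean_along p g))" if "j < n" for j
      by (rule Cdiff_cong[OF openin_cube, where f = "mean_along (if j = k then Suc p else p) (partial j g)"])
        (use Suc that in \<open>auto simp: partial_eqI[OF d]\<close>)
    with Suc.prems d c show ?case by (auto intro!: line_differentiableI)
  }
qed

text \<open>Fundamental theorem of calculus along the segment \<open>contract_coord x t\<close>,
  which runs from \<open>x(k := y k)\<close> at t = 0 to x at t = 1.\<close>

lemma Hadamard_step: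
  assumes f: "smooth n (cube n y e) f"
  shows "smooth n (cube n y e) (mean_along 0 (partial k f))"
    and "x \<in> cube n y e \<Longrightarrow> f x = f (x(k := y k)) + (x k - y k) * mean_along 0 (partial k f) x"
proof -
  show "smooth n (cube n y e) (mean_along 0 (partial k f))"
    using smooth_partial[OF f k] Cdiff_mean_along unfolding smooth_iff_Cdiff by blast
  assume x: "x \<in> cube n y e"
  have "((\<lambda>t. (x k - y k) * (partial k f (contract_coord x t))) has_integral
      f (contract_coord x 1) - f (contract_coord x 0)) {0..1}"
  proof (rule fundamental_theorem_of_calculus)
    fix t :: real assume t: "t \<in> {0..1}"
    let ?z = "contract_coord x t"
    have "?z \<in> cube n y e" using contract_coord_in_cube[OF x t] .
    from line_derivative_partial[OF smooth_line_differentiable[OF f k this]]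
    have d: "((\<lambda>r. f (?z(k := r))) has_real_derivative partial k f ?z) (at (?z k))" .
    have e1: "f (contract_coord x t') = f (?z(k := y k + t' * (x k - y k)))" for t'
      by (simp add: contract_coord_def)
    have zk: "?z k = y k + t * (x k - y k)" by (simp add: contract_coord_def)
    have "((\<lambda>t'. f (?z(k := y k + t' * (x k - y k)))) has_real_derivative partial k f ?z * (x k - y k)) (at t)"
      by (rule DERIV_chain2[where f = "\<lambda>r. f (?z(k := r))" and g = "\<lambda>t'. y k + t' * (x k - y k)" and x = t,
            OF d[unfolded zk]]) (auto intro!: derivative_eq_intros)
    then have "((\<lambda>t'. f (contract_coord x t')) has_real_derivative (x k - y k) * partial k f ?z) (at t within {0..1})"
      unfolding e1 by (simp add: mult.commute has_field_derivative_at_within)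
    then show "((\<lambda>t'. f (contract_coord x t')) has_vector_derivative (x k - y k) * partial k f ?z) (at t within {0..1})"
      by (simp add: has_real_derivative_iff_has_vector_derivative)
  qed simp
  from integral_unique[OF this]
  have "(x k - y k) * mean_along 0 (partial k f) x = f (contract_coord x 1) - f (contract_coord x 0)"
    unfolding mean_along_def by simp
  then show "f x = f (x(k := y k)) + (x k - y k) * mean_along 0 (partial k f) x"
    by (simp add: contract_coord_def)
qed

end

text \<open>The coordinates are frozen one after the other: after K steps the remainder g is f with
  the first K coordinates set to those of y.\<close>

lemma Hadamard_cube:
  assumes f: "smooth n (cube n y e) f" and y: "y \<in> cube n y e"
  obtains h where "\<And>k. k < n \<Longrightarrow> smooth n (cube n y e) (h k)"
    "\<And>x. x \<in> cube n y e \<Longrightarrow> f x = f y + (\<Sum>k<n. (x k - y k) * h k x)"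
proof -
  let ?C = "cube n y e"
  have "\<exists>g h. smooth n ?C g \<and> (\<forall>k<K. smooth n ?C (h k)) \<and>
      (\<forall>x\<in>?C. f x = g x + (\<Sum>k<K. (x k - y k) * h k x) \<and> g x = f (\<lambda>i. if i < K then y i else x i))"
    if "K \<le> n" for K
    using that
  proof (induction K)
    case 0
    then show ?case using f by auto
  next
    case (Suc K)
    from Suc.IH[OF Suc_leD[OF Suc.prems]]
    obtain g h where gh: "smooth n ?C g" "\<And>k. k < K \<Longrightarrow> smooth n ?C (h k)"
      "\<And>x. x \<in> ?C \<Longrightarrow> f x = g x + (\<Sum>k<K. (x k - y k) * h k x)"
      "\<And>x. x \<in> ?C \<Longrightarrow> g x = f (\<lambda>i. if i < K then y i else x i)" by blast
    have K: "K < n" using Suc.prems by simp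
    \<comment> \<open>By the Hadamard step \<open>?g x\<close> equals
      \<open>g (x(K := y K))\<close>; in the form given here its smoothness follows from closure
      under sums and products.\<close>
    let ?h = "mean_along y K 0 (partial K g)" and ?g = "\<lambda>x. g x - (x K - y K) * mean_along y K 0 (partial K g) x"
    note H = Hadamard_step[OF K gh(1)]
    have "smooth n ?C (\<lambda>x. g x + (- 1) * ((x K + - y K) * ?h x))"
      by (intro smooth_add smooth_mult openin_cube gh(1) H(1) smooth_const smooth_coordinate)
    then have "smooth n ?C ?g" by simp
    moreover have "smooth n ?C ((h(K := ?h)) k)" if "k < Suc K" for k
      using that gh(2) H(1) by (cases "k = K") auto
    moreover have "f x = ?g x + (\<Sum>k<Suc K. (x k - y k) * (h(K := ?h)) k x)" if "x \<in> ?C" for x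
    proof -
      have "(\<Sum>k<K. (x k - y k) * (h(K := ?h)) k x) = (\<Sum>k<K. (x k - y k) * h k x)"
        by (rule sum.cong) auto
      then show ?thesis using gh(3)[OF that] by simp
    qed
    moreover have "?g x = f (\<lambda>i. if i < Suc K then y i else x i)" if "x \<in> ?C" for x
    proof -
      have "x(K := y K) \<in> ?C" using that y K by (auto simp: cube_def)
      then have "g (x(K := y K)) = f (\<lambda>i. if i < K then y i else (x(K := y K)) i)" by (rule gh(4))
      also have "(\<lambda>i. if i < K then y i else (x(K := y K)) i) = (\<lambda>i. if i < Suc K then y i else x i)"
        by (auto simp: fun_eq_iff less_Suc_eq)
      finally show ?thesis using H(2)[OF that] by (simp del: fun_upd_apply)
    qed
    ultimately show ?case by (intro exI[of _ ?g] exI[of _ "h(K := ?h)"]) blast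
  qed
  from this[OF order_refl] obtain g h where gh: "\<And>k. k < n \<Longrightarrow> smooth n ?C (h k)"
      "\<And>x. x \<in> ?C \<Longrightarrow> f x = g x + (\<Sum>k<n. (x k - y k) * h k x)"
      "\<And>x. x \<in> ?C \<Longrightarrow> g x = f (\<lambda>i. if i < n then y i else x i)" by blast
  \<comment> \<open>Points of the cube vanish at all indices from n on, so freezing n coordinates
    leaves only y.\<close>
  have "(\<lambda>i. if i < n then y i else x i) = y" if "x \<in> ?C" for x
    using that y by (auto simp: cube_def fun_eq_iff)
  with gh that show thesis by metis
qed


subsection \<open>Morphisms of superdomains\<close>

text \<open>The map of points \<phi> is tied to T only through bodies; how T acts on the nilpotent
  part of a function is known from the algebra laws alone.\<close>

locale superdomain_morphism =
  fixes n m :: nat and V' V :: "(nat \<Rightarrow> real) set" and T :: "sfun \<Rightarrow> sfun"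
    and \<phi> :: "(nat \<Rightarrow> real) \<Rightarrow> nat \<Rightarrow> real"
  assumes V': "openin (Euclidean_space n) V'" and V: "openin (Euclidean_space n) V"
    and hom: "superalgebra_hom n m V' V T"
    and \<phi>: "x \<in> V \<Longrightarrow> \<phi> x \<in> V'"
    and body: "F \<in> superfunctions n m V' \<Longrightarrow> x \<in> V \<Longrightarrow> gbody (T F x) = gbody (F (\<phi> x))"
begin

abbreviation "\<S>' \<equiv> superfunctions n m V'"
abbreviation "\<S> \<equiv> superfunctions n m V"

lemma T_superfunction: "F \<in> \<S>' \<Longrightarrow> T F \<in> \<S>"
  using hom unfolding superalgebra_hom_def by blast

lemma T_parity:
  "F \<in> \<S>' \<Longrightarrow> (\<And>y. y \<in> V' \<Longrightarrow> has_parity p (F y)) \<Longrightarrow> x \<in> V \<Longrightarrow> has_parity p (T F x)"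
  using hom unfolding superalgebra_hom_def by blast

lemma T_scaleR: "F \<in> \<S>' \<Longrightarrow> x \<in> V \<Longrightarrow> T (\<lambda>y. r *\<^sub>R F y) x = r *\<^sub>R T F x"
  using hom unfolding superalgebra_hom_def by blast

lemma T_cong:
  "F \<in> \<S>' \<Longrightarrow> (\<And>y. y \<in> V' \<Longrightarrow> F y = G y) \<Longrightarrow> x \<in> V \<Longrightarrow> T F x = T G x"
  using hom superfunctions_cong[OF V', of F m G] unfolding superalgebra_hom_def by blast

lemma T_add: "F \<in> \<S>' \<Longrightarrow> G \<in> \<S>' \<Longrightarrow> x \<in> V \<Longrightarrow> T (\<lambda>y. F y + G y) x = T F x + T G x"
  using hom unfolding superalgebra_hom_def by blast

lemma T_mult: "F \<in> \<S>' \<Longrightarrow> G \<in> \<S>' \<Longrightarrow> x \<in> V \<Longrightarrow> T (\<lambda>y. F y * G y) x = T F x * T G x"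
  using hom unfolding superalgebra_hom_def by blast

lemma T_one: "x \<in> V \<Longrightarrow> T (\<lambda>_. 1) x = 1"
  using hom unfolding superalgebra_hom_def by blast

lemma T_of_real: "x \<in> V \<Longrightarrow> T (\<lambda>_. of_real r) x = of_real r"
  using T_scaleR[of "\<lambda>_. 1" x r] by (simp add: T_one superfunctions_const of_real_def)

lemma T_zero: "x \<in> V \<Longrightarrow> T (\<lambda>_. 0) x = 0"
  using T_of_real[of x 0] by simp

lemma T_diff: "F \<in> \<S>' \<Longrightarrow> G \<in> \<S>' \<Longrightarrow> x \<in> V \<Longrightarrow> T (\<lambda>y. F y - G y) x = T F x - T G x"
  using T_add[of F "\<lambda>y. (- 1) *\<^sub>R G y" x] T_scaleR[of G x "- 1"] superfunctions_scaleR[OF V', of G m "- 1"]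
  by simp

lemma T_sum:
  "(\<And>i. i \<in> A \<Longrightarrow> F i \<in> \<S>') \<Longrightarrow> x \<in> V \<Longrightarrow> T (\<lambda>y. \<Sum>i\<in>A. F i y) x = (\<Sum>i\<in>A. T (F i) x)"
  by (induction A rule: infinite_finite_induct)
    (simp_all add: T_zero T_add superfunctions_sum[OF V'])

lemma pd_T_cong:
  assumes "\<And>x. x \<in> V \<Longrightarrow> T F x = G x" "x \<in> V"
  shows "pd n i (T F) x = pd n i G x"
  using assms pd_cong[OF V] by blast

lemma has_pd_T: "F \<in> \<S>' \<Longrightarrow> x \<in> V \<Longrightarrow> has_pd n i (T F) (pd n i (T F) x) x"
  using has_pd_superfunction T_superfunction by blast

section \<open>The Jacobian and the chain rule of a morphism\<close>

definition J :: "nat \<Rightarrow> nat \<Rightarrow> sfun" where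
  "J i j = pd n i (T (coord n j))"

lemma J_superfunction: "j < n + m \<Longrightarrow> J i j \<in> \<S>"
  unfolding J_def by (intro superfunctions_pd[OF V] T_superfunction superfunctions_coord)

lemma J_parity: "j < n + m \<Longrightarrow> x \<in> V \<Longrightarrow> has_parity (par n i + par n j) (J i j x)"
  unfolding J_def
  using has_parity_pd[OF V, of "par n j" "T (coord n j)" x i] T_parity[OF superfunctions_coord has_parity_coord]
  by (simp add: add.commute)

definition chain_defect :: "nat \<Rightarrow> (nat \<Rightarrow> real) \<Rightarrow> sfun \<Rightarrow> grassmann" where
  "chain_defect i x F = pd n i (T F) x - (\<Sum>j<n+m. J i j x * T (pd n j F) x)"

context
  fixes i :: nat and x :: "nat \<Rightarrow> real"
  assumes x: "x \<in> V"
begin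

lemma chain_defect_cong:
  assumes "F \<in> \<S>'" "\<And>y. y \<in> V' \<Longrightarrow> F y = G y"
  shows "chain_defect i x F = chain_defect i x G"
proof -
  have "pd n i (T F) x = pd n i (T G) x"
    using T_cong[OF assms] by (rule pd_T_cong[OF _ x])
  moreover have "T (pd n j F) x = T (pd n j G) x" for j
    by (rule T_cong[OF superfunctions_pd[OF V' assms(1)] pd_cong[OF V' _ assms(2)] x])
  ultimately show ?thesis by (simp add: chain_defect_def)
qed

lemma chain_defect_add:
  assumes "F \<in> \<S>'" "G \<in> \<S>'"
  shows "chain_defect i x (\<lambda>y. F y + G y) = chain_defect i x F + chain_defect i x G"
proof -
  have "pd n i (T (\<lambda>y. F y + G y)) x = pd n i (\<lambda>x. T F x + T G x) x"
    using T_add[OF assms] by (rule pd_T_cong[OF _ x])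
  also have "\<dots> = pd n i (T F) x + pd n i (T G) x"
    using assms x by (intro pd_eqI has_pd_add has_pd_T)
  finally have 1: "pd n i (T (\<lambda>y. F y + G y)) x = pd n i (T F) x + pd n i (T G) x" .
  have "T (pd n j (\<lambda>y. F y + G y)) x = T (\<lambda>y. pd n j F y + pd n j G y) x" for j
    by (rule T_cong[OF superfunctions_pd[OF V' superfunctions_add[OF V' assms]] _ x])
      (auto intro!: pd_eqI has_pd_add has_pd_superfunction assms)
  then have "T (pd n j (\<lambda>y. F y + G y)) x = T (pd n j F) x + T (pd n j G) x" for j
    using T_add[OF superfunctions_pd[OF V' assms(1)] superfunctions_pd[OF V' assms(2)] x] by simp
  with 1 show ?thesis by (simp add: chain_defect_def distrib_left sum.distrib)
qed

lemma chain_defect_sum: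
  "(\<And>k. k \<in> A \<Longrightarrow> F k \<in> \<S>') \<Longrightarrow> chain_defect i x (\<lambda>_. 0) = 0 \<Longrightarrow>
    chain_defect i x (\<lambda>y. \<Sum>k\<in>A. F k y) = (\<Sum>k\<in>A. chain_defect i x (F k))"
  by (induction A rule: infinite_finite_induct)
    (simp_all add: chain_defect_add superfunctions_sum[OF V'])

lemma chain_defect_const: "chain_defect i x (\<lambda>_. of_real r) = 0"
proof -
  have "pd n i (T (\<lambda>_. of_real r)) x = pd n i (\<lambda>_. of_real r) x"
    using T_of_real by (rule pd_T_cong[OF _ x])
  moreover have "pd n j (\<lambda>_. of_real r) = (\<lambda>_. 0)" for j
    by (rule ext) (rule pd_eqI[OF has_pd_const])
  ultimately show ?thesis by (simp add: chain_defect_def T_zero[OF x])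
qed

lemma chain_defect_coord: "k < n + m \<Longrightarrow> chain_defect i x (coord n k) = 0"
proof -
  assume k: "k < n + m"
  have "pd n j (coord n k) = (\<lambda>_. if j = k then 1 else 0)" for j
    using pd_coord[OF k] by blast
  then have "T (pd n j (coord n k)) x = (if j = k then 1 else 0)" for j
    using T_one[OF x] T_zero[OF x] by simp
  moreover have "(\<Sum>j<n+m. J i j x * (if j = k then 1 else 0)) = J i k x"
    using k by (simp add: if_distrib[of "\<lambda>z. _ * z"] cong: if_cong)
  ultimately show ?thesis by (simp only: chain_defect_def J_def diff_self)
qed

text \<open>The product rule in the new coordinates has the sign belonging to j, but moving
  \<open>T F x\<close> to the left of \<open>J i j x\<close> contributes the sign of (i + j) p, so
  every summand ends up with the sign belonging to i and the sums recombine.\<close>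

lemma chain_defect_mult:
  assumes F: "F \<in> \<S>'" "\<And>y. y \<in> V' \<Longrightarrow> has_parity p (F y)" and G: "G \<in> \<S>'"
  shows "chain_defect i x (\<lambda>y. F y * G y) =
    chain_defect i x F * T G x + ((- 1) ^ (par n i * p) :: real) *\<^sub>R (T F x * chain_defect i x G)"
proof -
  let ?s = "\<lambda>j. (- 1) ^ (par n j * p) :: real"
  have "pd n i (T (\<lambda>y. F y * G y)) x = pd n i (\<lambda>x. T F x * T G x) x"
    using T_mult[OF F(1) G] by (rule pd_T_cong[OF _ x])
  also have "\<dots> = pd n i (T F) x * T G x + ?s i *\<^sub>R (T F x * pd n i (T G) x)"
    using F G x by (intro pd_eqI has_pd_mult has_pd_T T_parity)
  finally have 1: "pd n i (T (\<lambda>y. F y * G y)) x = \<dots>" .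
  have 2: "J i j x * T (pd n j (\<lambda>y. F y * G y)) x =
      J i j x * T (pd n j F) x * T G x + ?s i *\<^sub>R (T F x * (J i j x * T (pd n j G) x))"
    if j: "j < n + m" for j
  proof -
    have "T (pd n j (\<lambda>y. F y * G y)) x = T (\<lambda>y. pd n j F y * G y + ?s j *\<^sub>R (F y * pd n j G y)) x"
      by (rule T_cong[OF superfunctions_pd[OF V' superfunctions_mult[OF V' F(1) G]] _ x])
        (auto intro!: pd_eqI has_pd_mult has_pd_superfunction F G)
    also have "\<dots> = T (pd n j F) x * T G x + ?s j *\<^sub>R (T F x * T (pd n j G) x)"
      using F(1) G by (simp add: T_add T_mult T_scaleR x superfunctions_pd[OF V'] superfunctions_mult[OF V']
          superfunctions_scaleR[OF V'])
    finally have "T (pd n j (\<lambda>y. F y * G y)) x = \<dots>" .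
    moreover have "J i j x * T F x = ((- 1) ^ ((par n i + par n j) * p) :: real) *\<^sub>R (T F x * J i j x)"
      by (rule mult_commute_parity[OF J_parity[OF j x] T_parity[OF F x]])
    then have "J i j x * (T F x * z) = ((- 1) ^ ((par n i + par n j) * p) :: real) *\<^sub>R (T F x * (J i j x * z))" for z
      by (metis mult.assoc mult_scaleR_left)
    moreover have "?s j * (- 1) ^ ((par n i + par n j) * p) = ?s i"
      by (auto simp: minus_one_power_iff)
    ultimately show ?thesis by (simp add: distrib_left mult.assoc)
  qed
  have "(\<Sum>j<n+m. J i j x * T (pd n j (\<lambda>y. F y * G y)) x) =
      (\<Sum>j<n+m. J i j x * T (pd n j F) x * T G x + ?s i *\<^sub>R (T F x * (J i j x * T (pd n j G) x)))"
    by (rule sum.cong) (simp_all add: 2)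
  then show ?thesis unfolding chain_defect_def 1
    by (simp add: sum.distrib left_diff_distrib right_diff_distrib sum_distrib_left sum_distrib_right
        scaleR_sum_right scaleR_diff_right mult.assoc)
qed

end

end

text \<open>Hadamard's lemma writes \<open>f\<close> as a constant plus terms \<open>(x\<^sup>k - y\<^sup>k) h\<^sub>k\<close>; the first factor is pulled back
  to an element without body. Hence if the defect of the chain rule lies in the \<open>r\<close>-th power of the
  ideal of nilpotents for all \<open>f\<close>, then it lies in the \<open>(r+1)\<close>-st.\<close>

lemma (in superdomain_morphism) chain_defect_order:
  assumes "V' = cube n y e" "x \<in> V" "\<phi> x = y" and f: "smooth n V' f"
  shows "gorder_ge r (chain_defect i x (\<lambda>z. of_real (f z)))"
  using f
proof (induction r arbitrary: f)
  case (Suc r)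
  have y: "y \<in> cube n y e" using \<phi> assms by auto
  from Suc.prems have "smooth n (cube n y e) f" using assms(1) by simp
  from Hadamard_cube[OF this y] obtain h where
    h: "\<And>k. k < n \<Longrightarrow> smooth n V' (h k)"
    and f: "\<And>z. z \<in> V' \<Longrightarrow> f z = f y + (\<Sum>k<n. (z k - y k) * h k z)"
    using assms(1) by metis
  \<comment> \<open>With this constant, x^k - y^k is an even superfunction whose defect vanishes,
    because coordinates and constants have none.\<close>
  define c where "c k = (of_real (- y k) :: grassmann)" for k
  have c: "gsupported m (c k)" "has_parity 0 (c k)" "chain_defect i x (\<lambda>_. c k) = 0" "gbody (c k) = - y k" for k
    unfolding c_def using chain_defect_const[OF assms(2)]
    by (simp_all only: gsupported_of_real has_parity_of_real gbody_simps)
  let ?X = "\<lambda>k z. coord n k z + c k" and ?h = "\<lambda>k z. of_real (h k z)"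
  have X: "?X k \<in> \<S>'" if "k < n" for k
    using that by (intro superfunctions_add[OF V'] superfunctions_coord superfunctions_const c) auto
  have Xp: "has_parity 0 (?X k z)" if "k < n" for k z
    using that has_parity_coord[of n k z] by (auto simp: par_def intro!: has_parity_add c)
  have hS: "?h k \<in> \<S>'" if "k < n" for k
    using that h by (intro superfunctions_of_real)
  have Xh: "(\<lambda>z. ?X k z * ?h k z) \<in> \<S>'" if "k < n" for k
    using that X hS by (intro superfunctions_mult[OF V'])
  have "chain_defect i x (\<lambda>z. of_real (f z)) =
      chain_defect i x (\<lambda>z. of_real (f y) + (\<Sum>k<n. ?X k z * ?h k z))"
    by (rule chain_defect_cong[OF assms(2) superfunctions_of_real[OF Suc.prems]])
      (subst f, simp_all add: coord_def c_def)
  also have "\<dots> = (\<Sum>k<n. chain_defect i x (\<lambda>z. ?X k z * ?h k z))"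
  proof -
    have "chain_defect i x (\<lambda>z. \<Sum>k<n. ?X k z * ?h k z) = (\<Sum>k<n. chain_defect i x (\<lambda>z. ?X k z * ?h k z))"
      by (rule chain_defect_sum[OF assms(2)]) (use Xh chain_defect_const[OF assms(2), of i 0] in auto)
    moreover have "(\<lambda>z. \<Sum>k<n. ?X k z * ?h k z) \<in> \<S>'"
      using Xh by (intro superfunctions_sum[OF V']) auto
    ultimately show ?thesis
      by (simp add: chain_defect_add[OF assms(2)] superfunctions_const chain_defect_const[OF assms(2)])
  qed
  also have "\<dots> = (\<Sum>k<n. T (?X k) x * chain_defect i x (?h k))"
  proof (rule sum.cong)
    fix k assume "k \<in> {..<n}"
    then have k: "k < n" by simp
    have "chain_defect i x (?X k) = 0"
      using k chain_defect_add[OF assms(2) superfunctions_coord superfunctions_const, of k "c k" i] c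
        chain_defect_coord[OF assms(2), of k i]
      by simp
    then show "chain_defect i x (\<lambda>z. ?X k z * ?h k z) = T (?X k) x * chain_defect i x (?h k)"
      using chain_defect_mult[OF assms(2) X[OF k] Xp[OF k] hS[OF k], of i] by simp
  qed simp
  finally have e: "chain_defect i x (\<lambda>z. of_real (f z)) = \<dots>" .
  have "gorder_ge (1 + r) (T (?X k) x * chain_defect i x (?h k))" if "k < n" for k
  proof (intro gorder_ge_mult gorder_ge_1)
    show "gbody (T (?X k) x) = 0"
      using body[OF X[OF that] assms(2)] that assms(3) by (simp add: coord_def c)
  qed (use Suc.IH h that in auto)
  then show ?case unfolding e by (auto intro: gorder_ge_sum)
qed simp

text \<open>The defect involves only the first m generators, while its order can be taken above
  m.\<close>

lemma (in superdomain_morphism) chain_defect_scalar: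
  assumes "V' = cube n y e" "x \<in> V" "\<phi> x = y" and f: "smooth n V' f"
  shows "chain_defect i x (\<lambda>z. of_real (f z)) = 0"
proof (rule gorder_ge_eq_0)
  let ?F = "\<lambda>z. of_real (f z) :: grassmann"
  have F: "?F \<in> \<S>'" by (rule superfunctions_of_real[OF f])
  show "gsupported m (chain_defect i x ?F)"
    unfolding chain_defect_def
    by (intro gsupported_diff gsupported_sum gsupported_mult
        superfunctions_gsupported[where n = n and V = V, OF _ assms(2)]
        superfunctions_pd[OF V] T_superfunction F superfunctions_pd[OF V'] J_superfunction) auto
qed (use chain_defect_order[OF assms] in auto)

text \<open>Induction on the number l of generators that occur. With \<theta> the next generator and
  H the derivative of F by it, F = (F - \<theta> H) + \<theta> H, where both F - \<theta> H and H
  are free of \<theta>; the derivation property and the vanishing on the coordinate \<theta> do the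
  rest. The start l = 0 is the case of real-valued functions.\<close>

lemma (in superdomain_morphism) chain_defect_eq_0:
  assumes cube: "V' = cube n y e" "x \<in> V" "\<phi> x = y" and F: "F \<in> \<S>'"
  shows "chain_defect i x F = 0"
proof -
  have "chain_defect i x F = 0" if "F \<in> \<S>'" "l \<le> m" "\<And>z. z \<in> V' \<Longrightarrow> gsupported l (F z)" for F l
    using that
  proof (induction l arbitrary: F)
    case 0
    have "F z = of_real (gbody (F z))" if "z \<in> V'" for z
    proof (rule grassmann_eqI)
      fix I show "gcoeff (F z) I = gcoeff (of_real (gbody (F z))) I"
        using 0(3)[OF that] by (cases "I = {}") (auto simp: gsupported_def gcoeff_of_real gbody_def)
    qed
    then have "chain_defect i x F = chain_defect i x (\<lambda>z. of_real (gbody (F z)))"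
      by (rule chain_defect_cong[OF cube(2) 0(1)])
    then show ?case
      using chain_defect_scalar[OF cube] superfunctions_smooth[OF 0(1)] by (simp add: gbody_def)
  next
    case (Suc l)
    let ?H = "pd n (n + l) F" and ?\<theta> = "coord n (n + l)"
    let ?G = "\<lambda>z. F z + (- 1) *\<^sub>R (?\<theta> z * ?H z)"
    have H: "?H \<in> \<S>'" and \<theta>: "?\<theta> \<in> \<S>'"
      using Suc.prems(1,2) by (auto intro: superfunctions_pd[OF V'] superfunctions_coord)
    have \<theta>H: "(\<lambda>z. ?\<theta> z * ?H z) \<in> \<S>'" by (rule superfunctions_mult[OF V' \<theta> H])
    have G: "?G \<in> \<S>'" by (intro superfunctions_add[OF V'] superfunctions_scaleR[OF V'] Suc.prems(1) \<theta>H)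
    have sH: "gsupported l (?H z)" if "z \<in> V'" for z
      unfolding gsupported_def
    proof (intro allI impI)
      fix I assume "gcoeff (?H z) I \<noteq> 0"
      then have l: "l \<notin> I" "gcoeff (F z) (insert l I) \<noteq> 0"
        by (auto simp: pd_def gcoeff_gderiv_odd split: if_splits)
      then have "insert l I \<subseteq> {..<Suc l}" using Suc.prems(3)[OF that] unfolding gsupported_def by blast
      with l(1) show "I \<subseteq> {..<l}" by (fastforce simp: less_Suc_eq)
    qed
    have sG: "gsupported l (?G z)" if z: "z \<in> V'" for z
      unfolding gsupported_def
    proof (intro allI impI)
      fix I assume I: "gcoeff (?G z) I \<noteq> 0"
      show "I \<subseteq> {..<l}"
      proof (cases "l \<in> I")
        case True
        have "finite I" using I gcoeff_infinite by blast
        define K where "K = I - {l}"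
        have K: "I = insert l K" "l \<notin> K" "finite K" using True \<open>finite I\<close> by (auto simp: K_def)
        \<comment> \<open>Multiplying the derivative by \<theta>_l restores the part of F that
          contains \<theta>_l: the sign of the derivative and that of the product are the same and
          square to 1.\<close>
        have "gcoeff (ggen l * gderiv_odd l (F z)) I =
            (\<Sum>L\<in>{{l}}. gsign L (I - L) * gcoeff (ggen l) L * gcoeff (gderiv_odd l (F z)) (I - L))"
          unfolding gcoeff_mult using K by (intro sum.mono_neutral_right) (auto simp: gcoeff_ggen)
        also have "\<dots> = gcoeff (F z) I"
          using K by (simp add: gcoeff_ggen gcoeff_gderiv_odd)
        finally have "gcoeff (?G z) I = 0" by (simp add: pd_def coord_def)
        with I show ?thesis by simp
      next
        case False
        then have "gcoeff (?\<theta> z * ?H z) I = 0"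
          unfolding gcoeff_mult by (intro sum.neutral) (auto simp: coord_def gcoeff_ggen)
        with I have "gcoeff (F z) I \<noteq> 0" by simp
        then have "I \<subseteq> {..<Suc l}" using Suc.prems(3)[OF z] unfolding gsupported_def by blast
        with False show ?thesis by (fastforce simp: less_Suc_eq)
      qed
    qed
    have "chain_defect i x (\<lambda>z. ?\<theta> z * ?H z) = 0"
      using chain_defect_mult[OF cube(2) \<theta> has_parity_coord H, of i] Suc.IH[OF H _ sH]
        chain_defect_coord[OF cube(2), of "n + l" i] Suc.prems(2) by simp
    moreover have "chain_defect i x ?G = 0" using Suc.IH[OF G _ sG] Suc.prems(2) by simp
    moreover have "chain_defect i x F = chain_defect i x (\<lambda>z. ?G z + ?\<theta> z * ?H z)"
      by (rule chain_defect_cong[OF cube(2) Suc.prems(1)]) simp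
    ultimately show ?case using chain_defect_add[OF cube(2) G \<theta>H, of i] by simp
  qed
  from this[OF F order_refl] show ?thesis using superfunctions_gsupported[OF F] by blast
qed


subsection \<open>Determinants with even entries\<close>

text \<open>Even elements commute, so in this type the ordered products in \<open>gdet\<close>
  become products over sets and can be reindexed by permutations.\<close>

typedef geven = "{a. has_parity 0 a}" morphisms geven_rep geven_of
  by (rule exI[of _ 0]) simp

setup_lifting type_definition_geven

instantiation geven :: comm_monoid_mult
begin
lift_definition one_geven :: geven is 1 by simp
lift_definition times_geven :: "geven \<Rightarrow> geven \<Rightarrow> geven" is "(*)"
  using has_parity_mult by fastforce
instance
  by standard (transfer, simp add: mult.assoc mult_commute_even')+
end

lemma prod_list_geven:
  "(\<And>j. j < k \<Longrightarrow> has_parity 0 (f j)) \<Longrightarrow>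
    prod_list (map f [0..<k]) = geven_rep (\<Prod>j<k. geven_of (f j))"
proof (induction k)
  case (Suc k)
  then show ?case by (simp add: times_geven.rep_eq geven_of_inverse mult.commute[of "geven_of (f k)"])
qed (simp add: one_geven.rep_eq)

lemma has_parity_prod_list:
  "(\<And>j. j < k \<Longrightarrow> has_parity 0 (f j)) \<Longrightarrow> has_parity 0 (prod_list (map f [0..<k]))"
  using geven_rep by (simp add: prod_list_geven)

lemma prod_list_replace:
  assumes "j < k" "has_parity 0 a"
  shows "a * prod_list (map (f(j := 1)) [0..<k]) = prod_list (map (f(j := a)) [0..<k])"
  using assms(1)
proof (induction k)
  case (Suc k)
  show ?case
  proof (cases "j = k")
    case True
    have "map (f(j := b)) [0..<k] = map f [0..<k]" for b using True by auto
    then show ?thesis using True mult_commute_even'[OF assms(2)] by (simp del: fun_upd_apply add: fun_upd_same)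
  next
    case False
    then show ?thesis using Suc by (simp add: mult.assoc[symmetric])
  qed
qed simp

lemma has_parity_of_int: "has_parity 0 (of_int z)"
  by (metis has_parity_of_real of_real_of_int_eq)

lemma permutes_lessThan: "p permutes {..<k} \<Longrightarrow> i < k \<Longrightarrow> p i < (k :: nat)"
  using permutes_in_image by fastforce

lemma has_parity_gdet:
  assumes "\<And>i j. i < k \<Longrightarrow> j < k \<Longrightarrow> has_parity 0 (A i j)"
  shows "has_parity 0 (gdet k A)"
proof -
  have "has_parity (0 + 0) (of_int (sign p) * prod_list (map (\<lambda>i. A i (p i)) [0..<k]))"
    if "p permutes {..<k}" for p
    using that permutes_lessThan assms
    by (intro has_parity_mult has_parity_of_int has_parity_prod_list) auto
  then show ?thesis unfolding gdet_def by (auto intro: has_parity_sum)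
qed

lemma gdet_cong:
  assumes "\<And>i j. i < k \<Longrightarrow> j < k \<Longrightarrow> A i j = B i j"
  shows "gdet k A = gdet k B"
proof -
  have "map (\<lambda>i. A i (p i)) [0..<k] = map (\<lambda>i. B i (p i)) [0..<k]" if "p permutes {..<k}" for p
    using that assms permutes_lessThan by auto
  then show ?thesis unfolding gdet_def by (intro sum.cong refl) (simp only: mem_Collect_eq)
qed

text \<open>Composing with the transposition of the two rows flips the sign of a permutation and
  preserves its product, so the determinant equals its negative; 2 is invertible.\<close>

lemma gdet_equal_rows:
  assumes par: "\<And>i j. i < k \<Longrightarrow> j < k \<Longrightarrow> has_parity 0 (A i j)"
    and ab: "a < k" "b < k" "a \<noteq> b" and rows: "\<And>j. j < k \<Longrightarrow> A a j = A b j"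
  shows "gdet k A = 0"
proof -
  let ?\<tau> = "Transposition.transpose a b"
  let ?t = "\<lambda>p. of_int (sign p) * prod_list (map (\<lambda>i. A i (p i)) [0..<k])"
  have \<tau>: "?\<tau> permutes {..<k}" using ab by (intro permutes_swap_id) auto
  have t: "?t (p \<circ> ?\<tau>) = - ?t p" if p: "p permutes {..<k}" for p
  proof -
    have p\<tau>: "p \<circ> ?\<tau> permutes {..<k}" by (rule permutes_compose[OF \<tau> p])
    have "prod_list (map (\<lambda>i. A i ((p \<circ> ?\<tau>) i)) [0..<k]) = geven_rep (\<Prod>i<k. geven_of (A i ((p \<circ> ?\<tau>) i)))"
      using par permutes_lessThan[OF p\<tau>] by (intro prod_list_geven) auto
    also have "(\<Prod>i<k. geven_of (A i ((p \<circ> ?\<tau>) i))) = (\<Prod>i<k. geven_of (A (?\<tau> i) (p (?\<tau> i))))"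
    proof (rule prod.cong)
      fix i assume "i \<in> {..<k}"
      then have "p (?\<tau> i) < k" using permutes_lessThan[OF p\<tau>] by simp
      then show "geven_of (A i ((p \<circ> ?\<tau>) i)) = geven_of (A (?\<tau> i) (p (?\<tau> i)))"
        using rows by (auto simp: Transposition.transpose_def)
    qed simp
    also have "\<dots> = (\<Prod>i<k. geven_of (A i (p i)))"
      by (rule prod.reindex_bij_betw[OF permutes_imp_bij[OF \<tau>]])
    also have "geven_rep \<dots> = prod_list (map (\<lambda>i. A i (p i)) [0..<k])"
      using par permutes_lessThan[OF p] by (intro prod_list_geven[symmetric]) auto
    finally have "prod_list (map (\<lambda>i. A i ((p \<circ> ?\<tau>) i)) [0..<k]) = prod_list (map (\<lambda>i. A i (p i)) [0..<k])" .
    moreover have "sign (p \<circ> ?\<tau>) = - sign p"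
      using ab(3) permutes_imp_permutation[OF _ p] permutes_imp_permutation[OF _ \<tau>]
      by (simp add: sign_compose sign_swap_id)
    ultimately show ?thesis by simp
  qed
  have "gdet k A = (\<Sum>p | p permutes {..<k}. ?t (p \<circ> ?\<tau>))"
    unfolding gdet_def by (rule sum_permutations_compose_right[OF \<tau>])
  also have "\<dots> = - gdet k A"
    unfolding gdet_def sum_negf[symmetric] using t by (intro sum.cong) auto
  finally have "gdet k A + gdet k A = 0" by (simp only: eq_neg_iff_add_eq_0)
  then have "(2 :: real) *\<^sub>R gdet k A = 0" by (simp add: scaleR_2)
  then show ?thesis by simp
qed

text \<open>Taking bodies is a ring homomorphism, so the body of the determinant is the real
  determinant of the matrix of bodies, which is invertible with the bodies of B as inverse.\<close>

lemma gbody_gdet_nonzero: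
  assumes "\<And>i j. i < k \<Longrightarrow> j < k \<Longrightarrow> (\<Sum>l<k. A i l * B l j) = (if i = j then 1 else 0)"
  shows "gbody (gdet k A) \<noteq> 0"
proof -
  let ?M = "\<lambda>A. mat k k (\<lambda>(i, j). gbody (A i j))"
  have "gbody (gdet k A) = det (?M A)"
  proof -
    have "prod_list (map (gbody \<circ> (\<lambda>i. A i (p i))) [0..<k]) = (\<Prod>i = 0..<k. ?M A $$ (i, p i))"
      if "p permutes {..<k}" for p
    proof -
      have "(\<Prod>i = 0..<k. ?M A $$ (i, p i)) = (\<Prod>i = 0..<k. gbody (A i (p i)))"
        using permutes_lessThan[OF that] by (intro prod.cong) auto
      then show ?thesis using prod.distinct_set_conv_list[of "[0..<k]" "\<lambda>i. gbody (A i (p i))"]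
        by (simp add: o_def)
    qed
    then show ?thesis
      unfolding gdet_def by (subst det_def'[of _ k]) (auto simp: lessThan_atLeast0 intro!: sum.cong)
  qed
  moreover have "?M A * ?M B = 1\<^sub>m k"
  proof (rule eq_matI)
    fix i j assume "i < dim_row (1\<^sub>m k :: real mat)" "j < dim_col (1\<^sub>m k :: real mat)"
    then have ij: "i < k" "j < k" by auto
    then have "(?M A * ?M B) $$ (i, j) = gbody (\<Sum>l<k. A i l * B l j)"
      by (simp add: scalar_prod_def lessThan_atLeast0)
    then show "(?M A * ?M B) $$ (i, j) = 1\<^sub>m k $$ (i, j)"
      using ij assms by simp
  qed auto
  then have "det (?M A) * det (?M B) = 1"
    by (subst det_mult[symmetric, of _ k]) auto
  ultimately show ?thesis by auto
qed

lemma has_pd_prod_list: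
  assumes "\<And>j. j < k \<Longrightarrow> has_pd n i (f j) (df j) x" "\<And>j. j < k \<Longrightarrow> has_parity 0 (f j x)"
  shows "has_pd n i (\<lambda>y. prod_list (map (\<lambda>j. f j y) [0..<k]))
    (\<Sum>j<k. df j * prod_list (map ((\<lambda>l. f l x)(j := 1)) [0..<k])) x"
  using assms
proof (induction k)
  case 0
  then show ?case by (simp add: has_pd_one)
next
  case (Suc k)
  let ?P = "prod_list (map (\<lambda>j. f j x) [0..<k])"
  have P: "has_parity 0 ?P" using Suc.prems by (intro has_parity_prod_list) auto
  have "has_pd n i (\<lambda>y. prod_list (map (\<lambda>j. f j y) [0..<k]) * f k y)
     ((\<Sum>j<k. df j * prod_list (map ((\<lambda>l. f l x)(j := 1)) [0..<k])) * f k x +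
      ((- 1) ^ (par n i * 0) :: real) *\<^sub>R (?P * df k)) x"
    using Suc.prems by (intro has_pd_mult[OF Suc.IH Suc.prems(1) P]) auto
  also have "(\<Sum>j<k. df j * prod_list (map ((\<lambda>l. f l x)(j := 1)) [0..<k])) * f k x =
      (\<Sum>j<k. df j * prod_list (map ((\<lambda>l. f l x)(j := 1)) [0..<Suc k]))"
    unfolding sum_distrib_right by (rule sum.cong) (auto simp: mult.assoc)
  also have "((- 1) ^ (par n i * 0) :: real) *\<^sub>R (?P * df k) =
      df k * prod_list (map ((\<lambda>l. f l x)(k := 1)) [0..<Suc k])"
  proof -
    have "map ((\<lambda>l. f l x)(k := 1)) [0..<k] = map (\<lambda>j. f j x) [0..<k]" by auto
    then show ?thesis
      using mult_commute_even'[OF P] by (simp del: fun_upd_apply add: fun_upd_same)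
  qed
  finally have "has_pd n i (\<lambda>y. prod_list (map (\<lambda>j. f j y) [0..<k]) * f k y)
    (\<Sum>j<Suc k. df j * prod_list (map ((\<lambda>l. f l x)(j := 1)) [0..<Suc k])) x"
    by (simp only: sum.lessThan_Suc)
  moreover have "prod_list (map g [0..<Suc k]) = prod_list (map g [0..<k]) * g k" for g :: "nat \<Rightarrow> grassmann"
    by simp
  ultimately show ?case by (simp only:)
qed

text \<open>Jacobi's formula; \<open>G\<close> stands for \<open>\<partial>A A\<inverse>\<close>.\<close>

lemma has_pd_gdet:
  assumes A: "\<And>j l. j < k \<Longrightarrow> l < k \<Longrightarrow> has_pd n i (\<lambda>y. A y j l) (dA j l) x"
    and par: "\<And>j l. j < k \<Longrightarrow> l < k \<Longrightarrow> has_parity 0 (A x j l)"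
    and G: "\<And>j l. j < k \<Longrightarrow> l < k \<Longrightarrow> dA j l = (\<Sum>t<k. G j t * A x t l)"
  shows "has_pd n i (\<lambda>y. gdet k (A y)) ((\<Sum>j<k. G j j) * gdet k (A x)) x"
proof -
  let ?A = "\<lambda>p l. A x l (p l)"
  have 1: "has_pd n i (\<lambda>y. of_int (sign p) * prod_list (map (\<lambda>j. A y j (p j)) [0..<k]))
      (of_int (sign p) * (\<Sum>j<k. dA j (p j) * prod_list (map ((?A p)(j := 1)) [0..<k]))) x"
    if p: "p permutes {..<k}" for p
  proof -
    have "has_pd n i (\<lambda>y. prod_list (map (\<lambda>j. A y j (p j)) [0..<k]))
       (\<Sum>j<k. dA j (p j) * prod_list (map ((?A p)(j := 1)) [0..<k])) x"
      using permutes_lessThan[OF p] A par by (intro has_pd_prod_list) auto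
    from has_pd_scaleR[OF this, of "of_int (sign p)"] show ?thesis
      by (simp add: scaleR_conv_of_real)
  qed
  have 2: "dA j (p j) * prod_list (map ((?A p)(j := 1)) [0..<k]) =
      (\<Sum>t<k. G j t * prod_list (map (\<lambda>l. ((A x)(j := A x t)) l (p l)) [0..<k]))"
    if p: "p permutes {..<k}" and j: "j < k" for p j
  proof -
    have "A x t (p j) * prod_list (map ((?A p)(j := 1)) [0..<k]) =
        prod_list (map (\<lambda>l. ((A x)(j := A x t)) l (p l)) [0..<k])" if "t < k" for t
    proof -
      have "(?A p)(j := A x t (p j)) = (\<lambda>l. ((A x)(j := A x t)) l (p l))" by auto
      then show ?thesis
        using prod_list_replace[OF j par[OF that permutes_lessThan[OF p j]], of "?A p"] by simp
    qed
    then show ?thesis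
      using G[OF j permutes_lessThan[OF p j]] by (simp add: sum_distrib_right mult.assoc)
  qed
  \<comment> \<open>Row j of dA is a combination of the rows of A with coefficients
    \<open>G j t\<close>. Inserting row t in place of row j gives two equal rows unless t = j, so
    only the trace of G survives.\<close>
  have 3: "gdet k ((A x)(j := A x t)) = (if t = j then gdet k (A x) else 0)" if "j < k" "t < k" for j t
    using that par by (auto intro!: gdet_equal_rows[of k _ j t])
  have "(\<Sum>p | p permutes {..<k}. of_int (sign p) *
        (\<Sum>j<k. dA j (p j) * prod_list (map ((?A p)(j := 1)) [0..<k]))) =
      (\<Sum>p | p permutes {..<k}. \<Sum>j<k. \<Sum>t<k. G j t *
        (of_int (sign p) * prod_list (map (\<lambda>l. ((A x)(j := A x t)) l (p l)) [0..<k])))"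
  proof (rule sum.cong)
    fix p assume "p \<in> {p. p permutes {..<k}}"
    then have p: "p permutes {..<k}" by simp
    have "of_int (sign p) * (g * z) = g * (of_int (sign p) * z)" for g z :: grassmann
      by (metis mult.assoc mult_of_int_commute)
    then show "of_int (sign p) * (\<Sum>j<k. dA j (p j) * prod_list (map ((?A p)(j := 1)) [0..<k])) =
      (\<Sum>j<k. \<Sum>t<k. G j t *
        (of_int (sign p) * prod_list (map (\<lambda>l. ((A x)(j := A x t)) l (p l)) [0..<k])))"
      by (simp add: 2[OF p] sum_distrib_left)
  qed simp
  also have "\<dots> = (\<Sum>j<k. \<Sum>t<k. G j t * gdet k ((A x)(j := A x t)))"
    unfolding gdet_def sum_distrib_left
    by (subst sum.swap, intro sum.cong refl, subst sum.swap) simp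
  also have "\<dots> = (\<Sum>j<k. \<Sum>t<k. if t = j then G j t * gdet k (A x) else 0)"
    by (intro sum.cong refl) (simp add: 3)
  also have "\<dots> = (\<Sum>j<k. G j j) * gdet k (A x)"
    by (simp add: sum_distrib_right)
  finally have e: "(\<Sum>p | p permutes {..<k}. of_int (sign p) *
      (\<Sum>j<k. dA j (p j) * prod_list (map ((?A p)(j := 1)) [0..<k]))) = (\<Sum>j<k. G j j) * gdet k (A x)" .
  have "has_pd n i (\<lambda>y. gdet k (A y)) (\<Sum>p | p permutes {..<k}. of_int (sign p) *
      (\<Sum>j<k. dA j (p j) * prod_list (map ((?A p)(j := 1)) [0..<k]))) x"
    unfolding gdet_def by (rule has_pd_sum) (rule 1, simp)
  then show ?thesis unfolding e .
qed

subsection \<open>The logarithm\<close>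

lemma has_pd_even_power:
  assumes "has_pd n i F D x" "has_parity 0 (F x)"
  shows "has_pd n i (\<lambda>y. F y ^ k) (of_nat k * F x ^ (k - 1) * D) x"
proof (induction k)
  case 0
  then show ?case by (simp add: has_pd_one)
next
  case (Suc k)
  have "has_pd n i (\<lambda>y. F y * F y ^ k) (D * F x ^ k +
      ((- 1) ^ (par n i * 0) :: real) *\<^sub>R (F x * (of_nat k * F x ^ (k - 1) * D))) x"
    by (rule has_pd_mult[OF assms(1) Suc assms(2)])
  moreover have "F x * (of_nat k * F x ^ (k - 1) * D) = of_nat k * F x ^ k * D"
  proof (cases k)
    case (Suc l)
    have "F x * (of_nat k * F x ^ l * D) = of_nat k * (F x * F x ^ l) * D"
      by (metis mult.assoc mult_of_nat_commute)
    with Suc show ?thesis by simp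
  qed simp
  moreover have "D * F x ^ k = F x ^ k * D"
    using mult_commute_even'[OF has_parity_power[OF assms(2)]] by simp
  ultimately show ?case by (simp add: distrib_right add.commute mult.assoc)
qed

lemma ring_geometric_sum: "(1 - z) * (\<Sum>k<r. z ^ k) = 1 - z ^ r" for z :: "'a :: ring_1"
  by (induction r) (simp_all add: distrib_left left_diff_distrib)

text \<open>With b the body and u = a/b - 1, the derivative of the truncated logarithm is b'/b + (1
  - u + u^2 - ...) du, a sum with m terms. Multiplied by a it becomes the derivative \<sigma> a, and
  a can be cancelled because its body is nonzero.\<close>

lemma pd_gln_gabs:
  assumes V: "openin (Euclidean_space n) V" and x: "x \<in> V"
    and par: "\<And>y. y \<in> V \<Longrightarrow> has_parity 0 (a y)"
    and supp: "\<And>y. y \<in> V \<Longrightarrow> gsupported m (a y)"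
    and body: "\<And>y. y \<in> V \<Longrightarrow> gbody (a y) \<noteq> 0"
    and a: "has_pd n i a (\<sigma> * a x) x"
  shows "pd n i (\<lambda>y. gln m (gabs (a y))) x = \<sigma>"
proof -
  define b where "b y = gbody (a y)" for y
  define u where "u y = a y * of_real (inverse (b y)) - 1" for y
  \<comment> \<open>The body is a real function of the even coordinates, hence constant in odd
    directions.\<close>
  define b' where "b' = (if i < n then gbody (\<sigma> * a x) else 0)"
  have b0: "b y \<noteq> 0" if "y \<in> V" for y using body[OF that] by (simp add: b_def)
  have of_real_scale: "of_real r * z = r *\<^sub>R z" "z * of_real r = r *\<^sub>R z" for r and z :: grassmann
    by (simp_all add: of_real_def)
  have db: "((\<lambda>t. b (x(i := t))) has_real_derivative b') (at (x i))" if "i < n"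
    using a that by (simp add: has_pd_def b_def b'_def gbody_def)
  have pb: "has_pd n i (\<lambda>y. of_real (b y)) (of_real b') x"
    by (rule has_pd_of_real) (use db in \<open>auto simp: b'_def\<close>)
  have "has_pd n i (\<lambda>y. of_real (inverse (b y))) (of_real (- (inverse (b x) * b' * inverse (b x)))) x"
  proof (rule has_pd_of_real)
    assume "i < n"
    with DERIV_inverse'[OF db[OF this]] b0[OF x]
    show "((\<lambda>t. inverse (b (x(i := t)))) has_real_derivative - (inverse (b x) * b' * inverse (b x))) (at (x i))"
      by simp
  qed (simp add: b'_def)
  from has_pd_diff[OF has_pd_mult[OF a this par[OF x]] has_pd_one]
  have "\<exists>D. has_pd n i u D x"
    unfolding u_def by blast
  then obtain du where du: "has_pd n i u du x" by blast
  have upar: "has_parity 0 (u y)" if "y \<in> V" for y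
    using par[OF that] by (auto simp: u_def of_real_scale intro!: has_parity_diff has_parity_scaleR)
  have unil: "u y ^ Suc m = 0" if "y \<in> V" for y
  proof (rule gorder_ge_eq_0)
    show "gsupported m (u y ^ Suc m)"
      unfolding u_def of_real_scale
      by (intro gsupported_power gsupported_diff gsupported_scaleR supp that) simp
    have "gorder_ge 1 (u y)"
      using b0[OF that] by (intro gorder_ge_1) (simp add: u_def b_def)
    from gorder_ge_power[OF this, of "Suc m"] show "gorder_ge (Suc m) (u y ^ Suc m)" by simp
  qed simp
  have au: "a y = of_real (b y) * (1 + u y)" if "y \<in> V" for y
    using b0[OF that] by (simp add: u_def of_real_scale)
  \<comment> \<open>Differentiating u^(m+1) = 0. This removes the error of the geometric series with
    m terms, which is an inverse of 1 + u only up to u^m.\<close>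
  have umdu: "u x ^ m * du = 0"
  proof -
    have "has_pd n i (\<lambda>y. 0) (of_nat (Suc m) * u x ^ m * du) x"
      using has_pd_cong[OF V x _ has_pd_even_power[OF du upar[OF x], of "Suc m"], of "\<lambda>_. 0"] unil by simp
    from has_pd_unique[OF this has_pd_zero]
    have "(real (Suc m)) *\<^sub>R (u x ^ m * du) = 0"
      by (simp only: scaleR_conv_of_real of_real_of_nat_eq mult.assoc)
    then show ?thesis by simp
  qed
  have pa: "\<sigma> * a x = of_real b' * (1 + u x) + of_real (b x) * du"
  proof -
    have "has_pd n i (\<lambda>y. of_real (b y) * (1 + u y)) (of_real b' * (1 + u x) +
        ((- 1) ^ (par n i * 0) :: real) *\<^sub>R (of_real (b x) * (0 + du))) x"
      by (intro has_pd_mult pb has_pd_add has_pd_one du) simp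
    from has_pd_cong[OF V x _ this, of a] au
    have "has_pd n i a (of_real b' * (1 + u x) + of_real (b x) * du) x" by simp
    from has_pd_unique[OF a this] show ?thesis .
  qed
  define S where "S = (\<Sum>k<m. (- u x) ^ k)"
  have "has_pd n i (\<lambda>y. of_real (ln \<bar>b y\<bar>) + (\<Sum>k=1..m. ((- 1) ^ (k + 1) / real k) *\<^sub>R u y ^ k))
      (of_real (b' / b x) + (\<Sum>k=1..m. ((- 1) ^ (k + 1) / real k) *\<^sub>R (of_nat k * u x ^ (k - 1) * du))) x"
  proof (intro has_pd_add has_pd_sum has_pd_scaleR has_pd_even_power du upar x has_pd_of_real)
    assume i: "i < n"
    \<comment> \<open>The body may have either sign, so ln is differentiated on the two half-lines
      separately.\<close>
    have "((\<lambda>t. ln \<bar>t\<bar>) has_real_derivative 1 / b x) (at (b x))"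
    proof (cases "b x > 0")
      case True
      have "((\<lambda>t. ln t) has_real_derivative 1 / b x) (at (b x))"
        using True by (auto intro!: derivative_eq_intros)
      note der = this
      have ev: "\<forall>\<^sub>F t in nhds (b x). ln t = ln \<bar>t\<bar>"
        using eventually_nhds_in_open[of "{0<..}" "b x"] True by (auto elim: eventually_mono)
      from iffD1[OF DERIV_cong_ev[OF refl ev refl] der] show ?thesis .
    next
      case False
      with b0[OF x] have neg: "b x < 0" by simp
      have "((\<lambda>t. ln (- t)) has_real_derivative 1 / b x) (at (b x))"
        using neg by (auto intro!: derivative_eq_intros simp: field_simps)
      note der = this
      have ev: "\<forall>\<^sub>F t in nhds (b x). ln (- t) = ln \<bar>t\<bar>"
        using eventually_nhds_in_open[of "{..<0}" "b x"] neg by (auto elim: eventually_mono)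
      from iffD1[OF DERIV_cong_ev[OF refl ev refl] der] show ?thesis .
    qed
    then have "((\<lambda>t. ln \<bar>t\<bar>) has_real_derivative 1 / b x) (at (b (x(i := x i))))" by simp
    from DERIV_chain2[where f = "\<lambda>t. ln \<bar>t\<bar>" and g = "\<lambda>t. b (x(i := t))", OF this db[OF i]]
    show "((\<lambda>t. ln \<bar>b (x(i := t))\<bar>) has_real_derivative b' / b x) (at (x i))" by simp
  qed (simp add: b'_def)
  note log_pd = this
  \<comment> \<open>The absolute value affects only the leading term: the sign cancels in the
    quotient by the body.\<close>
  have log_eq: "gln m (gabs (a y)) = of_real (ln \<bar>b y\<bar>) + (\<Sum>k=1..m. ((- 1) ^ (k + 1) / real k) *\<^sub>R u y ^ k)"
    if "y \<in> V" for y
  proof -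
    have "gbody (gabs (a y)) = \<bar>b y\<bar>" by (simp add: gabs_def b_def abs_sgn mult.commute)
    moreover have "gabs (a y) /\<^sub>R \<bar>b y\<bar> = a y * of_real (inverse (b y))"
      using b0[OF that] by (simp add: gabs_def of_real_scale b_def[symmetric] abs_sgn sgn_if)
    ultimately show ?thesis by (simp add: gln_def u_def)
  qed
  have "has_pd n i (\<lambda>y. gln m (gabs (a y))) (of_real (b' / b x) +
      (\<Sum>k=1..m. ((- 1) ^ (k + 1) / real k) *\<^sub>R (of_nat k * u x ^ (k - 1) * du))) x"
    by (rule has_pd_cong[OF V x _ log_pd]) (rule log_eq[symmetric])
  also have "(\<Sum>k=1..m. ((- 1) ^ (k + 1) / real k) *\<^sub>R (of_nat k * u x ^ (k - 1) * du)) =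
      (\<Sum>k=1..m. (- u x) ^ (k - 1) * du)"
  proof (rule sum.cong)
    fix k assume "k \<in> {1..m}"
    then obtain l where k: "k = Suc l" by (cases k) auto
    have "(of_nat k * u x ^ l * du) = real k *\<^sub>R (u x ^ l * du)"
      by (simp only: scaleR_conv_of_real of_real_of_nat_eq mult.assoc)
    then show "((- 1) ^ (k + 1) / real k) *\<^sub>R (of_nat k * u x ^ (k - 1) * du) = (- u x) ^ (k - 1) * du"
      unfolding k by (simp add: power_minus[of "u x"] minus_one_power_grassmann del: of_nat_Suc)
  qed simp
  also have "\<dots> = S * du"
    unfolding S_def sum_distrib_right
    by (rule sum.reindex_bij_witness[of _ Suc "\<lambda>k. k - 1"]) auto
  finally have pl: "has_pd n i (\<lambda>y. gln m (gabs (a y))) (of_real (b' / b x) + S * du) x" .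
  have "(1 + u x) * (S * du) = du"
  proof -
    have "(1 + u x) * S = 1 - (- u x) ^ m"
      using ring_geometric_sum[of "- u x" m] by (simp add: S_def)
    then have "(1 + u x) * (S * du) = du - (- u x) ^ m * du"
      by (simp add: mult.assoc[symmetric] left_diff_distrib)
    also have "(- u x) ^ m * du = 0"
      using umdu by (simp add: power_minus[of "u x"] mult.assoc)
    finally show ?thesis by simp
  qed
  then have "a x * (S * du) = of_real (b x) * du"
    unfolding au[OF x] by (simp add: mult.assoc)
  moreover have "a x * of_real (b' / b x) = of_real b' * (1 + u x)"
    using b0[OF x] unfolding au[OF x] of_real_scale by simp
  ultimately have "a x * (of_real (b' / b x) + S * du) = \<sigma> * a x"
    unfolding pa by (simp only: distrib_left)
  then have "a x * (of_real (b' / b x) + S * du - \<sigma>) = 0"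
    using mult_commute_even'[OF par[OF x], of \<sigma>] by (simp add: right_diff_distrib)
  from gbody_nonzero_cancel[OF this body[OF x]]
  show ?thesis using pd_eqI[OF pl] by simp
qed


subsection \<open>The logarithmic derivative of the Berezinian\<close>

text \<open>The blocks of a supermatrix are functions of two indices that vanish outside their format, so that
  associativity of the product and most identities need no side conditions on the formats.\<close>

type_synonym gmat = "nat \<Rightarrow> nat \<Rightarrow> grassmann"

definition mm :: "nat \<Rightarrow> gmat \<Rightarrow> gmat \<Rightarrow> gmat" where
  "mm k A B = (\<lambda>i j. \<Sum>l<k. A i l * B l j)"

definition mtr :: "nat \<Rightarrow> gmat \<Rightarrow> grassmann" where
  "mtr k A = (\<Sum>i<k. A i i)"

definition mfmt :: "nat \<Rightarrow> nat \<Rightarrow> gmat \<Rightarrow> bool" where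
  "mfmt r c A \<longleftrightarrow> (\<forall>i j. \<not> (i < r \<and> j < c) \<longrightarrow> A i j = 0)"

definition mid :: "nat \<Rightarrow> gmat" where
  "mid k = (\<lambda>i j. if i < k \<and> i = j then 1 else 0)"

definition mpar :: "nat \<Rightarrow> gmat \<Rightarrow> bool" where
  "mpar p A \<longleftrightarrow> (\<forall>i j. has_parity p (A i j))"

definition msc :: "real \<Rightarrow> gmat \<Rightarrow> gmat" where
  "msc c A = (\<lambda>i j. c *\<^sub>R A i j)"

lemma mm_assoc: "mm k (mm l A B) C = mm l A (mm k B C)"
  unfolding mm_def
  by (intro ext) (simp add: sum_distrib_left sum_distrib_right mult.assoc, rule sum.swap)

lemma mm_linear:
  "mm k (A + B) C = mm k A C + mm k B C" "mm k A (B + C) = mm k A B + mm k A C"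
  "mm k (A - B) C = mm k A C - mm k B C" "mm k A (B - C) = mm k A B - mm k A C"
  "mm k (- A) C = - mm k A C" "mm k A (- C) = - mm k A C"
  "mm k (msc c A) C = msc c (mm k A C)" "mm k A (msc c C) = msc c (mm k A C)"
  "mm k 0 A = 0" "mm k A 0 = 0"
  by (simp_all add: mm_def msc_def fun_eq_iff algebra_simps sum.distrib sum_subtractf sum_negf scaleR_sum_right)

lemma mtr_linear:
  "mtr k (A + B) = mtr k A + mtr k B" "mtr k (A - B) = mtr k A - mtr k B"
  "mtr k (- A) = - mtr k A" "mtr k (msc c A) = c *\<^sub>R mtr k A"
  by (simp_all add: mtr_def msc_def sum.distrib sum_subtractf sum_negf scaleR_sum_right)

lemma msc_simps [simp]: "msc 1 A = A" "msc c (msc d A) = msc (c * d) A" "msc (- 1) A = - A"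
  by (simp_all add: msc_def fun_eq_iff)

lemma mm_mid_left: "mfmt k c A \<Longrightarrow> mm k (mid k) A = A"
proof (intro ext)
  fix i j assume A: "mfmt k c A"
  have "mm k (mid k) A i j = (\<Sum>l<k. if l = i then (if i < k then A i j else 0) else 0)"
    unfolding mm_def mid_def by (intro sum.cong) auto
  then show "mm k (mid k) A i j = A i j" using A by (auto simp: mfmt_def)
qed

lemma mm_mid_right: "mfmt r k A \<Longrightarrow> mm k A (mid k) = A"
proof (intro ext)
  fix i j assume A: "mfmt r k A"
  have "mm k A (mid k) i j = (\<Sum>l<k. if l = j then A i j else 0)"
    unfolding mm_def mid_def by (intro sum.cong) auto
  then show "mm k A (mid k) i j = A i j" using A by (auto simp: mfmt_def)
qed

lemma mfmt_mm: "mfmt r k A \<Longrightarrow> mfmt k' c B \<Longrightarrow> mfmt r c (mm l A B)"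
  by (auto simp: mfmt_def mm_def)

lemma mfmt_mid: "mfmt k k (mid k)"
  by (auto simp: mfmt_def mid_def)

lemma mfmt_add: "mfmt r c A \<Longrightarrow> mfmt r c B \<Longrightarrow> mfmt r c (A + B)"
  by (auto simp: mfmt_def)

lemma mpar_mm: "mpar p A \<Longrightarrow> mpar q B \<Longrightarrow> mpar (p + q) (mm k A B)"
  by (auto simp: mpar_def mm_def intro!: has_parity_sum has_parity_mult)

lemma mpar_cong: "even p = even q \<Longrightarrow> mpar p A = mpar q A"
  unfolding mpar_def using has_parity_cong by blast

lemma mtr_commute:
  assumes "mpar p A" "mpar q B"
  shows "mtr r (mm k A B) = ((- 1) ^ (p * q) :: real) *\<^sub>R mtr k (mm r B A)"
proof -
  have "A i l * B l i = ((- 1) ^ (p * q) :: real) *\<^sub>R (B l i * A i l)" for i l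
    using assms by (intro mult_commute_parity) (auto simp: mpar_def)
  then have "mtr r (mm k A B) = (\<Sum>i<r. \<Sum>l<k. ((- 1) ^ (p * q) :: real) *\<^sub>R (B l i * A i l))"
    unfolding mtr_def mm_def by (intro sum.cong refl)
  also have "\<dots> = ((- 1) ^ (p * q) :: real) *\<^sub>R mtr k (mm r B A)"
    unfolding mtr_def mm_def scaleR_sum_right by (rule sum.swap)
  finally show ?thesis .
qed

section \<open>Finite geometric series of nilpotent matrices\<close>

primrec mpow :: "nat \<Rightarrow> gmat \<Rightarrow> nat \<Rightarrow> gmat" where
  "mpow m X 0 = mid m"
| "mpow m X (Suc k) = mm m X (mpow m X k)"

text \<open>The Horner form of 1 + X + ... + X^k.\<close>

primrec mgeom :: "nat \<Rightarrow> gmat \<Rightarrow> nat \<Rightarrow> gmat" where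
  "mgeom m X 0 = mid m"
| "mgeom m X (Suc k) = mid m + mm m X (mgeom m X k)"

lemma mfmt_mgeom: "mfmt m m X \<Longrightarrow> mfmt m m (mgeom m X k)"
  by (induction k) (auto intro: mfmt_mid mfmt_mm mfmt_add)

lemma mgeom_Suc: "mfmt m m X \<Longrightarrow> mgeom m X (Suc k) = mgeom m X k + mpow m X (Suc k)"
  by (induction k) (simp_all add: mm_linear add.assoc)

lemma mgeom_commute: "mfmt m m X \<Longrightarrow> mm m (mgeom m X k) X = mm m X (mgeom m X k)"
  by (induction k) (simp_all add: mm_mid_left mm_mid_right mm_assoc mm_linear)

lemma mgeom_inverse:
  assumes X: "mfmt m m X" and nil: "mpow m X (Suc k) = 0"
  shows "mm m (mid m - X) (mgeom m X k) = mid m" "mm m (mgeom m X k) (mid m - X) = mid m"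
proof -
  have "mid m + mm m X (mgeom m X k) = mgeom m X k + 0"
    using mgeom_Suc[OF X, of k] nil by simp
  then have "mgeom m X k - mm m X (mgeom m X k) = mid m" by (simp add: algebra_simps)
  then show "mm m (mid m - X) (mgeom m X k) = mid m" "mm m (mgeom m X k) (mid m - X) = mid m"
    using mfmt_mgeom[OF X, of k]
    by (simp_all add: mm_linear mm_mid_left mm_mid_right mgeom_commute[OF X])
qed

text \<open>Entries of the r-th power have order at least r. The exponent is governed by the number
  m of generators and not by the size k of the matrix.\<close>

lemma mpow_nilpotent:
  assumes "\<And>i j. gbody (X i j) = 0" "\<And>i j. gsupported m (X i j)"
  shows "mpow k X (Suc m) = 0"
proof -
  have *: "gorder_ge r (mpow k X r i j)" "gsupported m (mpow k X r i j)" for r i j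
  proof (induction r arbitrary: i j)
    case (Suc r)
    {
      case 1
      have "gorder_ge (1 + r) (X i l * mpow k X r l j)" for l
        by (intro gorder_ge_mult gorder_ge_1 assms Suc)
      then show ?case by (simp add: mm_def gorder_ge_sum)
    next
      case 2
      show ?case by (simp add: mm_def gsupported_sum gsupported_mult assms Suc)
    }
  qed (simp_all add: mid_def)
  have "mpow k X (Suc m) i j = 0" for i j
    by (rule gorder_ge_eq_0[OF *(2) *(1) lessI])
  then show ?thesis by (intro ext) (simp add: zero_fun_def)
qed

text \<open>With \<open>A' = A - B E C\<close> and \<open>E = D\<inverse>\<close>, the left-hand side is the supertrace of \<open>\<partial>L L\<inverse>\<close>, expressed through
  the blocks \<open>P, Q, R, S\<close> of \<open>L\<inverse>\<close>, and the right-hand side is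
  \<open>tr (\<partial>A' A'\<inverse>) + tr (\<partial>E E\<inverse>)\<close>.\<close>

lemma supertrace_blocks:
  assumes fmt: "mfmt n m Q" "mfmt m n R" "mfmt m m S" "mfmt m m E"
    and par: "mpar 1 B" "mpar 1 C" "mpar 0 E" "mpar 0 P" "mpar (p + 1) dC" "mpar p dD"
    and LK: "mm n C P + mm m D R = 0" "mm n C Q + mm m D S = mid m"
    and KL: "mm n P B + mm m Q D = 0"
    and DE: "mm m D E = mid m" "mm m E D = mid m"
  shows "mtr n (mm n dA P + mm m dB R) - mtr m (mm n dC Q + mm m dD S) =
    mtr n (mm n (dA - (mm m dB (mm m E C) + msc ((- 1) ^ p) (mm m B (mm m (- mm m E (mm m dD E)) C)) +
      msc ((- 1) ^ p) (mm m B (mm m E dC)))) P) - mtr m (mm m dD E)"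
proof -
  \<comment> \<open>The familiar block formulas for the inverse: R = - E C P, Q = - P B E and S = E
    + E C P B E. They leave P as the only block of the inverse in the identity.\<close>
  have R: "R = - mm m E (mm n C P)"
  proof -
    have "mm m D R = - mm n C P" using LK(1) by (simp add: eq_neg_iff_add_eq_0 add.commute)
    then have "mm m E (mm m D R) = - mm m E (mm n C P)" by (simp add: mm_linear)
    then show ?thesis using DE(2) fmt(2) by (simp add: mm_assoc[symmetric] mm_mid_left)
  qed
  have Q: "Q = - mm n P (mm m B E)"
  proof -
    have "mm m Q D = - mm n P B" using KL by (simp add: eq_neg_iff_add_eq_0 add.commute)
    then have "mm m (mm m Q D) E = - mm n P (mm m B E)" by (simp add: mm_linear mm_assoc)
    then show ?thesis using DE(1) fmt(1) by (simp add: mm_assoc mm_mid_right)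
  qed
  have S: "S = E + mm m E (mm n C (mm n P (mm m B E)))"
  proof -
    have "mm m D S = mid m - mm n C Q" using LK(2) by (simp add: algebra_simps)
    then have "mm m E (mm m D S) = E - mm m E (mm n C Q)"
      using fmt(4) by (simp add: mm_linear mm_mid_right)
    moreover have "mm m E (mm m D S) = S"
      using DE(2) fmt(3) by (simp add: mm_assoc[symmetric] mm_mid_left)
    ultimately show ?thesis by (simp add: Q mm_linear)
  qed
  \<comment> \<open>Cyclic rotation under the trace. Carrying the odd block B past a factor of
    parity p + 1 costs the sign -(-1)^p, while the even E rotates freely; this sign is what turns
    the difference of traces into a supertrace.\<close>
  have t1: "mtr n (mm m B (mm m E (mm n dC P))) = - ((- 1) ^ p) *\<^sub>R mtr m (mm n dC (mm n P (mm m B E)))"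
  proof -
    have "mpar (0 + (p + 1 + 0)) (mm m E (mm n dC P))"
      by (intro mpar_mm par)
    then have "mtr n (mm m B (mm m E (mm n dC P))) = ((- 1) ^ (1 * (p + 1)) :: real) *\<^sub>R mtr m (mm n (mm m E (mm n dC P)) B)"
      using mtr_commute[OF par(1)] by simp
    also have "mtr m (mm n (mm m E (mm n dC P)) B) = mtr m (mm m E (mm n (mm n dC P) B))"
      by (simp add: mm_assoc)
    also have "\<dots> = ((- 1) ^ (0 * (p + 1 + 0 + 1)) :: real) *\<^sub>R mtr m (mm m (mm n (mm n dC P) B) E)"
      by (intro mtr_commute mpar_mm par)
    finally show ?thesis by (simp add: mm_assoc)
  qed
  have t2: "mtr n (mm m B (mm m E (mm m dD (mm m E (mm n C P))))) =
      - ((- 1) ^ p) *\<^sub>R mtr m (mm m dD (mm m E (mm n C (mm n P (mm m B E)))))"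
  proof -
    have "mpar (0 + (p + (0 + (1 + 0)))) (mm m E (mm m dD (mm m E (mm n C P))))"
      by (intro mpar_mm par)
    then have "mtr n (mm m B (mm m E (mm m dD (mm m E (mm n C P))))) =
        ((- 1) ^ (1 * (p + 1)) :: real) *\<^sub>R mtr m (mm n (mm m E (mm m dD (mm m E (mm n C P)))) B)"
      using mtr_commute[OF par(1)] by simp
    also have "mtr m (mm n (mm m E (mm m dD (mm m E (mm n C P)))) B) =
        mtr m (mm m E (mm n (mm m dD (mm m E (mm n C P))) B))"
      by (simp add: mm_assoc)
    also have "\<dots> = ((- 1) ^ (0 * (p + (0 + (1 + 0)) + 1)) :: real) *\<^sub>R
        mtr m (mm m (mm n (mm m dD (mm m E (mm n C P))) B) E)"
      by (intro mtr_commute mpar_mm par)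
    finally show ?thesis by (simp add: mm_assoc)
  qed
  have sq: "(- 1) ^ p * (- 1) ^ p = (1 :: real)" by (simp flip: power_mult_distrib)
  have "mtr n (mm n (dA - (mm m dB (mm m E C) + msc ((- 1) ^ p) (mm m B (mm m (- mm m E (mm m dD E)) C)) +
      msc ((- 1) ^ p) (mm m B (mm m E dC)))) P) =
     mtr n (mm n dA P) - mtr n (mm m dB (mm m E (mm n C P))) +
      ((- 1) ^ p) *\<^sub>R mtr n (mm m B (mm m E (mm m dD (mm m E (mm n C P))))) -
      ((- 1) ^ p) *\<^sub>R mtr n (mm m B (mm m E (mm n dC P)))"
    by (simp add: mm_linear mtr_linear mm_assoc)
  then show ?thesis
    unfolding t1 t2 by (simp add: R Q S mm_linear mtr_linear mm_assoc sq)
qed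


section \<open>Blocks of a supermatrix and derivatives of matrices\<close>

lemma sum_lessThan_split: "(\<Sum>k<n+m. f k) = (\<Sum>k<n. f k) + (\<Sum>l<m. f (n + l))"
  for f :: "nat \<Rightarrow> 'a :: comm_monoid_add"
  by (induction m) (simp_all add: add.assoc)

definition mblock :: "nat \<Rightarrow> nat \<Rightarrow> nat \<Rightarrow> nat \<Rightarrow> (nat \<Rightarrow> nat \<Rightarrow> sfun) \<Rightarrow> (nat \<Rightarrow> real) \<Rightarrow> gmat" where
  "mblock r c a b F x = (\<lambda>i j. if i < r \<and> j < c then F (a + i) (b + j) x else 0)"

lemma mfmt_mblock: "mfmt r c (mblock r c a b F x)"
  by (simp add: mfmt_def mblock_def)

lemma mblock_mult:
  "mm n (mblock r n a 0 F x) (mblock n c 0 b G x) + mm m (mblock r m a n F x) (mblock m c n b G x) =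
    (\<lambda>i j. if i < r \<and> j < c then \<Sum>k<n+m. F (a + i) k x * G k (b + j) x else 0)"
  by (auto simp: fun_eq_iff mm_def mblock_def sum_lessThan_split)

lemma msc_add: "msc c (A + B) = msc c A + msc c B"
  by (simp add: msc_def fun_eq_iff scaleR_right_distrib)

text \<open>\<open>gmat_inv\<close> is a choice, constrained only at indices below k; there the
  inverse is unique by X = X (D E) = (X D) E = E.\<close>

lemma gmat_inv_eqI:
  assumes "\<And>i j. i < k \<Longrightarrow> j < k \<Longrightarrow> (\<Sum>l<k. D i l * E l j) = (if i = j then 1 else 0)"
    and "\<And>i j. i < k \<Longrightarrow> j < k \<Longrightarrow> (\<Sum>l<k. E i l * D l j) = (if i = j then 1 else 0)"
    and ij: "i < k" "j < k"
  shows "gmat_inv k D i j = E i j"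
proof -
  let ?X = "gmat_inv k D"
  have "\<forall>i<k. \<forall>j<k. (\<Sum>l<k. D i l * ?X l j) = (if i = j then 1 else 0) \<and>
     (\<Sum>l<k. ?X i l * D l j) = (if i = j then 1 else 0)"
    unfolding gmat_inv_def by (rule someI[of _ E]) (simp add: assms(1,2))
  then have X: "(\<Sum>l<k. ?X i l * D l b) = (if i = b then 1 else 0)" if "b < k" for b
    using ij that by blast
  have "?X i j = (\<Sum>a<k. ?X i a * (if a = j then 1 else 0))"
    using ij by (simp add: if_distrib[of "\<lambda>z. _ * z"] cong: if_cong)
  also have "\<dots> = (\<Sum>a<k. ?X i a * (\<Sum>b<k. D a b * E b j))"
    using assms(1) ij by (intro sum.cong) auto
  also have "\<dots> = (\<Sum>b<k. (\<Sum>a<k. ?X i a * D a b) * E b j)"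
    by (simp add: sum_distrib_left sum_distrib_right mult.assoc) (rule sum.swap)
  also have "\<dots> = (\<Sum>b<k. (if i = b then 1 else 0) * E b j)"
    using X by (intro sum.cong) auto
  also have "\<dots> = E i j"
    using ij by (simp add: if_distrib[of "\<lambda>z. z * _"] cong: if_cong)
  finally show ?thesis .
qed

definition has_pdm :: "nat \<Rightarrow> nat \<Rightarrow> ((nat \<Rightarrow> real) \<Rightarrow> gmat) \<Rightarrow> gmat \<Rightarrow> (nat \<Rightarrow> real) \<Rightarrow> bool" where
  "has_pdm n t F D x \<longleftrightarrow> (\<forall>i j. has_pd n t (\<lambda>y. F y i j) (D i j) x)"

lemma has_pdm_diff: "has_pdm n t F D x \<Longrightarrow> has_pdm n t G D' x \<Longrightarrow> has_pdm n t (\<lambda>y. F y - G y) (D - D') x"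
  by (simp add: has_pdm_def has_pd_diff)

lemma has_pdm_mm:
  assumes "has_pdm n t F D x" "has_pdm n t G D' x" "mpar q (F x)"
  shows "has_pdm n t (\<lambda>y. mm k (F y) (G y))
    (mm k D (G x) + msc ((- 1) ^ (par n t * q)) (mm k (F x) D')) x"
  unfolding has_pdm_def
proof (intro allI)
  fix i j
  have "has_pd n t (\<lambda>y. \<Sum>l<k. F y i l * G y l j)
      (\<Sum>l<k. D i l * G x l j + ((- 1) ^ (par n t * q) :: real) *\<^sub>R (F x i l * D' l j)) x"
    using assms by (intro has_pd_sum has_pd_mult) (auto simp: has_pdm_def mpar_def)
  then show "has_pd n t (\<lambda>y. mm k (F y) (G y) i j)
      ((mm k D (G x) + msc ((- 1) ^ (par n t * q)) (mm k (F x) D')) i j) x"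
    by (simp add: mm_def msc_def sum.distrib scaleR_sum_right)
qed

lemma has_pdm_unique: "has_pdm n t F D x \<Longrightarrow> has_pdm n t F D' x \<Longrightarrow> D = D'"
  unfolding has_pdm_def using has_pd_unique by blast

definition smat :: "nat \<Rightarrow> nat \<Rightarrow> (nat \<Rightarrow> real) set \<Rightarrow> ((nat \<Rightarrow> real) \<Rightarrow> gmat) \<Rightarrow> bool" where
  "smat n m V F \<longleftrightarrow> (\<forall>i j. (\<lambda>y. F y i j) \<in> superfunctions n m V)"

lemma smat_mm:
  "openin (Euclidean_space n) V \<Longrightarrow> smat n m V F \<Longrightarrow> smat n m V G \<Longrightarrow> smat n m V (\<lambda>y. mm k (F y) (G y))"
  by (auto simp: smat_def mm_def intro!: superfunctions_sum superfunctions_mult)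

lemma smat_mid: "smat n m V (\<lambda>_. mid k)"
  by (simp add: smat_def mid_def superfunctions_const)

lemma smat_mgeom:
  assumes "openin (Euclidean_space n) V" "smat n m V X"
  shows "smat n m V (\<lambda>y. mgeom k (X y) r)"
proof (induction r)
  case (Suc r)
  then show ?case
    using smat_mm[OF assms Suc, of k] smat_mid[of n m V k] superfunctions_add[OF assms(1)]
    by (simp add: smat_def)
qed (simp add: smat_mid)

lemma smat_has_pdm:
  "smat n m V F \<Longrightarrow> x \<in> V \<Longrightarrow> has_pdm n t F (\<lambda>i j. pd n t (\<lambda>y. F y i j) x) x"
  unfolding smat_def has_pdm_def using has_pd_superfunction by blast

lemma mpar_mgeom: "mpar 0 X \<Longrightarrow> mpar 0 (mgeom k X r)"
proof (induction r)
  case 0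
  then show ?case by (simp add: mpar_def mid_def)
next
  case (Suc r)
  then show ?case
    using mpar_mm[OF Suc.prems Suc.IH[OF Suc.prems], of k]
    by (auto simp: mpar_def mid_def intro!: has_parity_add)
qed

section \<open>The Berezinian of a family of supermatrices L with inverse K\<close>

context
  fixes n m :: nat and V :: "(nat \<Rightarrow> real) set" and L K :: "nat \<Rightarrow> nat \<Rightarrow> sfun"
  assumes V: "openin (Euclidean_space n) V"
    and L: "\<And>i j. i < n + m \<Longrightarrow> j < n + m \<Longrightarrow> L i j \<in> superfunctions n m V"
    and K: "\<And>i j. i < n + m \<Longrightarrow> j < n + m \<Longrightarrow> K i j \<in> superfunctions n m V"
    and Lpar: "\<And>i j x. i < n + m \<Longrightarrow> j < n + m \<Longrightarrow> x \<in> V \<Longrightarrow> has_parity (par n i + par n j) (L i j x)"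
    and Kpar: "\<And>i j x. i < n + m \<Longrightarrow> j < n + m \<Longrightarrow> x \<in> V \<Longrightarrow> has_parity (par n i + par n j) (K i j x)"
    and LK: "\<And>i j x. i < n + m \<Longrightarrow> j < n + m \<Longrightarrow> x \<in> V \<Longrightarrow>
      (\<Sum>k<n+m. L i k x * K k j x) = (if i = j then 1 else 0)"
    and KL: "\<And>i j x. i < n + m \<Longrightarrow> j < n + m \<Longrightarrow> x \<in> V \<Longrightarrow>
      (\<Sum>k<n+m. K i k x * L k j x) = (if i = j then 1 else 0)"
begin

private abbreviation (input) "A \<equiv> mblock n n 0 0 L"
private abbreviation (input) "B \<equiv> mblock n m 0 n L"
private abbreviation (input) "C \<equiv> mblock m n n 0 L"
private abbreviation (input) "D \<equiv> mblock m m n n L"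
private abbreviation (input) "P \<equiv> mblock n n 0 0 K"
private abbreviation (input) "Q \<equiv> mblock n m 0 n K"
private abbreviation (input) "R \<equiv> mblock m n n 0 K"
private abbreviation (input) "S \<equiv> mblock m m n n K"

private lemma block_equations:
  assumes "x \<in> V"
  shows "mm n (A x) (P x) + mm m (B x) (R x) = mid n" "mm n (A x) (Q x) + mm m (B x) (S x) = 0"
    "mm n (C x) (P x) + mm m (D x) (R x) = 0" "mm n (C x) (Q x) + mm m (D x) (S x) = mid m"
    "mm n (P x) (A x) + mm m (Q x) (C x) = mid n" "mm n (P x) (B x) + mm m (Q x) (D x) = 0"
    "mm n (R x) (A x) + mm m (S x) (C x) = 0" "mm n (R x) (B x) + mm m (S x) (D x) = mid m"
  unfolding mblock_mult by (auto simp: fun_eq_iff mid_def LK KL assms)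

private lemma block_parity:
  assumes "x \<in> V"
  shows "mpar 1 (B x)" "mpar 1 (C x)" "mpar 0 (D x)" "mpar 0 (A x)"
    "mpar 0 (P x)" "mpar 1 (Q x)" "mpar 1 (R x)" "mpar 0 (S x)"
proof -
  have F: "mpar p (mblock r c a b F x)"
    if "\<And>i j. i < n + m \<Longrightarrow> j < n + m \<Longrightarrow> has_parity (par n i + par n j) (F i j x)"
      "a + r \<le> n + m" "b + c \<le> n + m"
      "\<And>i j. i < r \<Longrightarrow> j < c \<Longrightarrow> even (par n (a + i) + par n (b + j)) = even p" for F p r c a b
    unfolding mpar_def
  proof (intro allI)
    fix i j
    show "has_parity p (mblock r c a b F x i j)"
    proof (cases "i < r \<and> j < c")
      case True
      with that(2,3) have "has_parity (par n (a + i) + par n (b + j)) (F (a + i) (b + j) x)"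
        by (intro that(1)) auto
      with True show ?thesis using has_parity_cong[OF that(4)[of i j]] by (simp add: mblock_def)
    qed (auto simp: mblock_def)
  qed
  show "mpar 1 (B x)" "mpar 1 (C x)" "mpar 0 (D x)" "mpar 0 (A x)"
    "mpar 0 (P x)" "mpar 1 (Q x)" "mpar 1 (R x)" "mpar 0 (S x)"
    by (rule F; (use Lpar Kpar assms in \<open>simp add: par_def\<close>))+
qed

private lemma block_smat:
  assumes "a + r \<le> n + m" "b + c \<le> n + m"
  shows "smat n m V (mblock r c a b L)" "smat n m V (mblock r c a b K)"
proof -
  have "smat n m V (mblock r c a b F)"
    if "\<And>i j. i < n + m \<Longrightarrow> j < n + m \<Longrightarrow> F i j \<in> superfunctions n m V" for F
    unfolding smat_def
  proof (intro allI)
    fix i j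
    show "(\<lambda>y. mblock r c a b F y i j) \<in> superfunctions n m V"
      using that[of "a + i" "b + j"] assms
      by (cases "i < r \<and> j < c") (auto simp: mblock_def superfunctions_zero)
  qed
  then show "smat n m V (mblock r c a b L)" "smat n m V (mblock r c a b K)" using L K by auto
qed

text \<open>The inverse of D. From C Q + D S = 1 one gets D S = 1 - C Q, where C Q is nilpotent as a
  product of odd blocks, so E = S (1 - C Q)^(-1). The explicit formula also shows that the entries
  are superfunctions.\<close>

private definition E :: "(nat \<Rightarrow> real) \<Rightarrow> gmat" where
  "E y = mm m (S y) (mgeom m (mm n (C y) (Q y)) m)"

private lemma E_fmt: "mfmt m m (E y)"
  unfolding E_def by (rule mfmt_mm[OF mfmt_mblock mfmt_mgeom[OF mfmt_mm[OF mfmt_mblock mfmt_mblock]]])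

private lemma E_smat: "smat n m V E"
  unfolding E_def[abs_def] by (intro smat_mm smat_mgeom V block_smat) auto

text \<open>E is a right inverse by construction. A left inverse is obtained in the same way from S
  D = 1 - R B, and a left and a right inverse coincide.\<close>

private lemma E_inverse:
  assumes x: "x \<in> V"
  shows "mm m (D x) (E x) = mid m" "mm m (E x) (D x) = mid m"
proof -
  let ?X = "mm n (C x) (Q x)" and ?Y = "mm n (R x) (B x)"
  have nil: "mpow m (mm n (mblock m n a b F x) (mblock n m a' b' G x)) (Suc m) = 0"
    if "mpar 1 (mblock m n a b F x)" "smat n m V (mblock m n a b F)" "smat n m V (mblock n m a' b' G)"
    for a b a' b' F G
  proof (rule mpow_nilpotent)
    fix i j
    have "gbody (mblock m n a b F x i l) = 0" for l
      using that(1) gbody_odd[of 1] by (simp add: mpar_def)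
    then show "gbody (mm n (mblock m n a b F x) (mblock n m a' b' G x) i j) = 0"
      by (simp add: mm_def)
    show "gsupported m (mm n (mblock m n a b F x) (mblock n m a' b' G x) i j)"
      using smat_mm[OF V that(2,3), of n] x superfunctions_gsupported by (fastforce simp: smat_def)
  qed
  have X: "mfmt m m ?X" and Y: "mfmt m m ?Y" by (rule mfmt_mm[OF mfmt_mblock mfmt_mblock])+
  have "mm m (D x) (S x) = mid m - ?X" "mm m (S x) (D x) = mid m - ?Y"
    using block_equations(4,8)[OF x] by (simp_all add: algebra_simps)
  moreover have "mpow m ?X (Suc m) = 0" "mpow m ?Y (Suc m) = 0"
    using block_parity[OF x] by (auto intro!: nil block_smat simp del: mpow.simps)
  ultimately have DE: "mm m (D x) (E x) = mid m"
    and ED: "mm m (mm m (mgeom m ?Y m) (S x)) (D x) = mid m"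
    using mgeom_inverse[OF X] mgeom_inverse[OF Y] by (simp_all add: E_def mm_assoc[symmetric])
      (simp_all add: mm_assoc)
  have "mm m (mm m (mgeom m ?Y m) (S x)) (mm m (D x) (E x)) = E x"
    using ED E_fmt[of x] by (simp add: mm_assoc[symmetric] mm_mid_left)
  moreover have "mfmt m m (mm m (mgeom m ?Y m) (S x))"
    by (rule mfmt_mm[OF mfmt_mgeom[OF Y] mfmt_mblock])
  ultimately have "mm m (mgeom m ?Y m) (S x) = E x"
    unfolding DE by (simp add: mm_mid_right)
  with ED show "mm m (E x) (D x) = mid m" by simp
  show "mm m (D x) (E x) = mid m" by (rule DE)
qed

private lemma E_parity: "x \<in> V \<Longrightarrow> mpar 0 (E x)"
proof -
  assume x: "x \<in> V"
  have "mpar 0 (mm n (C x) (Q x))"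
    using mpar_mm[OF block_parity(2)[OF x] block_parity(6)[OF x], of n] mpar_cong[of "1 + 1" 0] by simp
  from mpar_mm[OF block_parity(8)[OF x] mpar_mgeom[OF this], of m m m] show ?thesis
    by (simp add: E_def)
qed

text \<open>The Schur complement of D in L; its inverse is the block P of K, so the logarithmic
  derivative of its determinant is directly expressible by K.\<close>

private definition A' :: "(nat \<Rightarrow> real) \<Rightarrow> gmat" where
  "A' y = A y - mm m (B y) (mm m (E y) (C y))"

private lemma A'_inverse:
  assumes x: "x \<in> V"
  shows "mm n (A' x) (P x) = mid n" "mm n (P x) (A' x) = mid n"
proof -
  have "mm m (E x) (mm n (C x) (P x)) = - mm m (E x) (mm m (D x) (R x))"
    using block_equations(3)[OF x] by (simp add: eq_neg_iff_add_eq_0 mm_linear(2)[symmetric] mm_linear(10))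
  also have "mm m (E x) (mm m (D x) (R x)) = R x"
    using E_inverse(2)[OF x] by (simp add: mm_assoc[symmetric] mm_mid_left[OF mfmt_mblock])
  finally have ECP: "mm m (E x) (mm n (C x) (P x)) = - R x" .
  show "mm n (A' x) (P x) = mid n"
    using block_equations(1)[OF x] unfolding A'_def mm_linear mm_assoc ECP by (simp only: diff_minus_eq_add)
  have PB: "mm n (P x) (B x) = - mm m (Q x) (D x)"
    using block_equations(6)[OF x] by (simp add: eq_neg_iff_add_eq_0)
  have "mm n (P x) (mm m (B x) (mm m (E x) (C x))) = mm m (mm n (P x) (B x)) (mm m (E x) (C x))"
    by (simp add: mm_assoc)
  also have "\<dots> = - mm m (Q x) (mm m (mm m (D x) (E x)) (C x))"
    by (simp add: PB mm_linear mm_assoc)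
  also have "\<dots> = - mm m (Q x) (C x)"
    using E_inverse(1)[OF x] by (simp add: mm_mid_left[OF mfmt_mblock])
  finally show "mm n (P x) (A' x) = mid n"
    using block_equations(5)[OF x] by (simp add: A'_def mm_linear)
qed

private lemma A'_parity: "x \<in> V \<Longrightarrow> mpar 0 (A' x)"
proof -
  assume x: "x \<in> V"
  have "mpar (1 + (0 + 1)) (mm m (B x) (mm m (E x) (C x)))"
    by (intro mpar_mm block_parity x E_parity)
  then have "mpar 0 (mm m (B x) (mm m (E x) (C x)))"
    using mpar_cong[of "1 + (0 + 1)" 0] by simp
  with block_parity(4)[OF x] show ?thesis by (simp add: A'_def mpar_def has_parity_diff)
qed

private lemma A'_fmt: "mfmt n n (A' y)"
proof -
  have "mfmt n n (mm m (B y) (mm m (E y) (C y)))"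
    by (rule mfmt_mm[OF mfmt_mblock mfmt_mm[OF E_fmt mfmt_mblock]])
  with mfmt_mblock[of n n 0 0 L y] show ?thesis by (simp add: A'_def mfmt_def)
qed

private lemma berezinian_eq:
  assumes x: "x \<in> V"
  shows "berezinian n m (\<lambda>i j. L i j x) = gdet n (A' x) * gdet m (E x)"
proof -
  have E: "gmat_inv m (\<lambda>k l. L (n + k) (n + l) x) i j = E x i j" if "i < m" "j < m" for i j
  proof (rule gmat_inv_eqI[OF _ _ that])
    fix i j assume ij: "i < m" "j < m"
    show "(\<Sum>l<m. L (n + i) (n + l) x * E x l j) = (if i = j then 1 else 0)"
      using fun_cong[OF fun_cong[OF E_inverse(1)[OF x]], of i j] ij by (simp add: mm_def mblock_def mid_def)
    show "(\<Sum>l<m. E x i l * L (n + l) (n + j) x) = (if i = j then 1 else 0)"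
      using fun_cong[OF fun_cong[OF E_inverse(2)[OF x]], of i j] ij by (simp add: mm_def mblock_def mid_def)
  qed
  have "gdet m (gmat_inv m (\<lambda>k l. L (n + k) (n + l) x)) = gdet m (E x)"
    by (rule gdet_cong) (rule E)
  moreover have "gdet n (\<lambda>i j. L i j x - (\<Sum>k<m. \<Sum>l<m. L i (n + k) x *
      gmat_inv m (\<lambda>k l. L (n + k) (n + l) x) k l * L (n + l) j x)) = gdet n (A' x)"
  proof (rule gdet_cong)
    fix i j assume "i < n" "j < n"
    then show "L i j x - (\<Sum>k<m. \<Sum>l<m. L i (n + k) x *
      gmat_inv m (\<lambda>k l. L (n + k) (n + l) x) k l * L (n + l) j x) = A' x i j"
      by (simp add: A'_def mm_def mblock_def E sum_distrib_left mult.assoc)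
  qed
  ultimately show ?thesis by (simp add: berezinian_def Let_def)
qed

text \<open>The Berezinian is det A' det E. Jacobi's formula for both factors gives tr (dA' P) + tr
  (dE D) = tr (dA' P) - tr (dD E), and \<open>supertrace_blocks\<close> recognizes this as the
  supertrace of dL K.\<close>

theorem pd_log_berezinian:
  assumes x: "x \<in> V"
  shows "pd n t (\<lambda>y. gln m (gabs (berezinian n m (\<lambda>i j. L i j y)))) x =
    (\<Sum>s<n+m. ((- 1) ^ par n s :: real) *\<^sub>R (\<Sum>k<n+m. pd n t (L s k) x * K k s x))"
proof -
  let ?dL = "\<lambda>i j. pd n t (L i j)"
  let ?dA = "mblock n n 0 0 ?dL x" and ?dB = "mblock n m 0 n ?dL x"
    and ?dC = "mblock m n n 0 ?dL x" and ?dD = "mblock m m n n ?dL x"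
  let ?\<epsilon> = "(- 1) ^ par n t :: real"
  define dE where "dE = (\<lambda>i j. pd n t (\<lambda>y. E y i j) x)"
  have pE: "has_pdm n t E dE x"
    unfolding dE_def by (rule smat_has_pdm[OF E_smat x])
  have pblock: "has_pdm n t (mblock r c a b L) (mblock r c a b ?dL x) x"
    if "a + r \<le> n + m" "b + c \<le> n + m" for a b r c
    unfolding has_pdm_def
  proof (intro allI)
    fix i j
    show "has_pd n t (\<lambda>y. mblock r c a b L y i j) (mblock r c a b ?dL x i j) x"
      using that has_pd_superfunction[OF L x, of "a + i" "b + j"]
      by (cases "i < r \<and> j < c") (auto simp: mblock_def has_pd_zero)
  qed
  have dpar: "has_parity (par n i + par n j + par n t) (?dL i j x)" if "i < n + m" "j < n + m" for i j
    using has_parity_pd[OF V, of "par n i + par n j" "L i j" x t] Lpar that x by simp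
  have dCpar: "mpar (par n t + 1) ?dC"
    unfolding mpar_def
  proof (intro allI)
    fix i j
    show "has_parity (par n t + 1) (?dC i j)"
      using dpar[of "n + i" j] by (auto simp: mblock_def par_def)
  qed
  have dDpar: "mpar (par n t) ?dD"
    unfolding mpar_def
  proof (intro allI)
    fix i j
    show "has_parity (par n t) (?dD i j)"
      using dpar[of "n + i" "n + j"] has_parity_cong[of "1 + 1 + par n t" "par n t"]
      by (auto simp: mblock_def par_def)
  qed
  have dEfmt: "mfmt m m dE"
    unfolding mfmt_def dE_def
  proof (intro allI impI)
    fix i j assume "\<not> (i < m \<and> j < m)"
    then have "(\<lambda>y. E y i j) = (\<lambda>_. 0)" using E_fmt by (auto simp: mfmt_def)
    then show "pd n t (\<lambda>y. E y i j) x = 0" by (simp add: pd_eqI[OF has_pd_zero])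
  qed
  \<comment> \<open>Differentiating D E = 1; no sign arises because D is even.\<close>
  have dE: "dE = - mm m (E x) (mm m ?dD (E x))"
  proof -
    have "has_pdm n t (\<lambda>y. mm m (D y) (E y)) (mm m ?dD (E x) + msc ((- 1) ^ (par n t * 0)) (mm m (D x) dE)) x"
      by (intro has_pdm_mm pblock pE block_parity x) auto
    moreover have "has_pdm n t (\<lambda>y. mm m (D y) (E y)) 0 x"
      unfolding has_pdm_def
    proof (intro allI)
      fix i j
      have "has_pd n t (\<lambda>_. of_real (if i < m \<and> i = j then 1 else 0)) 0 x" by (rule has_pd_const)
      then show "has_pd n t (\<lambda>y. mm m (D y) (E y) i j) ((0 :: gmat) i j) x"
        unfolding zero_fun_def
        by (rule has_pd_cong[OF V x, rotated]) (simp add: E_inverse mid_def)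
    qed
    ultimately have "mm m ?dD (E x) + mm m (D x) dE = 0"
      using has_pdm_unique by fastforce
    then have "mm m (D x) dE = - mm m ?dD (E x)" by (simp add: eq_neg_iff_add_eq_0 add.commute)
    then have "mm m (E x) (mm m (D x) dE) = - mm m (E x) (mm m ?dD (E x))"
      by (simp add: mm_linear)
    then show ?thesis
      using E_inverse(2)[OF x] dEfmt by (simp add: mm_assoc[symmetric] mm_mid_left)
  qed
  define dA' where "dA' = ?dA - (mm m ?dB (mm m (E x) (C x)) + msc ?\<epsilon> (mm m (B x) (mm m dE (C x))) +
      msc ?\<epsilon> (mm m (B x) (mm m (E x) ?dC)))"
  have pA': "has_pdm n t A' dA' x"
  proof -
    have "has_pdm n t A' (?dA - (mm m ?dB (mm m (E x) (C x)) + msc ((- 1) ^ (par n t * 1)) (mm m (B x)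
        (mm m dE (C x) + msc ((- 1) ^ (par n t * 0)) (mm m (E x) ?dC))))) x"
      unfolding A'_def[abs_def]
      by (intro has_pdm_diff has_pdm_mm pblock pE block_parity E_parity x) auto
    then show ?thesis by (simp add: dA'_def mm_linear msc_add add.assoc)
  qed
  have dA'fmt: "mfmt n n dA'"
  proof -
    have "dA' i j = 0" if "\<not> (i < n \<and> j < n)" for i j
    proof -
      have "(\<lambda>y. A' y i j) = (\<lambda>_. 0)" using A'_fmt that by (auto simp: mfmt_def)
      then have "has_pd n t (\<lambda>_. 0) (dA' i j) x" using pA' by (simp add: has_pdm_def) (metis)
      then show ?thesis using has_pd_unique has_pd_zero by blast
    qed
    then show ?thesis by (simp add: mfmt_def)
  qed
  have entry: "X = Y \<Longrightarrow> X j l = Y j l" for X Y :: gmat and j l by simp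
  have pdetA: "has_pd n t (\<lambda>y. gdet n (A' y)) (mtr n (mm n dA' (P x)) * gdet n (A' x)) x"
    unfolding mtr_def
  proof (rule has_pd_gdet[where dA = dA' and G = "mm n dA' (P x)"])
    fix j l
    show "has_pd n t (\<lambda>y. A' y j l) (dA' j l) x" using pA' by (simp add: has_pdm_def)
    show "has_parity 0 (A' x j l)" using A'_parity[OF x] by (simp add: mpar_def)
    have "mm n (mm n dA' (P x)) (A' x) = dA'"
      using A'_inverse(2)[OF x] dA'fmt by (simp add: mm_assoc mm_mid_right)
    from entry[OF this] show "dA' j l = (\<Sum>t<n. mm n dA' (P x) j t * A' x t l)"
      by (simp add: mm_def[of n "mm n dA' (P x)"])
  qed
  have pdetE: "has_pd n t (\<lambda>y. gdet m (E y)) (mtr m (mm m dE (D x)) * gdet m (E x)) x"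
    unfolding mtr_def
  proof (rule has_pd_gdet[where dA = dE and G = "mm m dE (D x)"])
    fix j l
    show "has_pd n t (\<lambda>y. E y j l) (dE j l) x" using pE by (simp add: has_pdm_def)
    show "has_parity 0 (E x j l)" using E_parity[OF x] by (simp add: mpar_def)
    have "mm m (mm m dE (D x)) (E x) = dE"
      using E_inverse(1)[OF x] dEfmt by (simp add: mm_assoc mm_mid_right)
    from entry[OF this] show "dE j l = (\<Sum>t<m. mm m dE (D x) j t * E x t l)"
      by (simp add: mm_def[of m "mm m dE (D x)"])
  qed
  have trE: "mtr m (mm m dE (D x)) = - mtr m (mm m ?dD (E x))"
  proof -
    have "mm m dE (D x) = - mm m (E x) (mm m ?dD (mm m (E x) (D x)))"
      by (simp add: dE mm_linear mm_assoc)
    also have "\<dots> = - mm m (E x) ?dD"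
      by (simp add: E_inverse[OF x] mm_mid_right[OF mfmt_mblock])
    finally have "mtr m (mm m dE (D x)) = - mtr m (mm m (E x) ?dD)" by (simp add: mtr_linear)
    also have "mtr m (mm m (E x) ?dD) = ((- 1) ^ (0 * par n t) :: real) *\<^sub>R mtr m (mm m ?dD (E x))"
      by (rule mtr_commute[OF E_parity[OF x] dDpar])
    finally show ?thesis by simp
  qed
  have evenA: "has_parity 0 (gdet n (A' y))" and evenE: "has_parity 0 (gdet m (E y))" if "y \<in> V" for y
    using A'_parity[OF that] E_parity[OF that] by (auto intro!: has_parity_gdet simp: mpar_def)
  define \<sigma> where "\<sigma> = mtr n (mm n dA' (P x)) - mtr m (mm m ?dD (E x))"
  let ?Ber = "\<lambda>y. berezinian n m (\<lambda>i j. L i j y)"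
  have pBer: "has_pd n t ?Ber (\<sigma> * ?Ber x) x"
  proof -
    have "has_pd n t (\<lambda>y. gdet n (A' y) * gdet m (E y)) (mtr n (mm n dA' (P x)) * gdet n (A' x) * gdet m (E x) +
       ((- 1) ^ (par n t * 0) :: real) *\<^sub>R (gdet n (A' x) * (mtr m (mm m dE (D x)) * gdet m (E x)))) x"
      by (rule has_pd_mult[OF pdetA pdetE evenA[OF x]])
    moreover have "gdet n (A' x) * (mtr m (mm m dE (D x)) * gdet m (E x)) =
        mtr m (mm m dE (D x)) * (gdet n (A' x) * gdet m (E x))"
      by (metis mult.assoc mult_commute_even'[OF evenA[OF x]])
    ultimately have "has_pd n t (\<lambda>y. gdet n (A' y) * gdet m (E y)) (\<sigma> * (gdet n (A' x) * gdet m (E x))) x"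
      by (simp add: \<sigma>_def trE mult.assoc left_diff_distrib)
    then show ?thesis
      unfolding berezinian_eq[OF x]
      by (rule has_pd_cong[OF V x, rotated]) (simp add: berezinian_eq)
  qed
  have supp: "gsupported m (gdet k F)" if "\<And>i j. gsupported m (F i j)" for k F
    unfolding gdet_def
  proof (intro gsupported_sum gsupported_mult)
    show "gsupported m (of_int (sign p))" for p :: "nat \<Rightarrow> nat"
      by (metis gsupported_of_real of_real_of_int_eq)
    have "gsupported m (prod_list (map (\<lambda>i. F i (p i)) is))" for p "is"
      by (induction "is") (auto intro: gsupported_mult that)
    then show "gsupported m (prod_list (map (\<lambda>i. F i (p i)) [0..<k]))" for p .
  qed
  have "pd n t (\<lambda>y. gln m (gabs (?Ber y))) x = \<sigma>"
  proof (rule pd_gln_gabs[OF V x _ _ _ pBer])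
    fix y assume y: "y \<in> V"
    show "has_parity 0 (?Ber y)"
      using has_parity_mult[OF evenA[OF y] evenE[OF y]] by (simp add: berezinian_eq[OF y])
    have "gsupported m (E y i j)" "gsupported m (A' y i j)" for i j
    proof -
      have S: "smat n m V F \<Longrightarrow> gsupported m (F y i j)" for F i j
        using superfunctions_gsupported y by (fastforce simp: smat_def)
      show "gsupported m (E y i j)" by (rule S[OF E_smat])
      have "gsupported m (mm m (B y) (mm m (E y) (C y)) i j)"
        by (rule S[of "\<lambda>y. mm m (B y) (mm m (E y) (C y))"]) (intro smat_mm V block_smat E_smat, auto)
      moreover have "gsupported m (A y i j)" by (rule S) (intro block_smat, auto)
      ultimately show "gsupported m (A' y i j)" by (simp add: A'_def gsupported_diff)
    qed
    then show "gsupported m (?Ber y)"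
      by (simp add: berezinian_eq[OF y] gsupported_mult supp)
    have "gbody (gdet n (A' y)) \<noteq> 0"
      using A'_inverse(1)[OF y] by (intro gbody_gdet_nonzero[of n _ "P y"]) (auto simp: mm_def mid_def fun_eq_iff)
    moreover have "gbody (gdet m (E y)) \<noteq> 0"
      using E_inverse(2)[OF y] by (intro gbody_gdet_nonzero[of m _ "D y"]) (auto simp: mm_def mid_def fun_eq_iff)
    ultimately show "gbody (?Ber y) \<noteq> 0" by (simp add: berezinian_eq[OF y])
  qed
  also have "\<sigma> = mtr n (mm n ?dA (P x) + mm m ?dB (R x)) - mtr m (mm n ?dC (Q x) + mm m ?dD (S x))"
    unfolding \<sigma>_def dA'_def dE
    by (rule supertrace_blocks[symmetric, where D = "D x"])
      (simp_all only: mfmt_mblock E_fmt block_parity[OF x] E_parity[OF x] dCpar dDpar block_equations[OF x]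
        E_inverse[OF x])
  also have "\<dots> = (\<Sum>s<n+m. ((- 1) ^ par n s :: real) *\<^sub>R (\<Sum>k<n+m. pd n t (L s k) x * K k s x))"
    unfolding mblock_mult sum_lessThan_split[of _ n m]
    by (simp add: mtr_def par_def sum_negf sum_subtractf sum.distrib sum_lessThan_split)
  finally show ?thesis .
qed

end


subsection \<open>Transformation laws at a point\<close>

text \<open>Signs are kept as real scalars so that they can be pulled out of noncommuting products,
  merged by \<open>sg_mult\<close>, and compared by the parity of one exponent through
  \<open>sg_cong\<close>.\<close>

definition sg :: "nat \<Rightarrow> real" where
  "sg k = (- 1) ^ k"

lemma sg_mult: "sg k * sg l = sg (k + l)"
  by (simp add: sg_def power_add)

lemma sg_cong: "even k = even l \<Longrightarrow> sg k = sg l"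
  by (simp add: sg_def minus_one_power_iff)

lemma sg_0 [simp]: "sg 0 = 1"
  by (simp add: sg_def)

lemma sg_grassmann: "(- 1) ^ k * z = sg k *\<^sub>R z" "z * (- 1) ^ k = sg k *\<^sub>R z" for z :: grassmann
  by (simp_all add: sg_def minus_one_power_grassmann)

lemma mult_commute_sg: "has_parity p a \<Longrightarrow> has_parity q b \<Longrightarrow> a * b = sg (p * q) *\<^sub>R (b * a)"
  unfolding sg_def by (rule mult_commute_parity)

lemma has_parity_eq: "has_parity p a \<Longrightarrow> even p = even q \<Longrightarrow> has_parity q a"
  using has_parity_cong by blast

lemma sum_swap3:
  "(\<Sum>a\<in>A. \<Sum>b\<in>B. \<Sum>c\<in>C. f a b c) = (\<Sum>b\<in>B. \<Sum>c\<in>C. \<Sum>a\<in>A. f a b c)"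
  by (subst sum.swap) (intro sum.cong refl sum.swap)

lemma sum_swap4:
  "(\<Sum>a\<in>A. \<Sum>b\<in>B. \<Sum>c\<in>C. \<Sum>d\<in>D. f a b c d) = (\<Sum>b\<in>B. \<Sum>c\<in>C. \<Sum>d\<in>D. \<Sum>a\<in>A. f a b c d)"
  by (subst sum.swap) (intro sum.cong refl sum_swap3)

lemma sum_delta_mult:
  fixes j k :: nat
  shows
  "j < k \<Longrightarrow> (\<Sum>l<k. f l * (if l = j then 1 else 0)) = (f j :: 'a :: semiring_1)"
  "j < k \<Longrightarrow> (\<Sum>l<k. f l * (if j = l then 1 else 0)) = (f j :: 'a :: semiring_1)"
  "j < k \<Longrightarrow> (\<Sum>l<k. (if j = l then 1 else 0) * f l) = (f j :: 'a :: semiring_1)"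
  "j < k \<Longrightarrow> (\<Sum>l<k. (if l = j then 1 else 0) * f l) = (f j :: 'a :: semiring_1)"
  by (simp_all add: if_distrib[of "\<lambda>z. z * _"] if_distrib[of "\<lambda>z. _ * z"] cong: if_cong)

text \<open>All quantities at one point of the domain of the coordinates \<open>x\<close>: \<open>a i i'\<close> is \<open>\<partial>\<^sub>i x\<^bsup>i'\<^esup>\<close>, \<open>b\<close> its inverse,
  \<open>da l i i'\<close> is \<open>\<partial>\<^sub>l \<partial>\<^sub>i x\<^bsup>i'\<^esup>\<close>, \<open>dS l i j\<close> is \<open>\<partial>\<^sub>l S\<^bsup>ij\<^esup>\<close>, \<open>\<Gamma> k i j\<close> is \<open>\<Gamma>\<^sup>k\<^bsub>ij\<^esub>\<close>, and \<open>\<Gamma>'\<close> consists of the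
  connection coefficients in the coordinates \<open>x'\<close>.\<close>

locale transition_algebra =
  fixes n m s :: nat and a b S :: gmat and da dS \<Gamma> \<Gamma>' :: "nat \<Rightarrow> nat \<Rightarrow> nat \<Rightarrow> grassmann"
  assumes a_par: "\<And>i j. i < n + m \<Longrightarrow> j < n + m \<Longrightarrow> has_parity (par n i + par n j) (a i j)"
    and b_par: "\<And>i j. i < n + m \<Longrightarrow> j < n + m \<Longrightarrow> has_parity (par n i + par n j) (b i j)"
    and S_par: "\<And>i j. i < n + m \<Longrightarrow> j < n + m \<Longrightarrow> has_parity (s + par n i + par n j) (S i j)"
    and da_par: "\<And>l i j. l < n + m \<Longrightarrow> i < n + m \<Longrightarrow> j < n + m \<Longrightarrow>
      has_parity (par n i + par n j + par n l) (da l i j)"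
    and dS_par: "\<And>l i j. l < n + m \<Longrightarrow> i < n + m \<Longrightarrow> j < n + m \<Longrightarrow>
      has_parity (s + par n i + par n j + par n l) (dS l i j)"
    and \<Gamma>'_par: "\<And>k i j. k < n + m \<Longrightarrow> i < n + m \<Longrightarrow> j < n + m \<Longrightarrow>
      has_parity (par n i + par n j + par n k) (\<Gamma>' k i j)"
    and ab: "\<And>i j. i < n + m \<Longrightarrow> j < n + m \<Longrightarrow> (\<Sum>k<n+m. a i k * b k j) = (if i = j then 1 else 0)"
    and ba: "\<And>i j. i < n + m \<Longrightarrow> j < n + m \<Longrightarrow> (\<Sum>k<n+m. b i k * a k j) = (if i = j then 1 else 0)"
    and S_sym: "\<And>i j. i < n + m \<Longrightarrow> j < n + m \<Longrightarrow> S i j = sg (par n i * par n j) *\<^sub>R S j i"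
    and \<Gamma>_sym: "\<And>k i j. k < n + m \<Longrightarrow> i < n + m \<Longrightarrow> j < n + m \<Longrightarrow> \<Gamma> k i j = sg (par n i * par n j) *\<^sub>R \<Gamma> k j i"
    and \<Gamma>'_sym: "\<And>k i j. k < n + m \<Longrightarrow> i < n + m \<Longrightarrow> j < n + m \<Longrightarrow> \<Gamma>' k i j = sg (par n i * par n j) *\<^sub>R \<Gamma>' k j i"
    and connection: "\<And>i j k'. i < n + m \<Longrightarrow> j < n + m \<Longrightarrow> k' < n + m \<Longrightarrow>
      (\<Sum>k<n+m. \<Gamma> k i j * a k k') = da i j k' + (\<Sum>i'<n+m. \<Sum>j'<n+m.
        sg (par n i' * (par n j + par n j')) *\<^sub>R (a i i' * a j j' * \<Gamma>' k' i' j'))"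
begin

abbreviation \<pi> :: "nat \<Rightarrow> nat" where "\<pi> \<equiv> par n"

text \<open>The expected components in the new coordinates. The sign arises from moving the momentum
  p_{j'} to the left past a_i^{i'} after p_j = a_j^{j'} p_{j'} and p_i = a_i^{i'} p_{i'} are
  inserted into S^{ij} p_j p_i.\<close>

definition S' :: gmat where
  "S' i' j' = (\<Sum>i<n+m. \<Sum>j<n+m. sg (\<pi> j' * (\<pi> i + \<pi> i')) *\<^sub>R (S i j * a j j' * a i i'))"

definition divS :: "nat \<Rightarrow> grassmann" where
  "divS i = (\<Sum>j<n+m. sg (\<pi> j * (s + 1)) *\<^sub>R dS j j i)"

definition \<sigma> :: "nat \<Rightarrow> grassmann" where
  "\<sigma> j = (\<Sum>i<n+m. sg (\<pi> i) *\<^sub>R (\<Sum>k<n+m. da j i k * b k i))"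

definition str :: "(nat \<Rightarrow> nat \<Rightarrow> nat \<Rightarrow> grassmann) \<Rightarrow> nat \<Rightarrow> grassmann" where
  "str G j = (\<Sum>i<n+m. sg (\<pi> i) *\<^sub>R G i j i)"

text \<open>In the connection law both the term with \<Gamma> and the one quadratic in a pick up the
  sign of i j when i and j are exchanged: swapping the two Jacobian factors and the lower indices of
  \<Gamma>' contributes exactly that. The remaining term has to follow.\<close>

lemma da_sym:
  assumes "i < n + m" "j < n + m" "k' < n + m"
  shows "da i j k' = sg (\<pi> i * \<pi> j) *\<^sub>R da j i k'"
proof -
  let ?t = "\<lambda>i j i' j'. sg (\<pi> i' * (\<pi> j + \<pi> j')) *\<^sub>R (a i i' * a j j' * \<Gamma>' k' i' j')"
  have "(\<Sum>i'<n+m. \<Sum>j'<n+m. ?t i j i' j') = (\<Sum>i'<n+m. \<Sum>j'<n+m. sg (\<pi> i * \<pi> j) *\<^sub>R ?t j i j' i')"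
  proof (intro sum.cong refl)
    fix i' j' assume "i' \<in> {..<n+m}" "j' \<in> {..<n+m}"
    then have ij: "i' < n + m" "j' < n + m" by auto
    have "a i i' * a j j' * \<Gamma>' k' i' j' =
        sg ((\<pi> i + \<pi> i') * (\<pi> j + \<pi> j') + \<pi> i' * \<pi> j') *\<^sub>R (a j j' * a i i' * \<Gamma>' k' j' i')"
      using mult_commute_sg[OF a_par a_par, of i i' j j'] \<Gamma>'_sym[OF assms(3) ij] ij assms
      by (simp add: sg_mult add.commute)
    moreover have "sg (\<pi> i' * (\<pi> j + \<pi> j')) * sg ((\<pi> i + \<pi> i') * (\<pi> j + \<pi> j') + \<pi> i' * \<pi> j') =
        sg (\<pi> i * \<pi> j) * sg (\<pi> j' * (\<pi> i + \<pi> i'))"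
      unfolding sg_mult by (rule sg_cong) auto
    ultimately show "?t i j i' j' = sg (\<pi> i * \<pi> j) *\<^sub>R ?t j i j' i'" by simp
  qed
  also have "\<dots> = sg (\<pi> i * \<pi> j) *\<^sub>R (\<Sum>j'<n+m. \<Sum>i'<n+m. ?t j i j' i')"
    unfolding scaleR_sum_right by (rule sum.swap)
  finally have "da i j k' = (\<Sum>k<n+m. \<Gamma> k i j * a k k') - sg (\<pi> i * \<pi> j) *\<^sub>R (\<Sum>j'<n+m. \<Sum>i'<n+m. ?t j i j' i')"
    using connection[OF assms] by simp
  also have "(\<Sum>k<n+m. \<Gamma> k i j * a k k') = sg (\<pi> i * \<pi> j) *\<^sub>R (\<Sum>k<n+m. \<Gamma> k j i * a k k')"
    unfolding scaleR_sum_right using \<Gamma>_sym[OF _ assms(1,2)] by (intro sum.cong) auto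
  finally show ?thesis
    using connection[OF assms(2,1,3)] by (simp flip: scaleR_diff_right)
qed

text \<open>Serves the terms of the divergence whose factor a_j^{j'} is not differentiated: once
  b_{j'}^l has been moved to the far right, a_j^{j'} b_{j'}^l contracts to a delta.\<close>

lemma contract_inverse:
  assumes j: "j < n + m" and i': "i' < n + m"
    and X: "\<And>l. l < n + m \<Longrightarrow> has_parity (s + \<pi> j + \<pi> i' + \<pi> l) (X l)"
  shows "(\<Sum>j'<n+m. \<Sum>l<n+m. sg (\<pi> j' * (s + 1) + \<pi> i' * (\<pi> j + \<pi> j')) *\<^sub>R (b j' l * (X l * a j j'))) =
    sg (\<pi> j * (s + 1)) *\<^sub>R X j"
proof -
  have "(\<Sum>j'<n+m. \<Sum>l<n+m. sg (\<pi> j' * (s + 1) + \<pi> i' * (\<pi> j + \<pi> j')) *\<^sub>R (b j' l * (X l * a j j'))) =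
      (\<Sum>j'<n+m. \<Sum>l<n+m. sg (\<pi> l * (s + 1 + \<pi> i') + \<pi> i' * \<pi> j) *\<^sub>R (X l * (a j j' * b j' l)))"
  proof (intro sum.cong refl)
    fix j' l assume "j' \<in> {..<n+m}" "l \<in> {..<n+m}"
    then have jl: "j' < n + m" "l < n + m" by auto
    have "b j' l * (X l * a j j') =
        sg ((\<pi> j' + \<pi> l) * ((s + \<pi> j + \<pi> i' + \<pi> l) + (\<pi> j + \<pi> j'))) *\<^sub>R (X l * a j j' * b j' l)"
      using jl j by (intro mult_commute_sg b_par has_parity_mult X a_par)
    moreover have "sg (\<pi> j' * (s + 1) + \<pi> i' * (\<pi> j + \<pi> j')) *
        sg ((\<pi> j' + \<pi> l) * ((s + \<pi> j + \<pi> i' + \<pi> l) + (\<pi> j + \<pi> j'))) =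
      sg (\<pi> l * (s + 1 + \<pi> i') + \<pi> i' * \<pi> j)"
      unfolding sg_mult by (rule sg_cong) auto
    ultimately show "sg (\<pi> j' * (s + 1) + \<pi> i' * (\<pi> j + \<pi> j')) *\<^sub>R (b j' l * (X l * a j j')) =
        sg (\<pi> l * (s + 1 + \<pi> i') + \<pi> i' * \<pi> j) *\<^sub>R (X l * (a j j' * b j' l))"
      by (simp add: mult.assoc)
  qed
  also have "\<dots> = (\<Sum>l<n+m. sg (\<pi> l * (s + 1 + \<pi> i') + \<pi> i' * \<pi> j) *\<^sub>R (X l * (\<Sum>j'<n+m. a j j' * b j' l)))"
    by (subst sum.swap) (simp add: scaleR_sum_right sum_distrib_left)
  also have "\<dots> = (\<Sum>l<n+m. sg (\<pi> l * (s + 1 + \<pi> i') + \<pi> i' * \<pi> j) *\<^sub>R X l * (if j = l then 1 else 0))"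
    using ab[OF j] by (intro sum.cong refl) simp
  also have "\<dots> = sg (\<pi> j * (s + 1 + \<pi> i') + \<pi> i' * \<pi> j) *\<^sub>R X j"
    by (rule sum_delta_mult(2)[OF j])
  also have "sg (\<pi> j * (s + 1 + \<pi> i') + \<pi> i' * \<pi> j) = sg (\<pi> j * (s + 1))"
    by (rule sg_cong) auto
  finally show ?thesis .
qed

lemma \<sigma>_par: "j < n + m \<Longrightarrow> has_parity (\<pi> j) (\<sigma> j)"
proof -
  assume j: "j < n + m"
  have "has_parity (\<pi> j) (da j i k * b k i)" if "i < n + m" "k < n + m" for i k
    by (rule has_parity_eq[OF has_parity_mult[OF da_par[OF j that] b_par[OF that(2,1)]]]) auto
  then show ?thesis unfolding \<sigma>_def by (auto intro!: has_parity_sum has_parity_scaleR)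
qed

text \<open>Serves the term in which the derivative falls on a_j^{j'}. By \<open>da_sym\<close> the
  indices l and j change places, after which the sum over j' and l is the supertrace
  \<sigma>_j.\<close>

lemma contract_second_derivative:
  assumes i: "i < n + m" and j: "j < n + m" and i': "i' < n + m"
  shows "(\<Sum>j'<n+m. \<Sum>l<n+m. sg (\<pi> j' * (s + 1) + \<pi> i' * (\<pi> j + \<pi> j') + \<pi> l * (s + \<pi> j + \<pi> i')) *\<^sub>R
      (b j' l * (S j i * a i i' * da l j j'))) = S i j * \<sigma> j * a i i'"
proof -
  have "(\<Sum>j'<n+m. \<Sum>l<n+m. sg (\<pi> j' * (s + 1) + \<pi> i' * (\<pi> j + \<pi> j') + \<pi> l * (s + \<pi> j + \<pi> i')) *\<^sub>R
      (b j' l * (S j i * a i i' * da l j j'))) =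
     (\<Sum>j'<n+m. \<Sum>l<n+m. sg (\<pi> i' * \<pi> j + \<pi> l) *\<^sub>R (S j i * a i i' * (da j l j' * b j' l)))"
  proof (intro sum.cong refl)
    fix j' l assume "j' \<in> {..<n+m}" "l \<in> {..<n+m}"
    then have jl: "j' < n + m" "l < n + m" by auto
    have "b j' l * (S j i * a i i' * da j l j') =
        sg ((\<pi> j' + \<pi> l) * ((s + \<pi> j + \<pi> i) + (\<pi> i + \<pi> i') + (\<pi> l + \<pi> j' + \<pi> j))) *\<^sub>R
          (S j i * a i i' * da j l j' * b j' l)"
      using jl i j i' by (intro mult_commute_sg b_par has_parity_mult S_par a_par da_par)
    moreover have "sg (\<pi> j' * (s + 1) + \<pi> i' * (\<pi> j + \<pi> j') + \<pi> l * (s + \<pi> j + \<pi> i')) * (sg (\<pi> l * \<pi> j) *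
        sg ((\<pi> j' + \<pi> l) * ((s + \<pi> j + \<pi> i) + (\<pi> i + \<pi> i') + (\<pi> l + \<pi> j' + \<pi> j)))) =
      sg (\<pi> i' * \<pi> j + \<pi> l)"
      unfolding sg_mult by (rule sg_cong) auto
    ultimately show "sg (\<pi> j' * (s + 1) + \<pi> i' * (\<pi> j + \<pi> j') + \<pi> l * (s + \<pi> j + \<pi> i')) *\<^sub>R
        (b j' l * (S j i * a i i' * da l j j')) =
      sg (\<pi> i' * \<pi> j + \<pi> l) *\<^sub>R (S j i * a i i' * (da j l j' * b j' l))"
      using da_sym[OF jl(2) j jl(1)] by (simp add: mult.assoc)
  qed
  also have "\<dots> = sg (\<pi> i' * \<pi> j) *\<^sub>R (S j i * a i i' * \<sigma> j)"
    by (subst sum.swap) (simp add: \<sigma>_def scaleR_sum_right sum_distrib_left sg_mult[symmetric])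
  also have "S j i * a i i' * \<sigma> j = sg (\<pi> j * \<pi> i + (\<pi> i + \<pi> i') * \<pi> j) *\<^sub>R (S i j * \<sigma> j * a i i')"
    using mult_commute_sg[OF a_par[OF i i'] \<sigma>_par[OF j]] S_sym[OF j i] by (simp add: mult.assoc sg_mult)
  also have "sg (\<pi> i' * \<pi> j) *\<^sub>R \<dots> = S i j * \<sigma> j * a i i'"
  proof -
    have "sg (\<pi> i' * \<pi> j + (\<pi> j * \<pi> i + (\<pi> i + \<pi> i') * \<pi> j)) = sg 0" by (rule sg_cong) auto
    then show ?thesis by (simp add: sg_mult)
  qed
  finally show ?thesis .
qed

text \<open>\<open>U l j'\<close> is the derivative \<partial>_l of S'^{j'i'} expanded by the
  product rule, and b_{j'}^l turns it into a derivative by x'^{j'}.\<close>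

lemma divS_transform:
  assumes i': "i' < n + m"
    and U: "\<And>l j'. l < n + m \<Longrightarrow> j' < n + m \<Longrightarrow> U l j' = (\<Sum>j<n+m. \<Sum>i<n+m. sg (\<pi> i' * (\<pi> j + \<pi> j')) *\<^sub>R
      (dS l j i * a i i' * a j j' + sg (\<pi> l * (s + \<pi> j + \<pi> i)) *\<^sub>R (S j i * da l i i' * a j j') +
       sg (\<pi> l * (s + \<pi> j + \<pi> i + (\<pi> i + \<pi> i'))) *\<^sub>R (S j i * a i i' * da l j j')))"
  shows "(\<Sum>j'<n+m. sg (\<pi> j' * (s + 1)) *\<^sub>R (\<Sum>l<n+m. b j' l * U l j')) =
    (\<Sum>i<n+m. divS i * a i i') + (\<Sum>i<n+m. \<Sum>j<n+m. S i j * da j i i') +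
    (\<Sum>i<n+m. \<Sum>j<n+m. S i j * \<sigma> j * a i i')"
proof -
  let ?e = "\<lambda>j j'. \<pi> j' * (s + 1) + \<pi> i' * (\<pi> j + \<pi> j')"
  \<comment> \<open>\<open>?X\<close> collects the terms with the derivative on S or on a_i^{i'},
    which keep a_j^{j'} for contraction with b; \<open>?Y\<close> has the derivative on
    a_j^{j'}.\<close>
  let ?X = "\<lambda>i j l. dS l j i * a i i' + sg (\<pi> l * (s + \<pi> j + \<pi> i)) *\<^sub>R (S j i * da l i i')"
  let ?Y = "\<lambda>i j j' l. S j i * a i i' * da l j j'"
  let ?f = "\<lambda>i j j' l. sg (?e j j') *\<^sub>R (b j' l * (?X i j l * a j j')) +
      sg (?e j j' + \<pi> l * (s + \<pi> j + \<pi> i')) *\<^sub>R (b j' l * ?Y i j j' l)"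
  have "(\<Sum>j'<n+m. sg (\<pi> j' * (s + 1)) *\<^sub>R (\<Sum>l<n+m. b j' l * U l j')) =
      (\<Sum>j'<n+m. \<Sum>l<n+m. \<Sum>j<n+m. \<Sum>i<n+m. ?f i j j' l)"
    unfolding scaleR_sum_right
  proof (intro sum.cong refl)
    fix j' l assume jl: "j' \<in> {..<n+m}" "l \<in> {..<n+m}"
    have "sg (\<pi> l * (s + \<pi> j + \<pi> i + (\<pi> i + \<pi> i'))) = sg (\<pi> l * (s + \<pi> j + \<pi> i'))" for i j
      by (rule sg_cong) auto
    note e = this
    have "sg (\<pi> j' * (s + 1)) *\<^sub>R (b j' l * U l j') = (\<Sum>j<n+m. \<Sum>i<n+m. sg (\<pi> j' * (s + 1)) *\<^sub>R
        (b j' l * sg (\<pi> i' * (\<pi> j + \<pi> j')) *\<^sub>R (?X i j l * a j j' + sg (\<pi> l * (s + \<pi> j + \<pi> i')) *\<^sub>R ?Y i j j' l)))"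
      using jl by (simp add: U e sum_distrib_left scaleR_sum_right distrib_right)
    also have "\<dots> = (\<Sum>j<n+m. \<Sum>i<n+m. ?f i j j' l)"
      by (intro sum.cong refl) (simp only: distrib_left mult_scaleR_right scaleR_add_right scaleR_scaleR sg_mult add.assoc)
    finally show "sg (\<pi> j' * (s + 1)) *\<^sub>R (b j' l * U l j') = (\<Sum>j<n+m. \<Sum>i<n+m. ?f i j j' l)" .
  qed
  also have "\<dots> = (\<Sum>j<n+m. \<Sum>i<n+m. \<Sum>j'<n+m. \<Sum>l<n+m. ?f i j j' l)"
    by (rule trans[OF sum.cong[OF refl sum_swap3] sum_swap3])
  also have "\<dots> = (\<Sum>j<n+m. \<Sum>i<n+m. sg (\<pi> j * (s + 1)) *\<^sub>R ?X i j j + S i j * \<sigma> j * a i i')"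
  proof (intro sum.cong refl)
    fix j i assume "j \<in> {..<n+m}" "i \<in> {..<n+m}"
    then have ij: "j < n + m" "i < n + m" by auto
    have X: "has_parity (s + \<pi> j + \<pi> i' + \<pi> l) (?X i j l)" if l: "l < n + m" for l
    proof (intro has_parity_add has_parity_scaleR)
      show "has_parity (s + \<pi> j + \<pi> i' + \<pi> l) (dS l j i * a i i')"
        by (rule has_parity_eq[OF has_parity_mult[OF dS_par[OF l ij] a_par[OF ij(2) i']]]) auto
      show "has_parity (s + \<pi> j + \<pi> i' + \<pi> l) (S j i * da l i i')"
        by (rule has_parity_eq[OF has_parity_mult[OF S_par[OF ij] da_par[OF l ij(2) i']]]) auto
    qed
    show "(\<Sum>j'<n+m. \<Sum>l<n+m. ?f i j j' l) = sg (\<pi> j * (s + 1)) *\<^sub>R ?X i j j + S i j * \<sigma> j * a i i'"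
      unfolding sum.distrib
      by (rule arg_cong2[where f = "(+)"], rule contract_inverse[OF ij(1) i'], erule X,
          rule contract_second_derivative[OF ij(2,1) i'])
  qed
  also have "\<dots> = (\<Sum>j<n+m. \<Sum>i<n+m. sg (\<pi> j * (s + 1)) *\<^sub>R (dS j j i * a i i')) +
     (\<Sum>j<n+m. \<Sum>i<n+m. S i j * da j i i') + (\<Sum>j<n+m. \<Sum>i<n+m. S i j * \<sigma> j * a i i')"
  proof -
    have "sg (\<pi> j * (s + 1)) *\<^sub>R ?X i j j = sg (\<pi> j * (s + 1)) *\<^sub>R (dS j j i * a i i') + S i j * da j i i'"
      if "i < n + m" "j < n + m" for i j
    proof -
      have "sg (\<pi> j * (s + 1)) * (sg (\<pi> j * (s + \<pi> j + \<pi> i)) * sg (\<pi> j * \<pi> i)) = sg 0"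
        unfolding sg_mult by (rule sg_cong) auto
      then show ?thesis using S_sym[OF that(2,1)] by (simp add: scaleR_add_right)
    qed
    then show ?thesis by (simp add: sum.distrib)
  qed
  also have "(\<Sum>j<n+m. \<Sum>i<n+m. sg (\<pi> j * (s + 1)) *\<^sub>R (dS j j i * a i i')) = (\<Sum>i<n+m. divS i * a i i')"
    by (subst sum.swap) (simp add: divS_def sum_distrib_right)
  also have "(\<Sum>j<n+m. \<Sum>i<n+m. S i j * da j i i') = (\<Sum>i<n+m. \<Sum>j<n+m. S i j * da j i i')"
    by (rule sum.swap)
  also have "(\<Sum>j<n+m. \<Sum>i<n+m. S i j * \<sigma> j * a i i') = (\<Sum>i<n+m. \<Sum>j<n+m. S i j * \<sigma> j * a i i')"
    by (rule sum.swap)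
  finally show ?thesis .
qed

text \<open>The connection law contracted with S^{jk}; the sign of its quadratic term is the one in
  \<open>S'\<close>.\<close>

lemma contr_transform:
  assumes i': "i' < n + m"
  shows "(\<Sum>i<n+m. (\<Sum>j<n+m. \<Sum>k<n+m. S j k * \<Gamma> i k j) * a i i') =
    (\<Sum>j<n+m. \<Sum>k<n+m. S j k * da k j i') + (\<Sum>j'<n+m. \<Sum>k'<n+m. S' j' k' * \<Gamma>' i' k' j')"
proof -
  let ?t = "\<lambda>j k j' k'. sg (\<pi> k' * (\<pi> j + \<pi> j')) *\<^sub>R (S j k * a k k' * a j j' * \<Gamma>' i' k' j')"
  have "(\<Sum>i<n+m. (\<Sum>j<n+m. \<Sum>k<n+m. S j k * \<Gamma> i k j) * a i i') =
      (\<Sum>j<n+m. \<Sum>k<n+m. S j k * (\<Sum>i<n+m. \<Gamma> i k j * a i i'))"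
    unfolding sum_distrib_left sum_distrib_right mult.assoc
    by (rule sum_swap3)
  also have "\<dots> = (\<Sum>j<n+m. \<Sum>k<n+m. S j k * da k j i' + (\<Sum>k'<n+m. \<Sum>j'<n+m. ?t j k j' k'))"
    using i' by (intro sum.cong refl) (simp add: connection distrib_left sum_distrib_left mult.assoc)
  also have "\<dots> = (\<Sum>j<n+m. \<Sum>k<n+m. S j k * da k j i') +
      (\<Sum>j<n+m. \<Sum>k<n+m. \<Sum>k'<n+m. \<Sum>j'<n+m. ?t j k j' k')"
    by (simp add: sum.distrib)
  also have "(\<Sum>j<n+m. \<Sum>k<n+m. \<Sum>k'<n+m. \<Sum>j'<n+m. ?t j k j' k') =
      (\<Sum>j'<n+m. \<Sum>k'<n+m. \<Sum>j<n+m. \<Sum>k<n+m. ?t j k j' k')"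
  proof -
    have "(\<Sum>k<n+m. \<Sum>k'<n+m. \<Sum>j'<n+m. ?t j k j' k') = (\<Sum>k'<n+m. \<Sum>j'<n+m. \<Sum>k<n+m. ?t j k j' k')" for j
      by (rule sum_swap3)
    then have "(\<Sum>j<n+m. \<Sum>k<n+m. \<Sum>k'<n+m. \<Sum>j'<n+m. ?t j k j' k') =
        (\<Sum>j<n+m. \<Sum>k'<n+m. \<Sum>j'<n+m. \<Sum>k<n+m. ?t j k j' k')" by simp
    also have "\<dots> = (\<Sum>k'<n+m. \<Sum>j'<n+m. \<Sum>j<n+m. \<Sum>k<n+m. ?t j k j' k')"
      by (rule sum_swap3)
    also have "\<dots> = (\<Sum>j'<n+m. \<Sum>k'<n+m. \<Sum>j<n+m. \<Sum>k<n+m. ?t j k j' k')"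
      by (rule sum.swap)
    finally show ?thesis .
  qed
  also have "\<dots> = (\<Sum>j'<n+m. \<Sum>k'<n+m. S' j' k' * \<Gamma>' i' k' j')"
    by (simp add: S'_def sum_distrib_right)
  finally show ?thesis .
qed

lemma str_par: "j < n + m \<Longrightarrow> has_parity (\<pi> j) (str \<Gamma>' j)"
proof -
  assume j: "j < n + m"
  have "has_parity (\<pi> j) (\<Gamma>' i j i)" if "i < n + m" for i
    by (rule has_parity_eq[OF \<Gamma>'_par[OF that j that]]) auto
  then show ?thesis unfolding str_def by (auto intro!: has_parity_sum has_parity_scaleR)
qed

text \<open>The connection law is multiplied by b from the right and its supertrace is taken: the
  inhomogeneous term becomes \<sigma>_i, and in the quadratic one b moves next to a_t^{j'} and
  contracts with it.\<close>

lemma str_transform: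
  assumes i: "i < n + m"
  shows "str \<Gamma> i = \<sigma> i + (\<Sum>i'<n+m. a i i' * str \<Gamma>' i')"
proof -
  let ?t = "\<lambda>t i' j' k'. sg (\<pi> i' * (\<pi> t + \<pi> j')) *\<^sub>R (a i i' * a t j' * \<Gamma>' k' i' j')"
  have \<Gamma>: "\<Gamma> t i t = (\<Sum>k'<n+m. da i t k' * b k' t) +
      (\<Sum>k'<n+m. \<Sum>i'<n+m. \<Sum>j'<n+m. ?t t i' j' k' * b k' t)" if t: "t < n + m" for t
  proof -
    have "\<Gamma> t i t = (\<Sum>k<n+m. \<Gamma> k i t * (if k = t then 1 else 0))"
      using t by (simp add: sum_delta_mult)
    also have "\<dots> = (\<Sum>k<n+m. \<Gamma> k i t * (\<Sum>k'<n+m. a k k' * b k' t))"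
      using ab t by (intro sum.cong) auto
    also have "\<dots> = (\<Sum>k'<n+m. (\<Sum>k<n+m. \<Gamma> k i t * a k k') * b k' t)"
      unfolding sum_distrib_left sum_distrib_right mult.assoc by (rule sum.swap)
    also have "\<dots> = (\<Sum>k'<n+m. da i t k' * b k' t + (\<Sum>i'<n+m. \<Sum>j'<n+m. ?t t i' j' k' * b k' t))"
      using connection[OF i t] by (intro sum.cong refl) (simp add: distrib_right sum_distrib_right)
    finally show ?thesis by (simp add: sum.distrib)
  qed
  have "str \<Gamma> i = \<sigma> i + (\<Sum>t<n+m. \<Sum>k'<n+m. \<Sum>i'<n+m. \<Sum>j'<n+m. sg (\<pi> t) *\<^sub>R (?t t i' j' k' * b k' t))"
    by (simp add: str_def \<Gamma> \<sigma>_def scaleR_add_right sum.distrib scaleR_sum_right)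
  also have "(\<Sum>t<n+m. \<Sum>k'<n+m. \<Sum>i'<n+m. \<Sum>j'<n+m. sg (\<pi> t) *\<^sub>R (?t t i' j' k' * b k' t)) =
      (\<Sum>t<n+m. \<Sum>k'<n+m. \<Sum>i'<n+m. \<Sum>j'<n+m.
        sg (\<pi> i' * \<pi> j' + \<pi> k' * \<pi> i' + \<pi> k') *\<^sub>R (a i i' * (b k' t * a t j') * \<Gamma>' k' i' j'))"
  proof (intro sum.cong refl)
    fix t k' i' j' assume "t \<in> {..<n+m}" "k' \<in> {..<n+m}" "i' \<in> {..<n+m}" "j' \<in> {..<n+m}"
    then have lt: "t < n + m" "k' < n + m" "i' < n + m" "j' < n + m" by auto
    have "a t j' * \<Gamma>' k' i' j' * b k' t =
        sg (((\<pi> t + \<pi> j') + (\<pi> i' + \<pi> j' + \<pi> k')) * (\<pi> k' + \<pi> t)) *\<^sub>R (b k' t * (a t j' * \<Gamma>' k' i' j'))"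
      using lt by (intro mult_commute_sg b_par has_parity_mult \<Gamma>'_par a_par)
    moreover have "sg (\<pi> t) * (sg (\<pi> i' * (\<pi> t + \<pi> j')) *
        sg (((\<pi> t + \<pi> j') + (\<pi> i' + \<pi> j' + \<pi> k')) * (\<pi> k' + \<pi> t))) =
        sg (\<pi> i' * \<pi> j' + \<pi> k' * \<pi> i' + \<pi> k')"
      unfolding sg_mult by (rule sg_cong) auto
    ultimately show "sg (\<pi> t) *\<^sub>R (?t t i' j' k' * b k' t) =
        sg (\<pi> i' * \<pi> j' + \<pi> k' * \<pi> i' + \<pi> k') *\<^sub>R (a i i' * (b k' t * a t j') * \<Gamma>' k' i' j')"
      by (simp add: mult.assoc)
  qed
  also have "\<dots> = (\<Sum>k'<n+m. \<Sum>i'<n+m. \<Sum>j'<n+m. \<Sum>t<n+m.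
        sg (\<pi> i' * \<pi> j' + \<pi> k' * \<pi> i' + \<pi> k') *\<^sub>R (a i i' * (b k' t * a t j') * \<Gamma>' k' i' j'))"
    by (rule sum_swap4)
  also have "\<dots> = (\<Sum>k'<n+m. \<Sum>i'<n+m. \<Sum>j'<n+m.
        sg (\<pi> i' * \<pi> j' + \<pi> k' * \<pi> i' + \<pi> k') *\<^sub>R (a i i' * (\<Sum>t<n+m. b k' t * a t j') * \<Gamma>' k' i' j'))"
    by (simp add: sum_distrib_left sum_distrib_right scaleR_sum_right)
  also have "\<dots> = (\<Sum>k'<n+m. \<Sum>i'<n+m. sg (\<pi> k') *\<^sub>R (a i i' * \<Gamma>' k' i' k'))"
  proof (intro sum.cong refl)
    fix k' i' assume "k' \<in> {..<n+m}" "i' \<in> {..<n+m}"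
    then have k': "k' < n + m" by auto
    have "(\<Sum>j'<n+m. sg (\<pi> i' * \<pi> j' + \<pi> k' * \<pi> i' + \<pi> k') *\<^sub>R (a i i' * (\<Sum>t<n+m. b k' t * a t j') * \<Gamma>' k' i' j'))
        = (\<Sum>j'<n+m. (if k' = j' then 1 else 0) *
            (sg (\<pi> i' * \<pi> j' + \<pi> k' * \<pi> i' + \<pi> k') *\<^sub>R (a i i' * \<Gamma>' k' i' j')))"
      using ba[OF k'] by (intro sum.cong refl) simp
    also have "\<dots> = sg (\<pi> i' * \<pi> k' + \<pi> k' * \<pi> i' + \<pi> k') *\<^sub>R (a i i' * \<Gamma>' k' i' k')"
      by (rule sum_delta_mult(3)[OF k'])
    also have "sg (\<pi> i' * \<pi> k' + \<pi> k' * \<pi> i' + \<pi> k') = sg (\<pi> k')"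
      by (rule sg_cong) auto
    finally show "(\<Sum>j'<n+m. sg (\<pi> i' * \<pi> j' + \<pi> k' * \<pi> i' + \<pi> k') *\<^sub>R
        (a i i' * (\<Sum>t<n+m. b k' t * a t j') * \<Gamma>' k' i' j')) = sg (\<pi> k') *\<^sub>R (a i i' * \<Gamma>' k' i' k')" .
  qed
  also have "\<dots> = (\<Sum>i'<n+m. a i i' * str \<Gamma>' i')"
    by (subst sum.swap) (simp add: str_def sum_distrib_left)
  finally show ?thesis .
qed

text \<open>The sign in \<open>S'\<close> is used up by moving the trace of \<Gamma>' past a_i^{i'},
  so that it meets a_j^{j'} and \<open>str_transform\<close> applies.\<close>

lemma S_str_transform:
  assumes i': "i' < n + m"
  shows "(\<Sum>j'<n+m. S' i' j' * str \<Gamma>' j') = (\<Sum>i<n+m. \<Sum>j<n+m. S i j * (str \<Gamma> j - \<sigma> j) * a i i')"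
proof -
  have "(\<Sum>j'<n+m. S' i' j' * str \<Gamma>' j') =
      (\<Sum>j'<n+m. \<Sum>i<n+m. \<Sum>j<n+m. S i j * (a j j' * str \<Gamma>' j') * a i i')"
    unfolding S'_def sum_distrib_right
  proof (intro sum.cong refl)
    fix j' i j assume "j' \<in> {..<n+m}" "i \<in> {..<n+m}" "j \<in> {..<n+m}"
    then have lt: "j' < n + m" "i < n + m" "j < n + m" by auto
    have "a i i' * str \<Gamma>' j' = sg ((\<pi> i + \<pi> i') * \<pi> j') *\<^sub>R (str \<Gamma>' j' * a i i')"
      by (rule mult_commute_sg[OF a_par[OF lt(2) i'] str_par[OF lt(1)]])
    moreover have "sg (\<pi> j' * (\<pi> i + \<pi> i')) * sg ((\<pi> i + \<pi> i') * \<pi> j') = sg 0"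
      unfolding sg_mult by (rule sg_cong) auto
    ultimately show "sg (\<pi> j' * (\<pi> i + \<pi> i')) *\<^sub>R (S i j * a j j' * a i i') * str \<Gamma>' j' =
        S i j * (a j j' * str \<Gamma>' j') * a i i'"
      by (simp add: mult.assoc)
  qed
  also have "\<dots> = (\<Sum>i<n+m. \<Sum>j<n+m. \<Sum>j'<n+m. S i j * (a j j' * str \<Gamma>' j') * a i i')"
    by (rule sum_swap3)
  also have "\<dots> = (\<Sum>i<n+m. \<Sum>j<n+m. S i j * (\<Sum>j'<n+m. a j j' * str \<Gamma>' j') * a i i')"
    by (simp add: sum_distrib_left sum_distrib_right)
  also have "\<dots> = (\<Sum>i<n+m. \<Sum>j<n+m. S i j * (str \<Gamma> j - \<sigma> j) * a i i')"
    using str_transform by (intro sum.cong refl) (simp add: algebra_simps)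
  finally show ?thesis .
qed

end


subsection \<open>Polarization\<close>

definition gfree :: "nat \<Rightarrow> grassmann \<Rightarrow> bool" where
  "gfree k c \<longleftrightarrow> (\<forall>I. k \<in> I \<longrightarrow> gcoeff c I = 0)"

lemma gfree_mult: "gfree k a \<Longrightarrow> gfree k b \<Longrightarrow> gfree k (a * b)"
  unfolding gfree_def by (metis UnE gcoeff_mult_nonzeroE)

lemma gfree_ggen: "l \<noteq> k \<Longrightarrow> gfree k (ggen l)"
  by (auto simp: gfree_def gcoeff_ggen)

lemma gfree_gsupported: "gsupported m c \<Longrightarrow> m \<le> k \<Longrightarrow> gfree k c"
  unfolding gfree_def gsupported_def by (meson lessThan_iff not_less subsetD)

text \<open>At \<open>insert k I\<close> only the splitting into I and {k} contributes, so every
  coefficient of c reappears up to sign in the product.\<close>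

lemma gfree_cancel:
  assumes "gfree k c" "c * ggen k = 0"
  shows "c = 0"
proof (rule grassmann_eqI)
  fix I :: "nat set" assume I: "finite I"
  show "gcoeff c I = gcoeff 0 I"
  proof (cases "k \<in> I")
    case False
    have "0 = gcoeff (c * ggen k) (insert k I)" using assms(2) by simp
    also have "\<dots> = (\<Sum>J\<in>{I}. gsign J (insert k I - J) * gcoeff c J * gcoeff (ggen k) (insert k I - J))"
      unfolding gcoeff_mult
    proof (rule sum.mono_neutral_right)
      show "\<forall>J\<in>Pow (insert k I) - {I}. gsign J (insert k I - J) * gcoeff c J * gcoeff (ggen k) (insert k I - J) = 0"
      proof
        fix J assume J: "J \<in> Pow (insert k I) - {I}"
        show "gsign J (insert k I - J) * gcoeff c J * gcoeff (ggen k) (insert k I - J) = 0"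
        proof (cases "k \<in> J")
          case False
          have "insert k I - J \<noteq> {k}"
          proof
            assume "insert k I - J = {k}"
            then have "I \<subseteq> J" using \<open>k \<notin> I\<close> by (auto simp: set_eq_iff)
            with J False show False by auto
          qed
          then show ?thesis by (simp add: gcoeff_ggen)
        qed (use assms(1) in \<open>simp add: gfree_def\<close>)
      qed
    qed (use I in auto)
    also have "\<dots> = gsign I {k} * gcoeff c I"
      using False by (simp add: gcoeff_ggen insert_Diff_if)
    finally show ?thesis by (simp add: gsign_def)
  qed (use assms(1) in \<open>simp add: gfree_def\<close>)
qed

text \<open>The momenta are chosen to be \<open>1\<close> or one of the generators \<open>\<theta>\<^sub>m, \<theta>\<^bsub>m+1\<^esub>\<close>, which do not occur in \<open>C\<close>.\<close>

lemma polarization: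
  assumes supp: "\<And>i j. i < n + m \<Longrightarrow> j < n + m \<Longrightarrow> gsupported m (C i j)"
    and sym: "\<And>i j. i < n + m \<Longrightarrow> j < n + m \<Longrightarrow> C i j = sg (par n i * par n j) *\<^sub>R C j i"
    and zero: "\<And>p. (\<And>i. i < n + m \<Longrightarrow> has_parity (par n i) (p i)) \<Longrightarrow>
      (\<Sum>i<n+m. \<Sum>j<n+m. C i j * p j * p i) = 0"
    and ij: "i < n + m" "j < n + m"
  shows "C i j = 0"
proof -
  \<comment> \<open>For even k the momentum is concentrated at k with value 1; for odd k the
    symmetry assumption already says that the entry is its own negative.\<close>
  have diag: "C k k = 0" if k: "k < n + m" for k
  proof (cases "k < n")
    case True
    let ?p = "\<lambda>i. if i = k then 1 else 0"
    have "0 = (\<Sum>i<n+m. \<Sum>j<n+m. C i j * ?p j * ?p i)"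
      by (rule zero[symmetric]) (use True in \<open>auto simp: par_def\<close>)
    also have "\<dots> = (\<Sum>i<n+m. C i k * ?p i)"
      using k by (intro sum.cong refl) (simp add: sum_distrib_right[symmetric] sum_delta_mult)
    also have "\<dots> = C k k" using k by (simp add: sum_delta_mult)
    finally show ?thesis by simp
  next
    case False
    then have "C k k = - C k k" using sym[OF k k] by (simp add: par_def sg_def)
    then have "C k k + C k k = 0" by (simp only: eq_neg_iff_add_eq_0)
    then have "(2 :: real) *\<^sub>R C k k = 0" by (simp add: scaleR_2)
    then show ?thesis by simp
  qed
  show ?thesis
  proof (cases "i = j")
    case True
    with diag ij show ?thesis by simp
  next
    case ne: False
    \<comment> \<open>Two different generators are used, because for odd i and j the square of a
      single one would be zero.\<close>
    define u where "u = (if i < n then 1 else ggen m)"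
    define v where "v = (if j < n then 1 else ggen (m + 1))"
    have uv: "has_parity (par n i) u" "has_parity (par n j) v"
      using has_parity_ggen by (auto simp: u_def v_def par_def)
    let ?p = "\<lambda>k. if k = i then u else if k = j then v else 0"
    have "0 = (\<Sum>k<n+m. \<Sum>l<n+m. C k l * ?p l * ?p k)"
      by (rule zero[symmetric]) (use uv in auto)
    also have "\<dots> = (\<Sum>k\<in>{i, j}. \<Sum>l\<in>{i, j}. C k l * ?p l * ?p k)"
    proof -
      have "(\<Sum>l<n+m. C k l * ?p l * ?p k) = (\<Sum>l\<in>{i, j}. C k l * ?p l * ?p k)" for k
        by (rule sum.mono_neutral_right) (use ij in auto)
      moreover have "(\<Sum>k<n+m. \<Sum>l\<in>{i, j}. C k l * ?p l * ?p k) = (\<Sum>k\<in>{i, j}. \<Sum>l\<in>{i, j}. C k l * ?p l * ?p k)"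
        by (rule sum.mono_neutral_right) (use ij in auto)
      ultimately show ?thesis by simp
    qed
    also have "\<dots> = C i j * v * u + C j i * u * v"
      using ne diag ij by simp
    \<comment> \<open>The sign from the symmetry of C and the one from commuting u and v agree, so
      the two cross terms add up instead of cancelling.\<close>
    also have "C j i * u * v = C i j * v * u"
    proof -
      have "u * v = sg (par n i * par n j) *\<^sub>R (v * u)" by (rule mult_commute_sg[OF uv])
      moreover have "sg (par n j * par n i) * sg (par n i * par n j) = sg 0"
        unfolding sg_mult by (rule sg_cong) auto
      ultimately show ?thesis using sym[OF ij(2,1)] by (simp add: mult.assoc)
    qed
    finally have "(2 :: real) *\<^sub>R (C i j * v * u) = 0" by (simp add: scaleR_2)
    then have z: "C i j * v * u = 0" by simp
    have "C i j * v = 0"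
    proof (cases "i < n")
      case False
      have "gfree m (C i j * v)"
      proof (cases "j < n")
        case True
        then show ?thesis using gfree_gsupported[OF supp[OF ij], of m] by (simp add: v_def)
      next
        case False
        then show ?thesis
          using gfree_mult[OF gfree_gsupported[OF supp[OF ij], of m] gfree_ggen[of "m + 1" m]] by (simp add: v_def)
      qed
      from gfree_cancel[OF this] show ?thesis using z False by (simp add: u_def)
    qed (use z in \<open>simp add: u_def\<close>)
    then show ?thesis
      using gfree_cancel[OF gfree_gsupported[OF supp[OF ij], of "m + 1"]] by (auto simp: v_def split: if_splits)
  qed
qed


subsection \<open>Projective coefficients\<close>

definition contr_trace :: "nat \<Rightarrow> nat \<Rightarrow> (nat \<Rightarrow> nat \<Rightarrow> sfun) \<Rightarrow> (nat \<Rightarrow> nat \<Rightarrow> nat \<Rightarrow> sfun) \<Rightarrow> nat \<Rightarrow> sfun" where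
  "contr_trace n m S G i x = (\<Sum>j<n+m. S i j x * (\<Sum>k<n+m. sg (par n k) *\<^sub>R G k j k x))"

lemma div_S_sg: "div_S n m s S i x = (\<Sum>j<n+m. sg (par n j * (s + 1)) *\<^sub>R pd n j (S j i) x)"
  by (simp add: div_S_def sg_grassmann)

text \<open>Both trace terms of \<Pi> have the same contraction with S, the second one because the
  symmetry of S absorbs its sign; hence the factor 2.\<close>

lemma contr_SP_projective:
  assumes sym: "\<And>i j. i < n + m \<Longrightarrow> j < n + m \<Longrightarrow> S i j x = sg (par n i * par n j) *\<^sub>R S j i x"
    and P: "\<And>k j i. k < n + m \<Longrightarrow> j < n + m \<Longrightarrow> i < n + m \<Longrightarrow> P k j i x = projective_coeff n m G k j i x"
    and i: "i < n + m"
  shows "contr_SP n m S P i x = contr_SP n m S G i x - (2 / (real n - real m + 1)) *\<^sub>R contr_trace n m S G i x"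
proof -
  let ?c = "1 / (real n - real m + 1)"
  define t where "t j = (\<Sum>k<n+m. sg (par n k) *\<^sub>R G k j k x)" for j
  have e: "P i k j x = G i k j x - ?c *\<^sub>R ((if i = j then 1 else 0) * t k + (if i = k then 1 else 0) *
      (sg (par n j * par n k) *\<^sub>R t j))" if "j < n + m" "k < n + m" for j k
  proof -
    have 1: "(\<Sum>s<n+m. G s k s x * (if i = j then 1 else 0) * (- 1) ^ par n s) = (if i = j then 1 else 0) * t k"
      by (simp add: t_def sg_grassmann)
    have 2: "(\<Sum>s<n+m. G s j s x * (if i = k then 1 else 0) * (- 1) ^ (par n j * par n k + par n s)) =
        (if i = k then 1 else 0) * (sg (par n j * par n k) *\<^sub>R t j)"
      by (simp add: t_def sg_grassmann scaleR_sum_right sg_mult)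
    show ?thesis
      unfolding P[OF i that(2,1)] projective_coeff_def 1 2 ..
  qed
  have "contr_SP n m S P i x = (\<Sum>j<n+m. \<Sum>k<n+m. S j k x * G i k j x) -
      ?c *\<^sub>R ((\<Sum>j<n+m. \<Sum>k<n+m. S j k x * ((if i = j then 1 else 0) * t k)) +
        (\<Sum>j<n+m. \<Sum>k<n+m. S j k x * ((if i = k then 1 else 0) * (sg (par n j * par n k) *\<^sub>R t j))))"
    unfolding contr_SP_def
    by (simp add: e right_diff_distrib distrib_left sum_subtractf sum.distrib scaleR_sum_right scaleR_add_right)
  also have "(\<Sum>j<n+m. \<Sum>k<n+m. S j k x * ((if i = j then 1 else 0) * t k)) = contr_trace n m S G i x"
  proof -
    have "(\<Sum>j<n+m. \<Sum>k<n+m. S j k x * ((if i = j then 1 else 0) * t k)) =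
        (\<Sum>j<n+m. (if i = j then 1 else 0) * (\<Sum>k<n+m. S j k x * t k))"
      by (intro sum.cong refl) (simp add: sum_distrib_left)
    also have "\<dots> = (\<Sum>k<n+m. S i k x * t k)" by (rule sum_delta_mult(3)[OF i])
    finally show ?thesis by (simp add: contr_trace_def t_def)
  qed
  also have "(\<Sum>j<n+m. \<Sum>k<n+m. S j k x * ((if i = k then 1 else 0) * (sg (par n j * par n k) *\<^sub>R t j))) =
      contr_trace n m S G i x"
  proof -
    have "(\<Sum>k<n+m. S j k x * ((if i = k then 1 else 0) * (sg (par n j * par n k) *\<^sub>R t j))) = S i j x * t j"
      if j: "j < n + m" for j
    proof -
      have "(\<Sum>k<n+m. S j k x * ((if i = k then 1 else 0) * (sg (par n j * par n k) *\<^sub>R t j))) =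
          (\<Sum>k<n+m. (if i = k then 1 else 0) * (S j k x * (sg (par n j * par n k) *\<^sub>R t j)))"
        by (intro sum.cong refl) simp
      also have "\<dots> = S j i x * (sg (par n j * par n i) *\<^sub>R t j)" by (rule sum_delta_mult(3)[OF i])
      also have "\<dots> = S i j x * t j" using sym[OF i j] by (simp add: mult.commute)
      finally show ?thesis .
    qed
    then show ?thesis by (simp add: contr_trace_def t_def)
  qed
  finally show ?thesis by (simp add: contr_SP_def scaleR_add_right flip: scaleR_left.add)
qed


lemma superfunctions_div_S:
  assumes V: "openin (Euclidean_space n) V"
    and S: "\<And>i j. i < n + m \<Longrightarrow> j < n + m \<Longrightarrow> S i j \<in> superfunctions n m V"
    and i: "i < n + m"
  shows "div_S n m s S i \<in> superfunctions n m V"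
  unfolding div_S_sg[abs_def]
  by (intro superfunctions_sum[OF V] superfunctions_scaleR[OF V] superfunctions_pd[OF V] S i) auto

context
  fixes n m s :: nat and V :: "(nat \<Rightarrow> real) set" and S :: "nat \<Rightarrow> nat \<Rightarrow> sfun" and P :: "nat \<Rightarrow> nat \<Rightarrow> nat \<Rightarrow> sfun"
  assumes V: "openin (Euclidean_space n) V"
    and S: "\<And>i j. i < n + m \<Longrightarrow> j < n + m \<Longrightarrow> S i j \<in> superfunctions n m V"
    and P: "\<And>k i j. k < n + m \<Longrightarrow> i < n + m \<Longrightarrow> j < n + m \<Longrightarrow> P k i j \<in> superfunctions n m V"
begin

private lemmas cl = superfunctions_sum[OF V] superfunctions_mult[OF V] superfunctions_add[OF V]
  superfunctions_diff[OF V] superfunctions_scaleR[OF V] superfunctions_pd[OF V]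

lemma superfunctions_contr_SP: "i < n + m \<Longrightarrow> contr_SP n m S P i \<in> superfunctions n m V"
  unfolding contr_SP_def[abs_def] by (intro cl S P) auto

lemma superfunctions_proj_laplacian:
  "F \<in> superfunctions n m V \<Longrightarrow> proj_laplacian n m s S P F \<in> superfunctions n m V"
  unfolding proj_laplacian_def[abs_def] by (intro cl S superfunctions_div_S[OF V S] superfunctions_contr_SP) auto

lemma superfunctions_proj_gamma: "i < n + m \<Longrightarrow> proj_gamma n m s S P i \<in> superfunctions n m V"
  unfolding proj_gamma_def[abs_def] by (intro cl superfunctions_div_S[OF V S] superfunctions_contr_SP) auto

lemma has_parity_proj_gamma:
  assumes S_par: "\<And>i j x. i < n + m \<Longrightarrow> j < n + m \<Longrightarrow> x \<in> V \<Longrightarrow> has_parity (s + par n i + par n j) (S i j x)"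
    and P_par: "\<And>k i j x. k < n + m \<Longrightarrow> i < n + m \<Longrightarrow> j < n + m \<Longrightarrow> x \<in> V \<Longrightarrow>
      has_parity (par n i + par n j + par n k) (P k i j x)"
    and i: "i < n + m" and x: "x \<in> V"
  shows "has_parity (s + par n i) (proj_gamma n m s S P i x)"
proof -
  have "has_parity (s + par n i) (pd n j (S j i) x)" if "j < n + m" for j
    by (rule has_parity_eq[OF has_parity_pd[OF V S_par[OF that i] x]]) auto
  moreover have "has_parity (s + par n i) (S j k x * P i k j x)" if "j < n + m" "k < n + m" for j k
    by (rule has_parity_eq[OF has_parity_mult[OF S_par[OF that x] P_par[OF i that(2,1) x]]]) auto
  ultimately show ?thesis
    unfolding proj_gamma_def div_S_sg contr_SP_def
    by (intro has_parity_scaleR has_parity_add has_parity_sum) auto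
qed

end


subsection \<open>A change of coordinates\<close>

text \<open>The chain rule is an assumption in both directions, because
  \<open>chain_defect_eq_0\<close> yields it only over cubes. For charts it is supplied by
  \<open>pull_chain_rule\<close>.\<close>

locale coordinate_change =
  T: superdomain_morphism n m V' V T \<phi> + T': superdomain_morphism n m V V' T' \<phi>'
  for n m :: nat and V' V :: "(nat \<Rightarrow> real) set" and T T' :: "sfun \<Rightarrow> sfun" and \<phi> \<phi>' +
  assumes TT': "F \<in> superfunctions n m V \<Longrightarrow> x \<in> V \<Longrightarrow> T (T' F) x = F x"
    and T'T: "F \<in> superfunctions n m V' \<Longrightarrow> y \<in> V' \<Longrightarrow> T' (T F) y = F y"
    and chain_T: "F \<in> superfunctions n m V' \<Longrightarrow> x \<in> V \<Longrightarrow> T.chain_defect i x F = 0"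
    and chain_T': "F \<in> superfunctions n m V \<Longrightarrow> y \<in> V' \<Longrightarrow> T'.chain_defect i y F = 0"
begin

lemma chain_rule:
  "F \<in> superfunctions n m V' \<Longrightarrow> x \<in> V \<Longrightarrow> pd n i (T F) x = (\<Sum>j<n+m. T.J i j x * T (pd n j F) x)"
  using chain_T[of F x i] by (simp add: T.chain_defect_def)

text \<open>The inverse Jacobian \<partial>x^j/\<partial>x^{i'}, re-expressed in the coordinates
  x.\<close>

definition K :: "nat \<Rightarrow> nat \<Rightarrow> sfun" where
  "K i j = T (T'.J i j)"

lemma K_superfunction: "j < n + m \<Longrightarrow> K i j \<in> superfunctions n m V"
  unfolding K_def by (intro T.T_superfunction T'.J_superfunction)

lemma K_parity: "j < n + m \<Longrightarrow> x \<in> V \<Longrightarrow> has_parity (par n i + par n j) (K i j x)"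
  unfolding K_def by (intro T.T_parity T'.J_superfunction T'.J_parity)

lemma J_K:
  assumes "i < n + m" "j < n + m" "x \<in> V"
  shows "(\<Sum>k<n+m. T.J i k x * K k j x) = (if i = j then 1 else 0)"
proof -
  have c: "T' (coord n j) \<in> superfunctions n m V'"
    by (intro T'.T_superfunction superfunctions_coord assms)
  have "(\<Sum>k<n+m. T.J i k x * K k j x) = pd n i (T (T' (coord n j))) x"
    unfolding K_def T'.J_def using chain_rule[OF c assms(3), of i] by simp
  also have "\<dots> = pd n i (coord n j) x"
    using TT'[OF superfunctions_coord[OF assms(2)]] by (rule T.pd_T_cong[OF _ assms(3)])
  finally show ?thesis using pd_coord[OF assms(2)] by simp
qed

text \<open>The chain rule for T' applied to \<open>T (coord n j)\<close> gives this identity over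
  V' with the factors interchanged in role; applying T carries it to V. In \<open>J_K\<close> the
  chain rule for T is used directly.\<close>

lemma K_J:
  assumes "i < n + m" "j < n + m" "x \<in> V"
  shows "(\<Sum>k<n+m. K i k x * T.J k j x) = (if i = j then 1 else 0)"
proof -
  have c: "T (coord n j) \<in> superfunctions n m V"
    by (intro T.T_superfunction superfunctions_coord assms)
  have e: "(\<Sum>k<n+m. T'.J i k y * T' (T.J k j) y) = (if i = j then 1 else 0)" if y: "y \<in> V'" for y
  proof -
    have "(\<Sum>k<n+m. T'.J i k y * T' (T.J k j) y) = pd n i (T' (T (coord n j))) y"
      unfolding T.J_def using chain_T'[OF c y, of i] by (simp add: T'.chain_defect_def)
    also have "\<dots> = pd n i (coord n j) y"
      using T'T[OF superfunctions_coord[OF assms(2)]] by (rule T'.pd_T_cong[OF _ y])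
    finally show ?thesis using pd_coord[OF assms(2)] by simp
  qed
  have S: "(\<lambda>y. T'.J i k y * T' (T.J k j) y) \<in> superfunctions n m V'" if "k < n + m" for k
    using that assms by (intro superfunctions_mult[OF T.V'] T'.J_superfunction T'.T_superfunction T.J_superfunction)
  have "(\<Sum>k<n+m. K i k x * T.J k j x) = (\<Sum>k<n+m. T (\<lambda>y. T'.J i k y * T' (T.J k j) y) x)"
  proof (rule sum.cong)
    fix k assume "k \<in> {..<n+m}"
    then have k: "k < n + m" by simp
    have "T (\<lambda>y. T'.J i k y * T' (T.J k j) y) x = T (T'.J i k) x * T (T' (T.J k j)) x"
      using k assms by (intro T.T_mult T'.J_superfunction T'.T_superfunction T.J_superfunction)
    also have "T (T' (T.J k j)) x = T.J k j x"
      using assms by (intro TT' T.J_superfunction)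
    finally show "K i k x * T.J k j x = T (\<lambda>y. T'.J i k y * T' (T.J k j) y) x" by (simp add: K_def)
  qed simp
  also have "\<dots> = T (\<lambda>y. \<Sum>k<n+m. T'.J i k y * T' (T.J k j) y) x"
    using S assms(3) by (intro T.T_sum[symmetric]) auto
  also have "\<dots> = T (\<lambda>y. if i = j then 1 else 0) x"
    using S e assms(3) by (intro T.T_cong superfunctions_sum[OF T.V']) auto
  also have "\<dots> = (if i = j then 1 else 0)" using T.T_one T.T_zero assms(3) by simp
  finally show ?thesis .
qed

text \<open>The chain rule solved for the derivatives in the new coordinates, by means of K J =
  1.\<close>

lemma T_pd:
  assumes "F \<in> superfunctions n m V'" "j < n + m" "x \<in> V"
  shows "T (pd n j F) x = (\<Sum>l<n+m. K j l x * pd n l (T F) x)"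
proof -
  have "(\<Sum>l<n+m. K j l x * pd n l (T F) x) = (\<Sum>l<n+m. \<Sum>k<n+m. K j l x * T.J l k x * T (pd n k F) x)"
    by (simp add: chain_rule[OF assms(1,3)] sum_distrib_left mult.assoc)
  also have "\<dots> = (\<Sum>k<n+m. (\<Sum>l<n+m. K j l x * T.J l k x) * T (pd n k F) x)"
    by (subst sum.swap) (simp add: sum_distrib_right)
  also have "\<dots> = (\<Sum>k<n+m. (if j = k then 1 else 0) * T (pd n k F) x)"
    using K_J[OF assms(2) _ assms(3)] by (intro sum.cong refl) simp
  also have "\<dots> = T (pd n j F) x" by (rule sum_delta_mult(3)[OF assms(2)])
  finally show ?thesis by simp
qed

end

section \<open>Pullbacks of the tensor, the connection and the two expressions\<close>

locale geometry_change = coordinate_change +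
  fixes s :: nat and S S' :: "nat \<Rightarrow> nat \<Rightarrow> sfun" and G G' P P' :: "nat \<Rightarrow> nat \<Rightarrow> nat \<Rightarrow> sfun"
  assumes nm: "real n - real m + 1 \<noteq> 0" "real n - real m + 3 \<noteq> 0"
    and S: "\<And>i j. i < n + m \<Longrightarrow> j < n + m \<Longrightarrow> S i j \<in> superfunctions n m V"
    and S': "\<And>i j. i < n + m \<Longrightarrow> j < n + m \<Longrightarrow> S' i j \<in> superfunctions n m V'"
    and S_parity: "\<And>i j x. i < n + m \<Longrightarrow> j < n + m \<Longrightarrow> x \<in> V \<Longrightarrow> has_parity (s + par n i + par n j) (S i j x)"
    and S_symmetric: "\<And>i j x. i < n + m \<Longrightarrow> j < n + m \<Longrightarrow> x \<in> V \<Longrightarrow> S i j x = sg (par n i * par n j) *\<^sub>R S j i x"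
    and S'_symmetric: "\<And>i j y. i < n + m \<Longrightarrow> j < n + m \<Longrightarrow> y \<in> V' \<Longrightarrow> S' i j y = sg (par n i * par n j) *\<^sub>R S' j i y"
    and quadratic: "\<And>x p'. x \<in> V \<Longrightarrow> (\<And>i. i < n + m \<Longrightarrow> has_parity (par n i) (p' i)) \<Longrightarrow>
      (\<Sum>i<n+m. \<Sum>j<n+m. S i j x * (\<Sum>j'<n+m. T.J j j' x * p' j') * (\<Sum>i'<n+m. T.J i i' x * p' i')) =
      (\<Sum>i'<n+m. \<Sum>j'<n+m. T (S' i' j') x * p' j' * p' i')"
    and G': "\<And>k i j. k < n + m \<Longrightarrow> i < n + m \<Longrightarrow> j < n + m \<Longrightarrow> G' k i j \<in> superfunctions n m V'"
    and G'_parity: "\<And>k i j y. k < n + m \<Longrightarrow> i < n + m \<Longrightarrow> j < n + m \<Longrightarrow> y \<in> V' \<Longrightarrow>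
      has_parity (par n i + par n j + par n k) (G' k i j y)"
    and G_symmetric: "\<And>k i j x. k < n + m \<Longrightarrow> i < n + m \<Longrightarrow> j < n + m \<Longrightarrow> x \<in> V \<Longrightarrow>
      G k i j x = sg (par n i * par n j) *\<^sub>R G k j i x"
    and G'_symmetric: "\<And>k i j y. k < n + m \<Longrightarrow> i < n + m \<Longrightarrow> j < n + m \<Longrightarrow> y \<in> V' \<Longrightarrow>
      G' k i j y = sg (par n i * par n j) *\<^sub>R G' k j i y"
    and connection_law: "\<And>i j k' x. i < n + m \<Longrightarrow> j < n + m \<Longrightarrow> k' < n + m \<Longrightarrow> x \<in> V \<Longrightarrow>
      (\<Sum>k<n+m. G k i j x * T.J k k' x) = pd n i (T.J j k') x + (\<Sum>i'<n+m. \<Sum>j'<n+m.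
        sg (par n i' * (par n j + par n j')) *\<^sub>R (T.J i i' x * T.J j j' x * T (G' k' i' j') x))"
    and P: "\<And>k j i x. k < n + m \<Longrightarrow> j < n + m \<Longrightarrow> i < n + m \<Longrightarrow> x \<in> V \<Longrightarrow>
      P k j i x = projective_coeff n m G k j i x"
    and P': "\<And>k j i y. k < n + m \<Longrightarrow> j < n + m \<Longrightarrow> i < n + m \<Longrightarrow> y \<in> V' \<Longrightarrow>
      P' k j i y = projective_coeff n m G' k j i y"
begin

text \<open>The difference C of both sides has vanishing quadratic form by the invariance of S^{ij}
  p_j p_i, so polarization applies once the right-hand side is known to have the symmetry of S,
  which is \<open>R_sym\<close>.\<close>

lemma tensor_law:
  assumes i'j': "i' < n + m" "j' < n + m" and x: "x \<in> V"
  shows "T (S' i' j') x = (\<Sum>i<n+m. \<Sum>j<n+m. sg (par n j' * (par n i + par n i')) *\<^sub>R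
    (S i j x * T.J j j' x * T.J i i' x))"
proof -
  let ?R = "\<lambda>i' j'. \<Sum>i<n+m. \<Sum>j<n+m. sg (par n j' * (par n i + par n i')) *\<^sub>R
    (S i j x * T.J j j' x * T.J i i' x)"
  have R_sym: "?R i' j' = sg (par n i' * par n j') *\<^sub>R ?R j' i'" if "i' < n + m" "j' < n + m" for i' j'
  proof -
    have "?R i' j' = (\<Sum>i<n+m. \<Sum>j<n+m. sg (par n i' * par n j') *\<^sub>R sg (par n i' * (par n j + par n j')) *\<^sub>R
        (S j i x * T.J i i' x * T.J j j' x))"
    proof (intro sum.cong refl)
      fix i j assume "i \<in> {..<n+m}" "j \<in> {..<n+m}"
      then have ij: "i < n + m" "j < n + m" by auto
      have "T.J j j' x * T.J i i' x = sg ((par n j + par n j') * (par n i + par n i')) *\<^sub>R (T.J i i' x * T.J j j' x)"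
        using that x by (intro mult_commute_sg T.J_parity)
      moreover have "sg (par n j' * (par n i + par n i')) * (sg (par n i * par n j) *
          sg ((par n j + par n j') * (par n i + par n i'))) =
        sg (par n i' * par n j') * sg (par n i' * (par n j + par n j'))"
        unfolding sg_mult by (rule sg_cong) auto
      ultimately show "sg (par n j' * (par n i + par n i')) *\<^sub>R (S i j x * T.J j j' x * T.J i i' x) =
          sg (par n i' * par n j') *\<^sub>R sg (par n i' * (par n j + par n j')) *\<^sub>R (S j i x * T.J i i' x * T.J j j' x)"
        using S_symmetric[OF ij x] by (simp add: mult.assoc)
    qed
    also have "\<dots> = sg (par n i' * par n j') *\<^sub>R ?R j' i'"
      by (subst sum.swap) (simp add: scaleR_sum_right)
    finally show ?thesis .
  qed
  define C where "C i' j' = T (S' i' j') x - ?R i' j'" for i' j'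
  have "C i' j' = 0"
  proof (rule polarization[of n m C])
    fix i' j' assume ij: "i' < n + m" "j' < n + m"
    show "gsupported m (C i' j')"
      unfolding C_def
      by (intro gsupported_diff gsupported_sum gsupported_scaleR gsupported_mult
          superfunctions_gsupported[where n = n and V = V, OF _ x] T.T_superfunction S' S T.J_superfunction)
        (use ij in auto)
    have "T (S' i' j') x = T (\<lambda>y. sg (par n i' * par n j') *\<^sub>R S' j' i' y) x"
      by (rule T.T_cong[OF S'[OF ij] S'_symmetric[OF ij] x])
    then show "C i' j' = sg (par n i' * par n j') *\<^sub>R C j' i'"
      unfolding C_def R_sym[OF ij] using T.T_scaleR[OF S'[OF ij(2,1)] x] by (simp add: scaleR_diff_right)
  next
    fix p' assume p': "\<And>i. i < n + m \<Longrightarrow> has_parity (par n i) (p' i)"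
    have "(\<Sum>i'<n+m. \<Sum>j'<n+m. ?R i' j' * p' j' * p' i') =
        (\<Sum>i'<n+m. \<Sum>j'<n+m. \<Sum>i<n+m. \<Sum>j<n+m. S i j x * (T.J j j' x * p' j') * (T.J i i' x * p' i'))"
      unfolding sum_distrib_right
    proof (intro sum.cong refl)
      fix i' j' i j assume "i' \<in> {..<n+m}" "j' \<in> {..<n+m}" "i \<in> {..<n+m}" "j \<in> {..<n+m}"
      then have lt: "i' < n + m" "j' < n + m" "i < n + m" "j < n + m" by auto
      have "T.J i i' x * p' j' = sg ((par n i + par n i') * par n j') *\<^sub>R (p' j' * T.J i i' x)"
        using lt p' x by (intro mult_commute_sg T.J_parity)
      then have "T.J i i' x * (p' j' * z) = sg ((par n i + par n i') * par n j') *\<^sub>R (p' j' * (T.J i i' x * z))" for z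
        by (metis mult.assoc mult_scaleR_left)
      moreover have "sg (par n j' * (par n i + par n i')) * sg ((par n i + par n i') * par n j') = sg 0"
        unfolding sg_mult by (rule sg_cong) auto
      ultimately show "sg (par n j' * (par n i + par n i')) *\<^sub>R (S i j x * T.J j j' x * T.J i i' x) * p' j' * p' i' =
          S i j x * (T.J j j' x * p' j') * (T.J i i' x * p' i')"
        by (simp add: mult.assoc)
    qed
    also have "\<dots> = (\<Sum>i<n+m. \<Sum>j<n+m. \<Sum>i'<n+m. \<Sum>j'<n+m. S i j x * (T.J j j' x * p' j') * (T.J i i' x * p' i'))"
      by (rule trans[OF sum.cong[OF refl sum_swap3] sum_swap3])
    also have "\<dots> = (\<Sum>i<n+m. \<Sum>j<n+m. S i j x * (\<Sum>j'<n+m. T.J j j' x * p' j') * (\<Sum>i'<n+m. T.J i i' x * p' i'))"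
      by (simp add: sum_distrib_left sum_distrib_right)
    also have "\<dots> = (\<Sum>i'<n+m. \<Sum>j'<n+m. T (S' i' j') x * p' j' * p' i')"
      by (rule quadratic[OF x p'])
    finally show "(\<Sum>i'<n+m. \<Sum>j'<n+m. C i' j' * p' j' * p' i') = 0"
      by (simp add: C_def left_diff_distrib sum_subtractf)
  qed (use i'j' in auto)
  then show ?thesis by (simp add: C_def)
qed

lemma transition_algebra:
  assumes x: "x \<in> V"
  shows "transition_algebra n m s (\<lambda>i j. T.J i j x) (\<lambda>i j. K i j x) (\<lambda>i j. S i j x)
    (\<lambda>l i j. pd n l (T.J i j) x) (\<lambda>l i j. pd n l (S i j) x) (\<lambda>k i j. G k i j x) (\<lambda>k i j. T (G' k i j) x)"
proof
  fix i j k l assume lt: "i < n + m" "j < n + m" "k < n + m"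
  show "has_parity (par n i + par n j + par n k) (pd n k (T.J i j) x)"
    using lt by (intro has_parity_pd[OF T.V _ x] T.J_parity)
  show "has_parity (s + par n i + par n j + par n k) (pd n k (S i j) x)"
    using lt by (intro has_parity_pd[OF T.V _ x] S_parity)
  show "has_parity (par n i + par n j + par n k) (T (G' k i j) x)"
    using lt x by (intro T.T_parity G' G'_parity)
  have "T (G' k i j) x = T (\<lambda>y. sg (par n i * par n j) *\<^sub>R G' k j i y) x"
    by (rule T.T_cong[OF G'[OF lt(3,1,2)] G'_symmetric[OF lt(3,1,2)] x])
  then show "T (G' k i j) x = sg (par n i * par n j) *\<^sub>R T (G' k j i) x"
    using T.T_scaleR[OF G'[OF lt(3,2,1)] x] by simp
qed (rule T.J_parity K_parity S_parity J_K K_J S_symmetric G_symmetric connection_law; (assumption | rule x))+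

context
  fixes x
  assumes x: "x \<in> V"
begin

interpretation A: transition_algebra n m s "\<lambda>i j. T.J i j x" "\<lambda>i j. K i j x" "\<lambda>i j. S i j x"
  "\<lambda>l i j. pd n l (T.J i j) x" "\<lambda>l i j. pd n l (S i j) x" "\<lambda>k i j. G k i j x" "\<lambda>k i j. T (G' k i j) x"
  by (rule transition_algebra[OF x])

lemma A_S': "i' < n + m \<Longrightarrow> j' < n + m \<Longrightarrow> A.S' i' j' = T (S' i' j') x"
  using tensor_law[OF _ _ x] by (simp add: A.S'_def)

text \<open>\<open>T_pd\<close> turns the new derivatives into old ones, \<open>tensor_law\<close>
  may be differentiated since it holds on all of V, and what is left is the pointwise algebra of
  \<open>divS_transform\<close>.\<close>

lemma T_div_S:
  assumes i': "i' < n + m"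
  shows "T (div_S n m s S' i') x = (\<Sum>i<n+m. div_S n m s S i x * T.J i i' x) +
    (\<Sum>i<n+m. \<Sum>j<n+m. S i j x * pd n j (T.J i i') x) + (\<Sum>i<n+m. \<Sum>j<n+m. S i j x * A.\<sigma> j * T.J i i' x)"
proof -
  have pS: "pd n j (S' j i') \<in> superfunctions n m V'" if "j < n + m" for j
    using that i' by (intro superfunctions_pd[OF T.V'] S')
  have "T (div_S n m s S' i') x = T (\<lambda>y. \<Sum>j<n+m. sg (par n j * (s + 1)) *\<^sub>R pd n j (S' j i') y) x"
    unfolding div_S_sg[abs_def] ..
  also have "\<dots> = (\<Sum>j<n+m. sg (par n j * (s + 1)) *\<^sub>R T (pd n j (S' j i')) x)"
    using pS x by (subst T.T_sum) (auto intro!: superfunctions_scaleR[OF T.V'] T.T_scaleR sum.cong)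
  also have "\<dots> = (\<Sum>j<n+m. sg (par n j * (s + 1)) *\<^sub>R (\<Sum>l<n+m. K j l x * pd n l (T (S' j i')) x))"
    using i' x S' by (intro sum.cong refl) (simp add: T_pd)
  also have "\<dots> = (\<Sum>i<n+m. A.divS i * T.J i i' x) +
    (\<Sum>i<n+m. \<Sum>j<n+m. S i j x * pd n j (T.J i i') x) + (\<Sum>i<n+m. \<Sum>j<n+m. S i j x * A.\<sigma> j * T.J i i' x)"
  proof (rule A.divS_transform[OF i'])
    fix l j' assume l: "l < n + m" and j': "j' < n + m"
    have "pd n l (T (S' j' i')) x = pd n l (\<lambda>x. \<Sum>j<n+m. \<Sum>i<n+m. sg (par n i' * (par n j + par n j')) *\<^sub>R
        (S j i x * T.J i i' x * T.J j j' x)) x"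
      using tensor_law[OF j' i'] by (rule T.pd_T_cong[OF _ x])
    also have "\<dots> = (\<Sum>j<n+m. \<Sum>i<n+m. sg (par n i' * (par n j + par n j')) *\<^sub>R
      ((pd n l (S j i) x * T.J i i' x + sg (par n l * (s + par n j + par n i)) *\<^sub>R (S j i x * pd n l (T.J i i') x)) *
          T.J j j' x + sg (par n l * (s + par n j + par n i + (par n i + par n i'))) *\<^sub>R
        (S j i x * T.J i i' x * pd n l (T.J j j') x)))"
      unfolding sg_def using i' j' x
      by (intro pd_eqI has_pd_sum has_pd_scaleR has_pd_mult has_parity_mult S_parity T.J_parity
          has_pd_superfunction[where V = V and m = m] S T.J_superfunction) auto
    finally show "pd n l (T (S' j' i')) x = (\<Sum>j<n+m. \<Sum>i<n+m. sg (par n i' * (par n j + par n j')) *\<^sub>R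
      (pd n l (S j i) x * T.J i i' x * T.J j j' x +
       sg (par n l * (s + par n j + par n i)) *\<^sub>R (S j i x * pd n l (T.J i i') x * T.J j j' x) +
       sg (par n l * (s + par n j + par n i + (par n i + par n i'))) *\<^sub>R (S j i x * T.J i i' x * pd n l (T.J j j') x)))"
      by (simp add: distrib_right)
  qed
  finally show ?thesis by (simp only: A.divS_def div_S_sg)
qed

lemma T_contr_SP:
  assumes i': "i' < n + m"
  shows "T (contr_SP n m S' G' i') x = (\<Sum>i<n+m. contr_SP n m S G i x * T.J i i' x) -
    (\<Sum>i<n+m. \<Sum>j<n+m. S i j x * pd n j (T.J i i') x)"
proof -
  have SG: "(\<lambda>y. S' j k y * G' i' k j y) \<in> superfunctions n m V'" if "j < n + m" "k < n + m" for j k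
    using that i' by (intro superfunctions_mult[OF T.V'] S' G')
  have "T (contr_SP n m S' G' i') x = (\<Sum>j<n+m. T (\<lambda>y. \<Sum>k<n+m. S' j k y * G' i' k j y) x)"
    unfolding contr_SP_def[abs_def] using SG x by (intro T.T_sum superfunctions_sum[OF T.V']) auto
  also have "\<dots> = (\<Sum>j<n+m. \<Sum>k<n+m. T (\<lambda>y. S' j k y * G' i' k j y) x)"
    using SG x by (intro sum.cong refl T.T_sum) auto
  also have "\<dots> = (\<Sum>j<n+m. \<Sum>k<n+m. A.S' j k * T (G' i' k j) x)"
    using i' x by (intro sum.cong refl) (simp add: A_S' T.T_mult S' G')
  also have "\<dots> = (\<Sum>i<n+m. (\<Sum>j<n+m. \<Sum>k<n+m. S j k x * G i k j x) * T.J i i' x) -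
    (\<Sum>j<n+m. \<Sum>k<n+m. S j k x * pd n k (T.J j i') x)"
    using A.contr_transform[OF i'] by simp
  finally show ?thesis by (simp add: contr_SP_def)
qed

lemma T_contr_trace:
  assumes i': "i' < n + m"
  shows "T (contr_trace n m S' G' i') x = (\<Sum>i<n+m. contr_trace n m S G i x * T.J i i' x) -
    (\<Sum>i<n+m. \<Sum>j<n+m. S i j x * A.\<sigma> j * T.J i i' x)"
proof -
  have Gs: "(\<lambda>y. sg (par n k) *\<^sub>R G' k j k y) \<in> superfunctions n m V'" if "j < n + m" "k < n + m" for j k
    using that by (intro superfunctions_scaleR[OF T.V'] G')
  have tr: "(\<lambda>y. \<Sum>k<n+m. sg (par n k) *\<^sub>R G' k j k y) \<in> superfunctions n m V'" if "j < n + m" for j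
    using that Gs by (intro superfunctions_sum[OF T.V']) auto
  have "T (contr_trace n m S' G' i') x = (\<Sum>j<n+m. T (\<lambda>y. S' i' j y * (\<Sum>k<n+m. sg (par n k) *\<^sub>R G' k j k y)) x)"
    unfolding contr_trace_def[abs_def] using i' x
    by (intro T.T_sum superfunctions_mult[OF T.V'] S' tr) auto
  also have "\<dots> = (\<Sum>j<n+m. A.S' i' j * A.str (\<lambda>k i j. T (G' k i j) x) j)"
  proof (intro sum.cong refl)
    fix j assume "j \<in> {..<n+m}"
    then have j: "j < n + m" by simp
    have "T (\<lambda>y. \<Sum>k<n+m. sg (par n k) *\<^sub>R G' k j k y) x = A.str (\<lambda>k i j. T (G' k i j) x) j"
      unfolding A.str_def using Gs[OF j] x j
      by (subst T.T_sum) (auto intro!: sum.cong T.T_scaleR G')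
    then show "T (\<lambda>y. S' i' j y * (\<Sum>k<n+m. sg (par n k) *\<^sub>R G' k j k y)) x =
        A.S' i' j * A.str (\<lambda>k i j. T (G' k i j) x) j"
      using j i' x by (simp add: T.T_mult S' tr A_S')
  qed
  also have "\<dots> = (\<Sum>i<n+m. \<Sum>j<n+m. S i j x * (A.str (\<lambda>k i j. G k i j x) j - A.\<sigma> j) * T.J i i' x)"
    by (rule A.S_str_transform[OF i'])
  finally show ?thesis
    by (simp add: contr_trace_def A.str_def right_diff_distrib left_diff_distrib sum_subtractf sum_distrib_right)
qed

lemma \<sigma>_log_berezinian:
  "A.\<sigma> j = pd n j (\<lambda>y. gln m (gabs (berezinian n m (\<lambda>i k. T.J i k y)))) x"
proof -
  have "pd n j (\<lambda>y. gln m (gabs (berezinian n m (\<lambda>i k. T.J i k y)))) x =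
    (\<Sum>s<n+m. ((- 1) ^ par n s :: real) *\<^sub>R (\<Sum>k<n+m. pd n j (T.J s k) x * K k s x))"
    by (rule pd_log_berezinian[OF T.V _ _ _ _ _ _ x];
        rule T.J_superfunction K_superfunction T.J_parity K_parity J_K K_J; assumption)
  then show ?thesis by (simp add: A.\<sigma>_def sg_def)
qed

text \<open>The chain rule is used twice. Where the outer derivative hits the Jacobian, the
  inhomogeneous term appears; otherwise, interchanging the two Jacobian factors changes the sign
  from j to j', which is the one in the law for S.\<close>

lemma second_derivatives:
  assumes F: "F \<in> superfunctions n m V'"
  shows "(\<Sum>i<n+m. \<Sum>j<n+m. S i j x * pd n j (pd n i (T F)) x) =
    (\<Sum>i'<n+m. (\<Sum>i<n+m. \<Sum>j<n+m. S i j x * pd n j (T.J i i') x) * T (pd n i' F) x) +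
    (\<Sum>i'<n+m. \<Sum>j'<n+m. T (S' i' j') x * T (pd n j' (pd n i' F)) x)"
proof -
  have pF: "pd n i F \<in> superfunctions n m V'" for i
    by (rule superfunctions_pd[OF T.V' F])
  have pp: "pd n j (pd n i (T F)) x = (\<Sum>i'<n+m. pd n j (T.J i i') x * T (pd n i' F) x +
      sg (par n j * (par n i + par n i')) *\<^sub>R (T.J i i' x * (\<Sum>j'<n+m. T.J j j' x * T (pd n j' (pd n i' F)) x)))"
    if ij: "i < n + m" "j < n + m" for i j
  proof -
    have "pd n j (pd n i (T F)) x = pd n j (\<lambda>x. \<Sum>i'<n+m. T.J i i' x * T (pd n i' F) x) x"
      by (rule pd_cong[OF T.V x chain_rule[OF F]])
    also have "\<dots> = (\<Sum>i'<n+m. pd n j (T.J i i') x * T (pd n i' F) x +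
      sg (par n j * (par n i + par n i')) *\<^sub>R (T.J i i' x * pd n j (T (pd n i' F)) x))"
      unfolding sg_def using x ij
      by (intro pd_eqI has_pd_sum has_pd_mult T.J_parity T.has_pd_T pF
          has_pd_superfunction[where V = V and m = m] T.J_superfunction) auto
    finally show ?thesis by (simp add: chain_rule[OF pF x])
  qed
  have "(\<Sum>i<n+m. \<Sum>j<n+m. S i j x * pd n j (pd n i (T F)) x) =
    (\<Sum>i<n+m. \<Sum>j<n+m. \<Sum>i'<n+m. S i j x * pd n j (T.J i i') x * T (pd n i' F) x) +
    (\<Sum>i<n+m. \<Sum>j<n+m. \<Sum>i'<n+m. \<Sum>j'<n+m. sg (par n j' * (par n i + par n i')) *\<^sub>R
       (S i j x * T.J j j' x * T.J i i' x) * T (pd n j' (pd n i' F)) x)"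
    unfolding sum.distrib[symmetric]
  proof (intro sum.cong refl)
    fix i j assume "i \<in> {..<n+m}" "j \<in> {..<n+m}"
    then have ij: "i < n + m" "j < n + m" by auto
    have "sg (par n j * (par n i + par n i')) *\<^sub>R (T.J i i' x * (T.J j j' x * z)) =
        sg (par n j' * (par n i + par n i')) *\<^sub>R (T.J j j' x * T.J i i' x * z)"
      if "i' < n + m" "j' < n + m" for i' j' z
    proof -
      have "T.J i i' x * T.J j j' x = sg ((par n i + par n i') * (par n j + par n j')) *\<^sub>R (T.J j j' x * T.J i i' x)"
        using that x by (intro mult_commute_sg T.J_parity)
      moreover have "sg (par n j * (par n i + par n i')) * sg ((par n i + par n i') * (par n j + par n j')) =
          sg (par n j' * (par n i + par n i'))"
        unfolding sg_mult by (rule sg_cong) auto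
      ultimately show ?thesis by (simp add: mult.assoc[symmetric])
    qed
    then have "S i j x * sg (par n j * (par n i + par n i')) *\<^sub>R (T.J i i' x *
          (\<Sum>j'<n+m. T.J j j' x * T (pd n j' (pd n i' F)) x)) =
        (\<Sum>j'<n+m. sg (par n j' * (par n i + par n i')) *\<^sub>R (S i j x * T.J j j' x * T.J i i' x) *
          T (pd n j' (pd n i' F)) x)" if "i' < n + m" for i'
      using that by (simp only: sum_distrib_left scaleR_sum_right) (auto intro!: sum.cong simp: mult.assoc)
    then show "S i j x * pd n j (pd n i (T F)) x = (\<Sum>i'<n+m. S i j x * pd n j (T.J i i') x * T (pd n i' F) x +
       (\<Sum>j'<n+m. sg (par n j' * (par n i + par n i')) *\<^sub>R
         (S i j x * T.J j j' x * T.J i i' x) * T (pd n j' (pd n i' F)) x))"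
      unfolding pp[OF ij] sum_distrib_left distrib_left by (intro sum.cong refl) (simp add: mult.assoc)
  qed
  also have "(\<Sum>i<n+m. \<Sum>j<n+m. \<Sum>i'<n+m. S i j x * pd n j (T.J i i') x * T (pd n i' F) x) =
      (\<Sum>i'<n+m. (\<Sum>i<n+m. \<Sum>j<n+m. S i j x * pd n j (T.J i i') x) * T (pd n i' F) x)"
    by (simp only: sum_distrib_right) (rule sum_swap3[symmetric])
  also have "(\<Sum>i<n+m. \<Sum>j<n+m. \<Sum>i'<n+m. \<Sum>j'<n+m. sg (par n j' * (par n i + par n i')) *\<^sub>R
       (S i j x * T.J j j' x * T.J i i' x) * T (pd n j' (pd n i' F)) x) =
      (\<Sum>i'<n+m. \<Sum>j'<n+m. A.S' i' j' * T (pd n j' (pd n i' F)) x)"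
    by (simp only: A.S'_def sum_distrib_right) (rule trans[OF sum.cong[OF refl sum_swap3] sum_swap3])
  also have "\<dots> = (\<Sum>i'<n+m. \<Sum>j'<n+m. T (S' i' j') x * T (pd n j' (pd n i' F)) x)"
    using A_S' by (intro sum.cong refl) auto
  finally show ?thesis .
qed

end

lemma contr_trace_superfunction: "i < n + m \<Longrightarrow> contr_trace n m S' G' i \<in> superfunctions n m V'"
  unfolding contr_trace_def[abs_def]
  by (intro superfunctions_sum[OF T.V'] superfunctions_mult[OF T.V'] superfunctions_scaleR[OF T.V'] S' G') auto

abbreviation "\<kappa> \<equiv> (real n - real m + 1) / (real n - real m + 3)"
abbreviation "\<mu> \<equiv> 2 / (real n - real m + 3)"

text \<open>The first identity makes the surviving inhomogeneous terms add up to exactly one copy;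
  the second one rescales the trace correction of \<Pi>.\<close>

lemma \<kappa>_\<mu>: "\<kappa> + \<mu> = 1" "\<kappa> * (2 / (real n - real m + 1)) = \<mu>"
proof -
  \<comment> \<open>To be read with a = n - m + 1.\<close>
  have "a / (a + 2) + 2 / (a + 2) = 1" "a / (a + 2) * (2 / a) = 2 / (a + 2)" if "a \<noteq> 0" "a + 2 \<noteq> 0" for a :: real
    using that by (simp_all flip: add_divide_distrib)
  from this[of "real n - real m + 1"] nm show "\<kappa> + \<mu> = 1" "\<kappa> * (2 / (real n - real m + 1)) = \<mu>"
    by (simp_all add: add.assoc)
qed

lemma contr_SP_P:
  assumes "i < n + m" "x \<in> V"
  shows "\<kappa> *\<^sub>R contr_SP n m S P i x = \<kappa> *\<^sub>R contr_SP n m S G i x - \<mu> *\<^sub>R contr_trace n m S G i x"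
proof -
  have "contr_SP n m S P i x = contr_SP n m S G i x - (2 / (real n - real m + 1)) *\<^sub>R contr_trace n m S G i x"
    by (rule contr_SP_projective[where S = S and x = x and P = P and G = G and i = i,
          OF S_symmetric[OF _ _ assms(2)] P[OF _ _ _ assms(2)] assms(1)])
  then show ?thesis by (simp only: scaleR_diff_right scaleR_scaleR \<kappa>_\<mu>(2))
qed

lemma contr_SP_P':
  assumes "i < n + m" "y \<in> V'"
  shows "\<kappa> *\<^sub>R contr_SP n m S' P' i y = \<kappa> *\<^sub>R contr_SP n m S' G' i y - \<mu> *\<^sub>R contr_trace n m S' G' i y"
proof -
  have "contr_SP n m S' P' i y = contr_SP n m S' G' i y - (2 / (real n - real m + 1)) *\<^sub>R contr_trace n m S' G' i y"
    by (rule contr_SP_projective[where S = S' and x = y and P = P' and G = G' and i = i,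
          OF S'_symmetric[OF _ _ assms(2)] P'[OF _ _ _ assms(2)] assms(1)])
  then show ?thesis by (simp only: scaleR_diff_right scaleR_scaleR \<kappa>_\<mu>(2))
qed

lemma scaleR_unit: "\<kappa> *\<^sub>R z + \<mu> *\<^sub>R z = z" for z :: grassmann
  using \<kappa>_\<mu>(1) by (simp flip: scaleR_left_distrib)

theorem proj_gamma_transform:
  assumes i': "i' < n + m" and x: "x \<in> V"
  shows "T (proj_gamma n m s S' P' i') x = (\<Sum>i<n+m. (proj_gamma n m s S P i x +
    (\<Sum>j<n+m. S i j x * pd n j (\<lambda>y. gln m (gabs (berezinian n m (\<lambda>i k. T.J i k y)))) x)) * T.J i i' x)"
proof -
  note sup = superfunctions_div_S[OF T.V' S' i'] superfunctions_contr_SP[OF T.V' S' G' i'] contr_trace_superfunction[OF i']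
  \<comment> \<open>The coefficient with \<Pi> replaced by the representative \<Gamma> and its
    trace, since the transformation laws are available for these.\<close>
  let ?g = "\<lambda>y. \<kappa> *\<^sub>R (div_S n m s S' i' y + contr_SP n m S' G' i' y) - \<mu> *\<^sub>R contr_trace n m S' G' i' y"
  have g: "?g \<in> superfunctions n m V'"
    by (intro superfunctions_diff[OF T.V'] superfunctions_scaleR[OF T.V'] superfunctions_add[OF T.V'] sup)
  have "T (proj_gamma n m s S' P' i') x = T ?g x"
    by (rule T.T_cong[OF g _ x, symmetric]) (simp add: proj_gamma_def scaleR_add_right contr_SP_P'[OF i'])
  also have "\<dots> = \<kappa> *\<^sub>R (T (div_S n m s S' i') x + T (contr_SP n m S' G' i') x) - \<mu> *\<^sub>R T (contr_trace n m S' G' i') x"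
    using sup x by (simp add: T.T_diff T.T_scaleR T.T_add superfunctions_scaleR[OF T.V'] superfunctions_add[OF T.V'])
  also have "\<dots> = (\<Sum>i<n+m. proj_gamma n m s S P i x * T.J i i' x) +
      (\<Sum>i<n+m. \<Sum>j<n+m. S i j x * pd n j (\<lambda>y. gln m (gabs (berezinian n m (\<lambda>i k. T.J i k y)))) x * T.J i i' x)"
    (is "_ = ?A + ?B")
  proof -
    have "?A = \<kappa> *\<^sub>R (\<Sum>i<n+m. div_S n m s S i x * T.J i i' x) + \<kappa> *\<^sub>R (\<Sum>i<n+m. contr_SP n m S G i x * T.J i i' x) -
        \<mu> *\<^sub>R (\<Sum>i<n+m. contr_trace n m S G i x * T.J i i' x)"
      by (simp add: proj_gamma_def scaleR_add_right contr_SP_P[OF _ x] distrib_right left_diff_distrib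
          sum.distrib sum_subtractf scaleR_sum_right)
    then show ?thesis
      unfolding T_div_S[OF x i'] T_contr_SP[OF x i'] T_contr_trace[OF x i'] \<sigma>_log_berezinian[OF x]
      \<comment> \<open>The second derivatives of x' cancel between divergence and contraction; the
        \<sigma>-term occurs with weight \<kappa> from the divergence and \<mu> from the
        trace.\<close>
      using scaleR_unit[of ?B] by (simp add: scaleR_add_right scaleR_diff_right algebra_simps)
  qed
  finally show ?thesis by (simp add: distrib_right sum.distrib sum_distrib_right)
qed

theorem proj_laplacian_transform:
  assumes F: "F \<in> superfunctions n m V'" and x: "x \<in> V"
  shows "T (proj_laplacian n m s S' P' F) x = proj_laplacian n m s S P (T F) x"
proof -
  note sup = superfunctions_div_S[OF T.V' S'] superfunctions_contr_SP[OF T.V' S' G'] contr_trace_superfunction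
  note cl = superfunctions_sum[OF T.V'] superfunctions_mult[OF T.V'] superfunctions_add[OF T.V']
    superfunctions_diff[OF T.V'] superfunctions_scaleR[OF T.V'] superfunctions_pd[OF T.V']
  let ?c = "\<lambda>i y. \<mu> *\<^sub>R div_S n m s S' i y - (\<kappa> *\<^sub>R contr_SP n m S' G' i y - \<mu> *\<^sub>R contr_trace n m S' G' i y)"
  let ?D = "\<lambda>i'. \<Sum>i<n+m. \<Sum>j<n+m. S i j x * pd n j (T.J i i') x"
  let ?e = "\<lambda>i. \<mu> *\<^sub>R div_S n m s S i x - \<kappa> *\<^sub>R contr_SP n m S P i x"
  have c: "?c i \<in> superfunctions n m V'" if "i < n + m" for i
    by (intro cl sup that)
  have f2: "(\<lambda>y. \<Sum>i<n+m. \<Sum>j<n+m. S' i j y * pd n j (pd n i F) y) \<in> superfunctions n m V'"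
    by (intro cl S' F) auto
  have f1: "(\<lambda>y. \<Sum>i<n+m. ?c i y * pd n i F y) \<in> superfunctions n m V'"
    by (intro superfunctions_sum[OF T.V'] superfunctions_mult[OF T.V'] c superfunctions_pd[OF T.V'] F) auto
  have Tc: "T (?c i') x = (\<Sum>i<n+m. ?e i * T.J i i' x) + ?D i'" if i': "i' < n + m" for i'
  proof -
    \<comment> \<open>D is the term with second derivatives of x', z the one with \<sigma>. The two
      copies of z cancel, while D is collected with weight \<mu> + \<kappa> = 1.\<close>
    have alg: "\<mu> *\<^sub>R (d + D + z) - (\<kappa> *\<^sub>R (c - D) - \<mu> *\<^sub>R (t - z)) = (\<mu> *\<^sub>R d - (\<kappa> *\<^sub>R c - \<mu> *\<^sub>R t)) + D"
      for d D z c t :: grassmann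
      using scaleR_unit[of D] by (simp add: algebra_simps)
    have "T (?c i') x = \<mu> *\<^sub>R T (div_S n m s S' i') x - (\<kappa> *\<^sub>R T (contr_SP n m S' G' i') x -
        \<mu> *\<^sub>R T (contr_trace n m S' G' i') x)"
      using sup i' x by (simp add: T.T_diff T.T_scaleR superfunctions_scaleR[OF T.V'] superfunctions_diff[OF T.V'])
    also have "\<dots> = (\<mu> *\<^sub>R (\<Sum>i<n+m. div_S n m s S i x * T.J i i' x) -
        (\<kappa> *\<^sub>R (\<Sum>i<n+m. contr_SP n m S G i x * T.J i i' x) - \<mu> *\<^sub>R (\<Sum>i<n+m. contr_trace n m S G i x * T.J i i' x))) + ?D i'"
      unfolding T_div_S[OF x i'] T_contr_SP[OF x i'] T_contr_trace[OF x i'] by (rule alg)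
    also have "\<mu> *\<^sub>R (\<Sum>i<n+m. div_S n m s S i x * T.J i i' x) -
        (\<kappa> *\<^sub>R (\<Sum>i<n+m. contr_SP n m S G i x * T.J i i' x) - \<mu> *\<^sub>R (\<Sum>i<n+m. contr_trace n m S G i x * T.J i i' x)) =
        (\<Sum>i<n+m. ?e i * T.J i i' x)"
      by (simp add: contr_SP_P[OF _ x] left_diff_distrib sum_subtractf scaleR_sum_right)
    finally show ?thesis .
  qed
  have "T (proj_laplacian n m s S' P' F) x =
      T (\<lambda>y. (\<Sum>i<n+m. \<Sum>j<n+m. S' i j y * pd n j (pd n i F) y) + (\<Sum>i<n+m. ?c i y * pd n i F y)) x"
    by (rule T.T_cong[symmetric, OF superfunctions_add[OF T.V' f2 f1] _ x])
      (simp add: proj_laplacian_def contr_SP_P')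
  also have "\<dots> = (\<Sum>i<n+m. \<Sum>j<n+m. T (S' i j) x * T (pd n j (pd n i F)) x) + (\<Sum>i<n+m. T (?c i) x * T (pd n i F) x)"
  proof -
    have 2: "T (\<lambda>y. \<Sum>i<n+m. \<Sum>j<n+m. S' i j y * pd n j (pd n i F) y) x =
        (\<Sum>i<n+m. \<Sum>j<n+m. T (\<lambda>y. S' i j y * pd n j (pd n i F) y) x)"
      using x by (subst T.T_sum) (auto intro!: cl S' F sum.cong T.T_sum)
    have 1: "T (\<lambda>y. \<Sum>i<n+m. ?c i y * pd n i F y) x = (\<Sum>i<n+m. T (\<lambda>y. ?c i y * pd n i F y) x)"
      using x c by (intro T.T_sum superfunctions_mult[OF T.V'] superfunctions_pd[OF T.V'] F) auto
    have "T (\<lambda>y. S' i j y * pd n j (pd n i F) y) x = T (S' i j) x * T (pd n j (pd n i F)) x"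
      if "i < n + m" "j < n + m" for i j
      using that x by (intro T.T_mult S' superfunctions_pd[OF T.V'] F)
    moreover have "T (\<lambda>y. ?c i y * pd n i F y) x = T (?c i) x * T (pd n i F) x" if "i < n + m" for i
      using that x by (intro T.T_mult c superfunctions_pd[OF T.V'] F)
    ultimately show ?thesis
      unfolding T.T_add[OF f2 f1 x] 1 2 by simp
  qed
  also have "(\<Sum>i'<n+m. T (?c i') x * T (pd n i' F) x) =
      (\<Sum>i'<n+m. (\<Sum>i<n+m. ?e i * T.J i i' x) * T (pd n i' F) x) + (\<Sum>i'<n+m. ?D i' * T (pd n i' F) x)"
    unfolding sum.distrib[symmetric] by (intro sum.cong refl) (simp only: lessThan_iff Tc distrib_right)
  also have "(\<Sum>i'<n+m. (\<Sum>i<n+m. ?e i * T.J i i' x) * T (pd n i' F) x) = (\<Sum>i<n+m. ?e i * pd n i (T F) x)"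
  proof -
    have "(\<Sum>i'<n+m. (\<Sum>i<n+m. ?e i * T.J i i' x) * T (pd n i' F) x) =
        (\<Sum>i<n+m. \<Sum>i'<n+m. ?e i * (T.J i i' x * T (pd n i' F) x))"
      unfolding sum_distrib_right mult.assoc by (rule sum.swap)
    then show ?thesis by (simp only: chain_rule[OF F x] sum_distrib_left)
  qed
  finally show ?thesis
    unfolding proj_laplacian_def second_derivatives[OF x F] by (simp only: add_ac)
qed

end


subsection \<open>Charts of a supermanifold\<close>

context
  fixes n m :: nat and M :: "('p, 'c) smfd"
  assumes M: "supermanifold n m M"
begin

private lemma chart:
  assumes "c \<in> charts M"
  shows "openin (base M) (cdom M c)" "openin (Euclidean_space n) (cmap M c ` cdom M c)"
    "homeomorphic_map (subtopology (base M) (cdom M c))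
      (subtopology (Euclidean_space n) (cmap M c ` cdom M c)) (cmap M c)"
proof -
  have "\<forall>c\<in>charts M. openin (base M) (cdom M c) \<and>
      openin (Euclidean_space n) (cmap M c ` cdom M c) \<and>
      homeomorphic_map (subtopology (base M) (cdom M c))
        (subtopology (Euclidean_space n) (cmap M c ` cdom M c)) (cmap M c)"
    using M unfolding supermanifold_def by (elim conjE)
  from bspec[OF this assms] show "openin (base M) (cdom M c)" "openin (Euclidean_space n) (cmap M c ` cdom M c)"
    "homeomorphic_map (subtopology (base M) (cdom M c))
      (subtopology (Euclidean_space n) (cmap M c ` cdom M c)) (cmap M c)"
    by blast+
qed

lemma cmap_inj: "c \<in> charts M \<Longrightarrow> inj_on (cmap M c) (cdom M c)"
  using homeomorphic_imp_injective_map[OF chart(3)] openin_subset[OF chart(1)]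
  by (simp add: topspace_subtopology inf_absorb2)

private lemma openin_cmap_iff:
  assumes c: "c \<in> charts M" and W: "W \<subseteq> cdom M c"
  shows "openin (Euclidean_space n) (cmap M c ` W) \<longleftrightarrow> openin (base M) W"
proof -
  have "W \<subseteq> topspace (subtopology (base M) (cdom M c))"
    using W openin_subset[OF chart(1)[OF c]] by auto
  from homeomorphic_map_openness[OF chart(3)[OF c] this] show ?thesis
    using W chart(1,2)[OF c] by (auto simp: openin_open_subtopology)
qed

private lemma openin_cmap_image:
  "c \<in> charts M \<Longrightarrow> openin (base M) W \<Longrightarrow> W \<subseteq> cdom M c \<Longrightarrow> openin (Euclidean_space n) (cmap M c ` W)"
  by (simp add: openin_cmap_iff)

lemma overlap_open: "c \<in> charts M \<Longrightarrow> d \<in> charts M \<Longrightarrow> openin (base M) (cdom M c \<inter> cdom M d)"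
  by (intro openin_Int chart)

context
  fixes c d W
  assumes c: "c \<in> charts M" and d: "d \<in> charts M"
    and W: "openin (base M) W" "W \<subseteq> cdom M c \<inter> cdom M d"
begin

private lemma pull_axioms:
  "superalgebra_hom n m (cmap M d ` W) (cmap M c ` W) (pull M c d W) \<and>
    (\<forall>F \<in> superfunctions n m (cmap M d ` W). \<forall>p\<in>W.
      gbody (pull M c d W F (cmap M c p)) = gbody (F (cmap M d p)) \<and>
      (\<forall>W'. openin (base M) W' \<and> W' \<subseteq> W \<and> p \<in> W' \<longrightarrow>
        pull M c d W' F (cmap M c p) = pull M c d W F (cmap M c p)))"
proof -
  have "\<forall>c\<in>charts M. \<forall>d\<in>charts M. \<forall>W. openin (base M) W \<and> W \<subseteq> cdom M c \<inter> cdom M d \<longrightarrow>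
      superalgebra_hom n m (cmap M d ` W) (cmap M c ` W) (pull M c d W) \<and>
      (\<forall>F \<in> superfunctions n m (cmap M d ` W). \<forall>p\<in>W.
        gbody (pull M c d W F (cmap M c p)) = gbody (F (cmap M d p)) \<and>
        (\<forall>W'. openin (base M) W' \<and> W' \<subseteq> W \<and> p \<in> W' \<longrightarrow>
          pull M c d W' F (cmap M c p) = pull M c d W F (cmap M c p)))"
    using M unfolding supermanifold_def by (elim conjE)
  from mp[OF spec[OF bspec[OF bspec[OF this c] d]] conjI[OF W]] show ?thesis .
qed

lemma pull_restrict:
  assumes "F \<in> superfunctions n m (cmap M d ` W)" "openin (base M) W'" "W' \<subseteq> W" "x \<in> cmap M c ` W'"
  shows "pull M c d W' F x = pull M c d W F x"
proof -
  obtain p where "x = cmap M c p" "p \<in> W'" using assms(4) by auto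
  with pull_axioms assms(1-3) show ?thesis by blast
qed

text \<open>The cocycle condition for the charts c, d, c together with the condition that
  \<open>pull M c c\<close> is the identity.\<close>

lemma pull_inverse:
  assumes F: "F \<in> superfunctions n m (cmap M c ` W)" and p: "p \<in> W"
  shows "pull M c d W (pull M d c W F) (cmap M c p) = F (cmap M c p)"
proof -
  have "\<forall>c\<in>charts M. \<forall>d\<in>charts M. \<forall>e\<in>charts M. \<forall>W.
      openin (base M) W \<and> W \<subseteq> cdom M c \<inter> cdom M d \<inter> cdom M e \<longrightarrow>
      (\<forall>F \<in> superfunctions n m (cmap M e ` W). \<forall>p\<in>W.
        pull M c d W (pull M d e W F) (cmap M c p) = pull M c e W F (cmap M c p))"
    using M unfolding supermanifold_def by (elim conjE)
  from mp[OF spec[OF bspec[OF bspec[OF bspec[OF this c] d] c]], of W] W F p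
  have "pull M c d W (pull M d c W F) (cmap M c p) = pull M c c W F (cmap M c p)" by auto
  moreover have "\<forall>c\<in>charts M. \<forall>W. openin (base M) W \<and> W \<subseteq> cdom M c \<longrightarrow>
      (\<forall>F \<in> superfunctions n m (cmap M c ` W). \<forall>p\<in>W. pull M c c W F (cmap M c p) = F (cmap M c p))"
    using M unfolding supermanifold_def by (elim conjE)
  from mp[OF spec[OF bspec[OF this c]], of W] W F p have "pull M c c W F (cmap M c p) = F (cmap M c p)" by auto
  ultimately show ?thesis by simp
qed

definition transition :: "(nat \<Rightarrow> real) \<Rightarrow> nat \<Rightarrow> real" where
  "transition x = cmap M d (inv_into (cdom M c) (cmap M c) x)"

lemma transition_cmap: "p \<in> cdom M c \<Longrightarrow> transition (cmap M c p) = cmap M d p"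
  using cmap_inj[OF c] by (simp add: transition_def)

lemma pull_morphism: "superdomain_morphism n m (cmap M d ` W) (cmap M c ` W) (pull M c d W) transition"
proof
  show "openin (Euclidean_space n) (cmap M d ` W)" "openin (Euclidean_space n) (cmap M c ` W)"
    using c d W by (auto intro: openin_cmap_image)
  show "superalgebra_hom n m (cmap M d ` W) (cmap M c ` W) (pull M c d W)" using pull_axioms by blast
  fix x assume "x \<in> cmap M c ` W"
  then obtain p where p: "x = cmap M c p" "p \<in> W" by auto
  with W have t: "transition x = cmap M d p" using transition_cmap by auto
  with p show "transition x \<in> cmap M d ` W" by auto
  show "gbody (pull M c d W F x) = gbody (F (transition x))" if "F \<in> superfunctions n m (cmap M d ` W)" for F
    using pull_axioms that p t by simp
qed

end

text \<open>The overlap is shrunk to the preimage W' of a cube around the image of p. There the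
  defect vanishes, and it is the same as over W because pullbacks are compatible with restriction
  and derivatives are local.\<close>

lemma pull_chain_rule:
  assumes c: "c \<in> charts M" and d: "d \<in> charts M"
    and W: "openin (base M) W" "W \<subseteq> cdom M c \<inter> cdom M d"
    and F: "F \<in> superfunctions n m (cmap M d ` W)" and x: "x \<in> cmap M c ` W"
  shows "superdomain_morphism.chain_defect n m (pull M c d W) i x F = 0"
proof -
  obtain p where p: "x = cmap M c p" "p \<in> W" using x by auto
  have Vd: "openin (Euclidean_space n) (cmap M d ` W)"
    using d W by (auto intro: openin_cmap_image)
  obtain e where e: "e > 0" "cmap M d p \<in> cube n (cmap M d p) e" "cube n (cmap M d p) e \<subseteq> cmap M d ` W"
    using cube_subset[OF Vd, of "cmap M d p"] p(2) by blast
  define W' where "W' = {q \<in> W. cmap M d q \<in> cube n (cmap M d p) e}"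
  have im: "cmap M d ` W' = cube n (cmap M d p) e" using e(3) by (auto simp: W'_def)
  have W'W: "W' \<subseteq> W" by (auto simp: W'_def)
  have pW': "p \<in> W'" using p e by (simp add: W'_def)
  have W': "openin (base M) W'" "W' \<subseteq> cdom M c \<inter> cdom M d"
    using openin_cmap_iff[OF d, of W'] W W'W openin_cube im by auto
  interpret T: superdomain_morphism n m "cmap M d ` W" "cmap M c ` W" "pull M c d W" "transition c d"
    by (rule pull_morphism[OF c d W])
  interpret T': superdomain_morphism n m "cmap M d ` W'" "cmap M c ` W'" "pull M c d W'" "transition c d"
    by (rule pull_morphism[OF c d W'])
  have x': "x \<in> cmap M c ` W'" using p(1) pW' by auto
  have sub: "superfunctions n m (cmap M d ` W) \<subseteq> superfunctions n m (cmap M d ` W')"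
    using superfunctions_subset W'W by blast
  have eq: "pull M c d W' H y = pull M c d W H y" if "H \<in> superfunctions n m (cmap M d ` W)" "y \<in> cmap M c ` W'" for H y
    by (rule pull_restrict[OF c d W that(1) W'(1) W'W that(2)])
  have "T'.chain_defect i x F = 0"
    by (rule T'.chain_defect_eq_0[OF im x']) (use F sub p(1) pW' W' transition_cmap[OF c d W] in auto)
  moreover have "T'.chain_defect i x F = T.chain_defect i x F"
  proof -
    have "pd n i (pull M c d W' H) x = pd n i (pull M c d W H) x" if "H \<in> superfunctions n m (cmap M d ` W)" for H
      by (rule pd_cong[OF T'.V x' eq[OF that]])
    moreover have "pull M c d W' (pd n j F) x = pull M c d W (pd n j F) x" for j
      by (rule eq[OF superfunctions_pd[OF Vd F] x'])
    ultimately show ?thesis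
      using F by (simp add: T.chain_defect_def T'.chain_defect_def T.J_def T'.J_def superfunctions_coord)
  qed
  ultimately show ?thesis by simp
qed

lemma pull_coordinate_change:
  assumes c: "c \<in> charts M" and d: "d \<in> charts M"
    and W: "openin (base M) W" "W \<subseteq> cdom M c \<inter> cdom M d"
  shows "coordinate_change n m (cmap M d ` W) (cmap M c ` W) (pull M c d W) (pull M d c W)
    (transition c d) (transition d c)"
proof -
  have W2: "W \<subseteq> cdom M d \<inter> cdom M c" using W by auto
  interpret T: superdomain_morphism n m "cmap M d ` W" "cmap M c ` W" "pull M c d W" "transition c d"
    by (rule pull_morphism[OF c d W])
  interpret T': superdomain_morphism n m "cmap M c ` W" "cmap M d ` W" "pull M d c W" "transition d c"
    by (rule pull_morphism[OF d c W(1) W2])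
  show ?thesis
    by unfold_locales
      (use pull_inverse[OF c d W] pull_inverse[OF d c W(1) W2] pull_chain_rule[OF c d W]
        pull_chain_rule[OF d c W(1) W2] in blast)+
qed

end

section \<open>From one change of coordinates to the supermanifold\<close>

lemma proj_laplacian_cong:
  assumes V: "openin (Euclidean_space n) V" "x \<in> V" and FG: "\<And>y. y \<in> V \<Longrightarrow> F y = G y"
  shows "proj_laplacian n m s S P F x = proj_laplacian n m s S P G x"
proof -
  have "pd n i F y = pd n i G y" if "y \<in> V" for i y by (rule pd_cong[OF V(1) that FG])
  moreover from this have "pd n j (pd n i F) x = pd n j (pd n i G) x" for i j by (rule pd_cong[OF V])
  ultimately show ?thesis using V(2) by (simp add: proj_laplacian_def)
qed

lemma superfunctions_projective_coeff:
  assumes V: "openin (Euclidean_space n) V"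
    and G: "\<And>k i j. k < n + m \<Longrightarrow> i < n + m \<Longrightarrow> j < n + m \<Longrightarrow> G k i j \<in> superfunctions n m V"
    and kij: "k < n + m" "j < n + m" "i < n + m"
  shows "projective_coeff n m G k j i \<in> superfunctions n m V"
proof -
  have g: "(\<lambda>x. G t l t x * (if b then 1 else 0) * (- 1) ^ e) \<in> superfunctions n m V"
    if "t < n + m" "l < n + m" for t l b e
    using G[OF that(1,2,1)] that by (cases b) (auto simp: sg_grassmann superfunctions_scaleR[OF V] superfunctions_zero)
  show ?thesis
    unfolding projective_coeff_def[abs_def]
    by (intro superfunctions_diff[OF V] superfunctions_scaleR[OF V] superfunctions_add[OF V]
        superfunctions_sum[OF V] g G kij) auto
qed

lemma has_parity_projective_coeff:
  assumes G: "\<And>k i j. k < n + m \<Longrightarrow> i < n + m \<Longrightarrow> j < n + m \<Longrightarrow> has_parity (par n i + par n j + par n k) (G k i j x)"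
    and kij: "k < n + m" "j < n + m" "i < n + m"
  shows "has_parity (par n j + par n i + par n k) (projective_coeff n m G k j i x)"
proof -
  have g: "has_parity (par n j + par n i + par n k) (G t l t x * (if b then 1 else 0) * (- 1) ^ e)"
    if "t < n + m" "l < n + m" "b \<Longrightarrow> even (par n l) = even (par n j + par n i + par n k)" for t l b e
  proof (cases b)
    case True
    have "has_parity (par n j + par n i + par n k) (G t l t x)"
      by (rule has_parity_eq[OF G[OF that(1,2,1)]]) (use that(3)[OF True] in auto)
    with True show ?thesis by (simp add: sg_grassmann has_parity_scaleR)
  qed simp
  show ?thesis
    unfolding projective_coeff_def
    by (intro has_parity_diff has_parity_scaleR has_parity_add has_parity_sum g has_parity_eq[OF G[OF kij]] kij) auto
qed

theorem theorem3p2: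
  fixes n m s :: nat
    and M :: "('p, 'c) smfd"
    and P :: "'c \<Rightarrow> nat \<Rightarrow> nat \<Rightarrow> nat \<Rightarrow> sfun"
    and S :: "'c \<Rightarrow> nat \<Rightarrow> nat \<Rightarrow> sfun"
  assumes "supermanifold n m M"
    and "int n - int m \<notin> {- 1, - 3}"
    and "projective_class n m M P"
    and "s \<in> {0, 1}"
    and "symmetric_tensor n m s M S"
  shows "(\<forall>c\<in>charts M. \<forall>d\<in>charts M. \<forall>W. openin (base M) W \<and> W \<subseteq> cdom M c \<inter> cdom M d \<longrightarrow>
            (\<forall>F \<in> superfunctions n m (cmap M d ` W). \<forall>p\<in>W.
              pull M c d W (proj_laplacian n m s (S d) (P d) F) (cmap M c p) =
              proj_laplacian n m s (S c) (P c) (pull M c d W F) (cmap M c p))) \<and>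
         (\<forall>W f. openin (base M) W \<and> f \<in> sections n m M W \<longrightarrow>
            (\<lambda>c. proj_laplacian n m s (S c) (P c) (f c)) \<in> sections n m M W)
       \<and> upper_connection_coeffs n m s M S (\<lambda>c. proj_gamma n m s (S c) (P c))"
proof -
  note M = assms(1)
  obtain \<Gamma> where conn: "symmetric_connection n m M \<Gamma>"
    and P\<Gamma>: "\<And>c k j i x. c \<in> charts M \<Longrightarrow> k < n + m \<Longrightarrow> j < n + m \<Longrightarrow> i < n + m \<Longrightarrow> x \<in> cmap M c ` cdom M c \<Longrightarrow>
      P c k j i x = projective_coeff n m (\<Gamma> c) k j i x"
    using assms(3) unfolding projective_class_def by blast
  have nm: "real n - real m + 1 \<noteq> 0" "real n - real m + 3 \<noteq> 0"
    using assms(2) by auto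
  have S: "S c i j \<in> superfunctions n m (cmap M c ` cdom M c)"
      "x \<in> cmap M c ` cdom M c \<Longrightarrow> has_parity (s + par n i + par n j) (S c i j x)"
      "x \<in> cmap M c ` cdom M c \<Longrightarrow> S c i j x = sg (par n i * par n j) *\<^sub>R S c j i x"
    if "c \<in> charts M" "i < n + m" "j < n + m" for c i j x
    using assms(5) that unfolding symmetric_tensor_def sg_grassmann by blast+
  have quad: "(\<Sum>i<n+m. \<Sum>j<n+m. S c i j x * (\<Sum>j'<n+m. jac n M c d j j' x * p' j') * (\<Sum>i'<n+m. jac n M c d i i' x * p' i')) =
      (\<Sum>i'<n+m. \<Sum>j'<n+m. pullback M c d (S d i' j') x * p' j' * p' i')"
    if "c \<in> charts M" "d \<in> charts M" "x \<in> cmap M c ` (cdom M c \<inter> cdom M d)"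
      "\<And>i. i < n + m \<Longrightarrow> has_parity (par n i) (p' i)" for c d x p'
    using assms(5) that unfolding symmetric_tensor_def Let_def by blast
  have \<Gamma>: "\<Gamma> c k i j \<in> superfunctions n m (cmap M c ` cdom M c)"
      "x \<in> cmap M c ` cdom M c \<Longrightarrow> has_parity (par n i + par n j + par n k) (\<Gamma> c k i j x)"
      "x \<in> cmap M c ` cdom M c \<Longrightarrow> \<Gamma> c k i j x = sg (par n i * par n j) *\<^sub>R \<Gamma> c k j i x"
    if "c \<in> charts M" "k < n + m" "i < n + m" "j < n + m" for c k i j x
    using conn that unfolding symmetric_connection_def sg_grassmann by blast+
  have law: "(\<Sum>k<n+m. \<Gamma> c k i j x * jac n M c d k k' x) = pd n i (jac n M c d j k') x +
      (\<Sum>i'<n+m. \<Sum>j'<n+m. sg (par n i' * (par n j + par n j')) *\<^sub>R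
        (jac n M c d i i' x * jac n M c d j j' x * pullback M c d (\<Gamma> d k' i' j') x))"
    if "c \<in> charts M" "d \<in> charts M" "x \<in> cmap M c ` (cdom M c \<inter> cdom M d)" "i < n + m" "j < n + m" "k' < n + m"
    for c d x i j k'
    using conn that unfolding symmetric_connection_def sg_grassmann mult_scaleR_left by blast
  \<comment> \<open>Read off from the coordinate change of c with itself.\<close>
  have Vc: "openin (Euclidean_space n) (cmap M c ` W)"
    if "c \<in> charts M" "openin (base M) W" "W \<subseteq> cdom M c" for c W
    using superdomain_morphism.V[OF pull_morphism[OF M that(1,1,2)]] that(3) by simp
  have cdom: "openin (base M) (cdom M c)" if "c \<in> charts M" for c
    using overlap_open[OF M that that] by simp
  have PS: "P c k j i \<in> superfunctions n m (cmap M c ` cdom M c)"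
    if "c \<in> charts M" "k < n + m" "j < n + m" "i < n + m" for c k j i
    by (rule superfunctions_cong[OF Vc[OF that(1) cdom[OF that(1)] order_refl]
          superfunctions_projective_coeff[OF Vc[OF that(1) cdom[OF that(1)] order_refl] \<Gamma>(1)[OF that(1)] that(2-4)]])
      (auto simp: P\<Gamma> that)
  have geometry: "geometry_change n m (cmap M d ` W) (cmap M c ` W) (pull M c d W) (pull M d c W)
      (transition M c d) (transition M d c) s (S c) (S d) (\<Gamma> c) (\<Gamma> d) (P c) (P d)"
    and jac_eq: "\<And>i j x. j < n + m \<Longrightarrow> x \<in> cmap M c ` W \<Longrightarrow>
      superdomain_morphism.J n (pull M c d W) i j x = jac n M c d i j x"
    if c: "c \<in> charts M" and d: "d \<in> charts M" and W: "openin (base M) W" "W \<subseteq> cdom M c \<inter> cdom M d" for c d W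
  proof -
    interpret coordinate_change n m "cmap M d ` W" "cmap M c ` W" "pull M c d W" "pull M d c W"
      "transition M c d" "transition M d c"
      by (rule pull_coordinate_change[OF M c d W])
    have res: "pull M c d W F x = pullback M c d F x"
      if "F \<in> superfunctions n m (cmap M d ` (cdom M c \<inter> cdom M d))" "x \<in> cmap M c ` W" for F x
      by (rule pull_restrict[OF M c d overlap_open[OF M c d] order_refl that(1) W that(2)])
    \<comment> \<open>\<open>jac\<close> is computed from the pullback over the full overlap,
      \<open>T.J\<close> from the one over W; they agree on an open set, hence so do their
      derivatives.\<close>
    have J: "T.J i j x = jac n M c d i j x" if "j < n + m" "x \<in> cmap M c ` W" for i j x
      unfolding T.J_def jac_def
      by (rule pd_cong[OF T.V that(2) res]) (use that in \<open>auto intro: superfunctions_coord\<close>)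
    show "superdomain_morphism.J n (pull M c d W) i j x = jac n M c d i j x"
      if "j < n + m" "x \<in> cmap M c ` W" for i j x
      using J[OF that] .
    have sub: "cmap M c ` W \<subseteq> cmap M c ` cdom M c" "cmap M d ` W \<subseteq> cmap M d ` cdom M d"
      "cmap M c ` W \<subseteq> cmap M c ` (cdom M c \<inter> cdom M d)"
      "cmap M d ` (cdom M c \<inter> cdom M d) \<subseteq> cmap M d ` cdom M d"
      using W(2) by auto
    show "geometry_change n m (cmap M d ` W) (cmap M c ` W) (pull M c d W) (pull M d c W)
      (transition M c d) (transition M d c) s (S c) (S d) (\<Gamma> c) (\<Gamma> d) (P c) (P d)"
    proof
      fix i j k x y
      assume ij: "i < n + m" "j < n + m"
      show "S c i j \<in> superfunctions n m (cmap M c ` W)" "S d i j \<in> superfunctions n m (cmap M d ` W)"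
        using superfunctions_subset[OF S(1)[OF c ij] sub(1)] superfunctions_subset[OF S(1)[OF d ij] sub(2)] by auto
      show "has_parity (s + par n i + par n j) (S c i j x)" "S c i j x = sg (par n i * par n j) *\<^sub>R S c j i x"
        if "x \<in> cmap M c ` W"
        using S(2,3)[OF c ij, of x] sub(1) that by blast+
      show "S d i j y = sg (par n i * par n j) *\<^sub>R S d j i y" if "y \<in> cmap M d ` W"
        using S(3)[OF d ij, of y] sub(2) that by blast
    next
      fix k i j x y
      assume kij: "k < n + m" "i < n + m" "j < n + m"
      show "\<Gamma> d k i j \<in> superfunctions n m (cmap M d ` W)"
        by (rule superfunctions_subset[OF \<Gamma>(1)[OF d kij] sub(2)])
      show "\<Gamma> c k i j x = sg (par n i * par n j) *\<^sub>R \<Gamma> c k j i x" if "x \<in> cmap M c ` W"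
        using \<Gamma>(3)[OF c kij, of x] sub(1) that by blast
      show "has_parity (par n i + par n j + par n k) (\<Gamma> d k i j y)"
        "\<Gamma> d k i j y = sg (par n i * par n j) *\<^sub>R \<Gamma> d k j i y" if "y \<in> cmap M d ` W"
        using \<Gamma>(2,3)[OF d kij, of y] sub(2) that by blast+
      show "P c k i j x = projective_coeff n m (\<Gamma> c) k i j x" if "x \<in> cmap M c ` W"
        using P\<Gamma>[OF c kij, of x] sub(1) that by blast
      show "P d k i j y = projective_coeff n m (\<Gamma> d) k i j y" if "y \<in> cmap M d ` W"
        using P\<Gamma>[OF d kij, of y] sub(2) that by blast
    next
      fix i j k' x
      assume ijk: "i < n + m" "j < n + m" "k' < n + m" and x: "x \<in> cmap M c ` W"
      have "pd n i (T.J j k') x = pd n i (jac n M c d j k') x"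
        by (rule pd_cong[OF T.V x J[OF ijk(3)]])
      moreover have "pull M c d W (\<Gamma> d k' i' j') x = pullback M c d (\<Gamma> d k' i' j') x"
        if "i' < n + m" "j' < n + m" for i' j'
        by (rule res[OF superfunctions_subset[OF \<Gamma>(1)[OF d ijk(3) that] sub(4)] x])
      ultimately show "(\<Sum>k<n+m. \<Gamma> c k i j x * T.J k k' x) = pd n i (T.J j k') x + (\<Sum>i'<n+m. \<Sum>j'<n+m.
          sg (par n i' * (par n j + par n j')) *\<^sub>R (T.J i i' x * T.J j j' x * pull M c d W (\<Gamma> d k' i' j') x))"
        using law[OF c d _ ijk, of x] x sub(3) ijk(3) by (simp add: J subset_iff)
    next
      fix x p'
      assume x: "x \<in> cmap M c ` W" and p': "\<And>i. i < n + m \<Longrightarrow> has_parity (par n i) (p' i)"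
      have "pull M c d W (S d i' j') x = pullback M c d (S d i' j') x" if "i' < n + m" "j' < n + m" for i' j'
        by (rule res[OF superfunctions_subset[OF S(1)[OF d that] sub(4)] x])
      then show "(\<Sum>i<n+m. \<Sum>j<n+m. S c i j x * (\<Sum>j'<n+m. T.J j j' x * p' j') * (\<Sum>i'<n+m. T.J i i' x * p' i')) =
          (\<Sum>i'<n+m. \<Sum>j'<n+m. pull M c d W (S d i' j') x * p' j' * p' i')"
        using quad[OF c d _ p', of x] x sub(3) by (simp add: J subset_iff)
    qed (rule nm)+
  qed
  have lap: "pull M c d W (proj_laplacian n m s (S d) (P d) F) x = proj_laplacian n m s (S c) (P c) (pull M c d W F) x"
    if "c \<in> charts M" "d \<in> charts M" "openin (base M) W" "W \<subseteq> cdom M c \<inter> cdom M d"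
      "F \<in> superfunctions n m (cmap M d ` W)" "x \<in> cmap M c ` W" for c d W F x
    by (rule geometry_change.proj_laplacian_transform[OF geometry[OF that(1-4)] that(5,6)])
  show ?thesis
  proof (intro conjI allI ballI impI)
    fix c d W F p
    assume "c \<in> charts M" "d \<in> charts M" "openin (base M) W \<and> W \<subseteq> cdom M c \<inter> cdom M d"
      "F \<in> superfunctions n m (cmap M d ` W)" "p \<in> W"
    then show "pull M c d W (proj_laplacian n m s (S d) (P d) F) (cmap M c p) =
        proj_laplacian n m s (S c) (P c) (pull M c d W F) (cmap M c p)"
      by (intro lap) auto
  next
    fix W f assume "openin (base M) W \<and> f \<in> sections n m M W"
    then have W: "openin (base M) W"
      and f: "\<And>c. c \<in> charts M \<Longrightarrow> f c \<in> superfunctions n m (cmap M c ` (W \<inter> cdom M c))"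
      and glue: "\<And>c d p. c \<in> charts M \<Longrightarrow> d \<in> charts M \<Longrightarrow> p \<in> W \<inter> cdom M c \<inter> cdom M d \<Longrightarrow>
        pull M c d (W \<inter> cdom M c \<inter> cdom M d) (f d) (cmap M c p) = f c (cmap M c p)"
      by (auto simp: sections_def)
    show "(\<lambda>c. proj_laplacian n m s (S c) (P c) (f c)) \<in> sections n m M W"
      unfolding sections_def
    proof (intro CollectI conjI ballI)
      fix c assume c: "c \<in> charts M"
      have sub: "cmap M c ` (W \<inter> cdom M c) \<subseteq> cmap M c ` cdom M c" by auto
      show "proj_laplacian n m s (S c) (P c) (f c) \<in> superfunctions n m (cmap M c ` (W \<inter> cdom M c))"
        by (intro superfunctions_proj_laplacian Vc c openin_Int W cdom f superfunctions_subset[OF _ sub] S PS) auto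
    next
      fix c d p assume c: "c \<in> charts M" and d: "d \<in> charts M" and p: "p \<in> W \<inter> cdom M c \<inter> cdom M d"
      let ?W = "W \<inter> cdom M c \<inter> cdom M d"
      have W': "openin (base M) ?W" by (intro openin_Int W cdom c d)
      have fd: "f d \<in> superfunctions n m (cmap M d ` ?W)"
        by (rule superfunctions_subset[OF f[OF d]]) auto
      have "pull M c d ?W (proj_laplacian n m s (S d) (P d) (f d)) (cmap M c p) =
          proj_laplacian n m s (S c) (P c) (pull M c d ?W (f d)) (cmap M c p)"
        by (rule lap[OF c d W' _ fd]) (use p in auto)
      \<comment> \<open>The pullback of \<open>f d\<close> agrees with \<open>f c\<close> on an open
        neighbourhood of the point, so the operator takes the same value on both.\<close>
      also have "\<dots> = proj_laplacian n m s (S c) (P c) (f c) (cmap M c p)"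
        by (rule proj_laplacian_cong[OF Vc[OF c W']]) (use p glue[OF c d] in auto)
      finally show "pull M c d ?W (proj_laplacian n m s (S d) (P d) (f d)) (cmap M c p) =
          proj_laplacian n m s (S c) (P c) (f c) (cmap M c p)" .
    qed
  next
    show "upper_connection_coeffs n m s M S (\<lambda>c. proj_gamma n m s (S c) (P c))"
      unfolding upper_connection_coeffs_def
    proof (intro conjI ballI allI impI)
      fix c i assume c: "c \<in> charts M" and i: "i < n + m"
      have V: "openin (Euclidean_space n) (cmap M c ` cdom M c)" by (rule Vc[OF c cdom[OF c] order_refl])
      show "proj_gamma n m s (S c) (P c) i \<in> superfunctions n m (cmap M c ` cdom M c)"
        by (rule superfunctions_proj_gamma[OF V S(1)[OF c] PS[OF c] i])
      show "has_parity (s + par n i) (proj_gamma n m s (S c) (P c) i x)" if x: "x \<in> cmap M c ` cdom M c" for x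
      proof (rule has_parity_proj_gamma[OF V S(1)[OF c] PS[OF c] S(2)[OF c] _ i x])
        fix k i j x assume "k < n + m" "i < n + m" "j < n + m" "x \<in> cmap M c ` cdom M c"
        then show "has_parity (par n i + par n j + par n k) (P c k i j x)"
          using \<Gamma>(2)[OF c] by (simp add: P\<Gamma>[OF c] has_parity_projective_coeff)
      qed
    next
      fix c d x i' assume c: "c \<in> charts M" and d: "d \<in> charts M"
        and x: "x \<in> cmap M c ` (cdom M c \<inter> cdom M d)" and i': "i' < n + m"
      note W = overlap_open[OF M c d] order_refl
      have J: "superdomain_morphism.J n (pullback M c d) i j = jac n M c d i j" for i j
        by (simp add: superdomain_morphism.J_def[OF pull_morphism[OF M c d W]] jac_def)
      show "pullback M c d (proj_gamma n m s (S d) (P d) i') x = (\<Sum>i<n+m. (proj_gamma n m s (S c) (P c) i x +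
          (\<Sum>j<n+m. S c i j x * pd n j (log_J n m M c d) x)) * jac n M c d i i' x)"
        using geometry_change.proj_gamma_transform[OF geometry[OF c d W] i' x]
        by (simp add: J log_J_def[abs_def])
    qed
  qed
qed

end
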